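(* Let $F=\{f_1,\ldots,f_r\}\subset K\{\mathbb{Y}\}$ be a system of difference polynomials which is quasi-regular at $\mathfrak{p}$ and satisfies the rank hypothesis stated in the context, let $e\ge1$ be the maximal order occurring in $F$, and let $\omega\in\mathbb{N}$ be the $\mathfrak{p}$-difference index of $F$. Then for every $i\in\mathbb{N}$ with $i\ge e-1$, the equality of ideals $$\Delta_{i-e+1+\omega}\cap B_i=\Delta\cap B_i$$ holds in the ring $B_i$. Furthermore, for every $i\in\mathbb{N}$ with $i\ge e-1$, $$\omega=\min\{h\in\mathbb{N}:\Delta_{i-e+1+h}\cap B_i=\Delta\cap B_i\}.$$
   Context: Difference algebra. A $\sigma$-ring is a commutative ring $R$ with a ring endomorphism $\sigma:R\to R$; a $\sigma$-field is a $\sigma$-ring that is a field. A $\sigma$-ideal $I$ of $R$ is an ideal with $\sigma(I)\subseteq I$; it is reflexive if $\sigma(a)\in I$ implies $a\in I$, and $\sigma$-prime if it is reflexive and a prime ideal. $[F]$ denotes the $\sigma$-ideal generated by a set $F$. $\mathbb{N}$ contains $0$. Setting. $K$ is a $\sigma$-field of characteristic $0$; $\mathbb{Y}=\{y_1,\ldots,y_n\}$ are $\sigma$-indeterminates, and $K\{\mathbb{Y}\}$ is the $\sigma$-polynomial ring, i.e. the polynomial ring over $K$ in the algebraically independent variables $y_j^{(l)}:=\sigma^l(y_j)$, $1\le j\le n$, $l\in\mathbb{N}$, with its natural $\sigma$. For an element $a$ put $a^{(l)}=\sigma^l(a)$ and $a^{[l]}=\{a,a^{(1)},\ldots,a^{(l)}\}$;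 for a set $S$ put $S^{(l)}=\{a^{(l)}:a\in S\}$, $S^{[l]}=\bigcup_{a\in S}a^{[l]}$. $F=\{f_1,\ldots,f_r\}\subset K\{\mathbb{Y}\}$, and $\mathfrak{p}\subset K\{\mathbb{Y}\}$ is a $\sigma$-prime ideal minimal over $[F]$ (minimal among $\sigma$-prime ideals containing $[F]$). $\epsilon_{ij}=\operatorname{ord}_{y_j}(f_i)$ is the largest $l$ such that $y_j^{(l)}$ occurs in $f_i$ (and $0$ if $y_j$ does not appear), $e=\max\epsilon_{ij}$, and it is assumed that $e\ge1$. $\kappa$ is the residue class field of $\mathfrak{p}$, i.e. the fraction field of $K\{\mathbb{Y}\}/\mathfrak{p}$. Rings and ideals. For $k\in\mathbb{N}$: $A_k=K[\mathbb{Y}^{[k]}]$; $B_k$ is the localization of $A_k$ at the prime ideal $A_k\cap\mathfrak{p}$; $\mathfrak{p}_k=A_{k-1+e}\cap\mathfrak{p}$; $\Delta_k$ is the ideal generated by $f_1^{[k-1]},\ldots,f_r^{[k-1]}$ in $B_{k-1+e}$, with $\Delta_0=(0)$. $\Delta$ denotes the $\sigma$-ideal generated by $F$ in $K\{\mathbb{Y}\}_{\mathfrak{p}}$. The rings $B_k$ are regarded as subrings of one another for increasing $k$ and of $K\{\mathbb{Y}\}_{\mathfrak{p}}$; thus $\Delta_{i-e+1+h}$ is an ideal of $B_{i+h}\supseteq B_i$. Quasi-regularity. $F$ is quasi-regular at $\mathfrak{p}$ if for every positive integer $k$ the Jacobian matrix of the polynomials $f_1^{[k-1]},\ldots,f_r^{[k-1]}$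 with respect to the variables $\mathbb{Y}^{[k-1+e]}$ has full row rank over the domain $A_{k-1+e}/\mathfrak{p}_k$, and $\Delta$ is reflexive. (In this case each $\Delta_k$ is a prime ideal of $B_{k-1+e}$.) Pseudo-Jacobian matrices. For $k\in\mathbb{N}$ and $i\ge e-1$, $J_{k,i}$ is the $kr\times kn$ matrix with $k\times k$ blocks of size $r\times n$ whose $(p,q)$ block ($1\le p,q\le k$) is the Jacobian matrix $\partial F^{(i-e+p)}/\partial \mathbb{Y}^{(i+q)}=\big(\partial f_a^{(i-e+p)}/\partial y_b^{(i+q)}\big)_{1\le a\le r,\,1\le b\le n}$ (zero for $q>p$). Put $\mu_{0,i}=0$ and $\mu_{k,i}=\dim_\kappa\ker(J_{k,i}^{\tau})=kr-\operatorname{rank}_\kappa(J_{k,i})$ for $k\ge1$ ($\tau$ denotes transpose). The number $\mu_{k,i}$ does not depend on $i\ge e-1$ and is denoted $\mu_k$. Rank hypothesis (standing). Let $\kappa(\Delta_k)$ be the residue class field of $\Delta_k$ in $B_{k-1+e}$ and $\kappa(\mathfrak{p}_k)$ the residue class field of $\mathfrak{p}_k$ in $A_{k-1+e}$. It is assumed that for all $k\in\mathbb{N}$, $i\ge e-1$ the rank of $J_{k,i}$ over $\kappa(\Delta_{i-e+1+k+s})$ does not depend on $s\in\mathbb{N}$; that is, the rank of $J_{k,i}$ over $\kappa(\Delta_{i-e+1+k})$, over $\kappa(\mathfrak{p}_{i-e+1+k})$ and over $\kappa$ is always the same. Difference index. There is a unique $\omega\in\mathbb{N}$ such that $\mu_k<\mu_{k+1}$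 for all $k<\omega$ and $\mu_k=\mu_{k+1}$ for all $k\ge\omega$; it is called the $\mathfrak{p}$-difference index of $F$. *)

theory Defs
  imports
    "HOL-Library.Poly_Mapping"
    "HOL-Library.Product_Lexorder"
    "HOL-Computational_Algebra.Fraction_Field"
    "HOL-Computational_Algebra.Polynomial_Factorial"
    "HOL-Algebra.QuotRing"
    "Jordan_Normal_Form.VS_Connect"
begin

section \<open>Subrings of a type, localizations, residue class fields\<close>

abbreviation ring_on :: "'a::{times,plus,one,zero} set \<Rightarrow> 'a ring" where
  "ring_on S \<equiv> class_ring\<lparr>carrier := S\<rparr>"

text \<open>The localization of the subring \<open>S\<close> of an integral domain at the prime ideal \<open>P\<close> of \<open>S\<close>,
  as a subring of the field of fractions of the ambient domain.\<close>

definition localization :: "'a::idom set \<Rightarrow> 'a set \<Rightarrow> 'a fract set" where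
  "localization S P = {to_fract a / to_fract s | a s. a \<in> S \<and> s \<in> S \<and> s \<notin> P}"

text \<open>The field of fractions of an integral domain given as a record.\<close>

definition fraction_rel :: "('a, 'm) ring_scheme \<Rightarrow> (('a \<times> 'a) \<times> ('a \<times> 'a)) set" where
  "fraction_rel D = {((a, b), (c, d)). a \<in> carrier D \<and> b \<in> carrier D - {\<zero>\<^bsub>D\<^esub>} \<and>
     c \<in> carrier D \<and> d \<in> carrier D - {\<zero>\<^bsub>D\<^esub>} \<and> a \<otimes>\<^bsub>D\<^esub> d = c \<otimes>\<^bsub>D\<^esub> b}"

definition fraction :: "('a, 'm) ring_scheme \<Rightarrow> 'a \<Rightarrow> 'a \<Rightarrow> ('a \<times> 'a) set" where
  "fraction D a b = fraction_rel D `` {(a, b)}"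

definition fraction_field :: "('a, 'm) ring_scheme \<Rightarrow> ('a \<times> 'a) set ring" where
  "fraction_field D = \<lparr>
     carrier = (carrier D \<times> (carrier D - {\<zero>\<^bsub>D\<^esub>})) // fraction_rel D,
     mult = (\<lambda>X Y. \<Union>(a, b)\<in>X. \<Union>(c, d)\<in>Y. fraction D (a \<otimes>\<^bsub>D\<^esub> c) (b \<otimes>\<^bsub>D\<^esub> d)),
     one = fraction D \<one>\<^bsub>D\<^esub> \<one>\<^bsub>D\<^esub>,
     zero = fraction D \<zero>\<^bsub>D\<^esub> \<one>\<^bsub>D\<^esub>,
     add = (\<lambda>X Y. \<Union>(a, b)\<in>X. \<Union>(c, d)\<in>Y.
       fraction D (a \<otimes>\<^bsub>D\<^esub> d \<oplus>\<^bsub>D\<^esub> c \<otimes>\<^bsub>D\<^esub> b) (b \<otimes>\<^bsub>D\<^esub> d))\<rparr>"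

definition residue_field :: "('a, 'm) ring_scheme \<Rightarrow> 'a set \<Rightarrow> ('a set \<times> 'a set) set ring" where
  "residue_field R P = fraction_field (R Quot P)"

definition residue_map :: "('a, 'm) ring_scheme \<Rightarrow> 'a set \<Rightarrow> 'a \<Rightarrow> ('a set \<times> 'a set) set" where
  "residue_map R P x = fraction (R Quot P) (P +>\<^bsub>R\<^esub> x) \<one>\<^bsub>R Quot P\<^esub>"

lemma UN_pairs_const:
  assumes "\<And>x y z w. (x, y) \<in> X \<Longrightarrow> (z, w) \<in> Y \<Longrightarrow> G x y z w = C" "u \<in> X" "v \<in> Y"
  shows "(\<Union>(x, y)\<in>X. \<Union>(z, w)\<in>Y. G x y z w) = C"
proof -
  have "(\<Union>(x, y)\<in>X. \<Union>(z, w)\<in>Y. G x y z w) = (\<Union>p\<in>X. \<Union>q\<in>Y. C)"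
    using assms(1) by (intro SUP_cong refl) (auto intro!: SUP_cong)
  thus ?thesis using assms(2,3) by auto
qed

lemma (in domain) fraction_rel_equiv: "equiv (carrier R \<times> (carrier R - {\<zero>})) (fraction_rel R)"
proof (rule equivI)
  show "fraction_rel R \<subseteq> (carrier R \<times> (carrier R - {\<zero>})) \<times> (carrier R \<times> (carrier R - {\<zero>}))"
    by (auto simp: fraction_rel_def)
  show "refl_on (carrier R \<times> (carrier R - {\<zero>})) (fraction_rel R)"
    by (auto simp: refl_on_def fraction_rel_def)
  show "sym (fraction_rel R)" by (auto simp: sym_def fraction_rel_def)
  show "trans (fraction_rel R)"
  proof (rule transI, clarify)
    fix a b c d x y
    assume "((a, b), c, d) \<in> fraction_rel R" "((c, d), x, y) \<in> fraction_rel R"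
    hence m: "a \<in> carrier R" "b \<in> carrier R" "c \<in> carrier R" "d \<in> carrier R" "x \<in> carrier R" "y \<in> carrier R"
      and n: "b \<noteq> \<zero>" "d \<noteq> \<zero>" "y \<noteq> \<zero>" and e1: "a \<otimes> d = c \<otimes> b" and e2: "c \<otimes> y = x \<otimes> d"
      by (auto simp: fraction_rel_def)
    have "d \<otimes> (a \<otimes> y) = (a \<otimes> d) \<otimes> y" using m by algebra
    also have "\<dots> = (c \<otimes> y) \<otimes> b" unfolding e1 using m by algebra
    also have "\<dots> = d \<otimes> (x \<otimes> b)" unfolding e2 using m by algebra
    finally have "a \<otimes> y = x \<otimes> b" using m n m_lcancel[of d] by simp
    thus "((a, b), x, y) \<in> fraction_rel R" using m n by (auto simp: fraction_rel_def)
  qed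
qed

lemma (in domain) fraction_eq_iff:
  assumes "a \<in> carrier R" "b \<in> carrier R - {\<zero>}" "c \<in> carrier R" "d \<in> carrier R - {\<zero>}"
  shows "fraction R a b = fraction R c d \<longleftrightarrow> a \<otimes> d = c \<otimes> b"
  unfolding fraction_def
  by (subst eq_equiv_class_iff[OF fraction_rel_equiv]) (use assms in \<open>auto simp: fraction_rel_def\<close>)

lemma (in domain) fraction_mem_iff:
  "(c, d) \<in> fraction R a b \<longleftrightarrow>
     a \<in> carrier R \<and> b \<in> carrier R - {\<zero>} \<and> c \<in> carrier R \<and> d \<in> carrier R - {\<zero>} \<and> a \<otimes> d = c \<otimes> b"
  by (auto simp: fraction_def fraction_rel_def)

lemma (in domain) carrier_fraction_field:
  "carrier (fraction_field R) = {fraction R a b | a b. a \<in> carrier R \<and> b \<in> carrier R - {\<zero>}}"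
  by (auto simp: fraction_field_def quotient_def fraction_def)

lemma (in domain) fraction_field_mult:
  assumes "a \<in> carrier R" "b \<in> carrier R - {\<zero>}" "c \<in> carrier R" "d \<in> carrier R - {\<zero>}"
  shows "fraction R a b \<otimes>\<^bsub>fraction_field R\<^esub> fraction R c d = fraction R (a \<otimes> c) (b \<otimes> d)"
proof -
  have *: "fraction R (x \<otimes> z) (y \<otimes> w) = fraction R (a \<otimes> c) (b \<otimes> d)"
    if "(x, y) \<in> fraction R a b" "(z, w) \<in> fraction R c d" for x y z w
  proof -
    from that have m: "x \<in> carrier R" "y \<in> carrier R" "z \<in> carrier R" "w \<in> carrier R"
      "y \<noteq> \<zero>" "w \<noteq> \<zero>" and e: "a \<otimes> y = x \<otimes> b" "c \<otimes> w = z \<otimes> d"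
      by (auto simp: fraction_mem_iff)
    have "x \<otimes> z \<otimes> (b \<otimes> d) = (x \<otimes> b) \<otimes> (z \<otimes> d)" using m assms by (simp add: m_ac)
    also have "\<dots> = a \<otimes> c \<otimes> (y \<otimes> w)" unfolding e[symmetric] using m assms by (simp add: m_ac)
    finally show ?thesis
      by (subst fraction_eq_iff) (use m assms in \<open>auto simp: integral_iff\<close>)
  qed
  have "(a, b) \<in> fraction R a b" "(c, d) \<in> fraction R c d"
    using assms by (auto simp: fraction_mem_iff)
  from UN_pairs_const[OF * this] show ?thesis by (simp add: fraction_field_def)
qed

lemma (in domain) fraction_field_add:
  assumes "a \<in> carrier R" "b \<in> carrier R - {\<zero>}" "c \<in> carrier R" "d \<in> carrier R - {\<zero>}"
  shows "fraction R a b \<oplus>\<^bsub>fraction_field R\<^esub> fraction R c d =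
           fraction R (a \<otimes> d \<oplus> c \<otimes> b) (b \<otimes> d)"
proof -
  have *: "fraction R (x \<otimes> w \<oplus> z \<otimes> y) (y \<otimes> w) = fraction R (a \<otimes> d \<oplus> c \<otimes> b) (b \<otimes> d)"
    if "(x, y) \<in> fraction R a b" "(z, w) \<in> fraction R c d" for x y z w
  proof -
    from that have m: "x \<in> carrier R" "y \<in> carrier R" "z \<in> carrier R" "w \<in> carrier R"
      "y \<noteq> \<zero>" "w \<noteq> \<zero>" and e: "a \<otimes> y = x \<otimes> b" "c \<otimes> w = z \<otimes> d"
      by (auto simp: fraction_mem_iff)
    have "(x \<otimes> w \<oplus> z \<otimes> y) \<otimes> (b \<otimes> d) = (x \<otimes> b) \<otimes> (w \<otimes> d) \<oplus> (z \<otimes> d) \<otimes> (y \<otimes> b)"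
      using m assms by (simp add: m_ac l_distr r_distr)
    also have "\<dots> = (a \<otimes> d \<oplus> c \<otimes> b) \<otimes> (y \<otimes> w)"
      unfolding e[symmetric] using m assms by (simp add: m_ac l_distr r_distr)
    finally show ?thesis
      by (subst fraction_eq_iff) (use m assms in \<open>auto simp: integral_iff\<close>)
  qed
  have "(a, b) \<in> fraction R a b" "(c, d) \<in> fraction R c d"
    using assms by (auto simp: fraction_mem_iff)
  from UN_pairs_const[OF * this] show ?thesis by (simp add: fraction_field_def)
qed

lemma (in domain) field_fraction_field: "field (fraction_field R)"
proof -
  let ?F = "fraction_field R"
  have one: "\<one>\<^bsub>?F\<^esub> = fraction R \<one> \<one>" and zero: "\<zero>\<^bsub>?F\<^esub> = fraction R \<zero> \<one>"
    by (simp_all add: fraction_field_def)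
  have E: "\<exists>a b. a \<in> carrier R \<and> b \<in> carrier R - {\<zero>} \<and> x = fraction R a b" if "x \<in> carrier ?F" for x
    using that by (auto simp: carrier_fraction_field)
  have in_F: "fraction R a b \<in> carrier ?F" if "a \<in> carrier R" "b \<in> carrier R" "b \<noteq> \<zero>" for a b
    using that by (auto simp: carrier_fraction_field)
  note S = one zero fraction_field_mult fraction_field_add in_F fraction_eq_iff integral_iff
  have "cring ?F"
  proof (intro cringI abelian_groupI comm_monoidI)
    fix x assume "x \<in> carrier ?F"
    from E[OF this] obtain a b where ab: "a \<in> carrier R" "b \<in> carrier R - {\<zero>}" "x = fraction R a b"
      by blast
    show "\<exists>y\<in>carrier ?F. y \<oplus>\<^bsub>?F\<^esub> x = \<zero>\<^bsub>?F\<^esub>"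
      by (rule bexI[of _ "fraction R (\<ominus> a) b"]) (use ab in \<open>simp_all add: S l_minus l_neg\<close>)
    show "\<zero>\<^bsub>?F\<^esub> \<oplus>\<^bsub>?F\<^esub> x = x" "\<one>\<^bsub>?F\<^esub> \<otimes>\<^bsub>?F\<^esub> x = x" using ab by (simp_all add: S)
    fix y assume "y \<in> carrier ?F"
    from E[OF this] obtain c d where cd: "c \<in> carrier R" "d \<in> carrier R - {\<zero>}" "y = fraction R c d"
      by blast
    show "x \<oplus>\<^bsub>?F\<^esub> y \<in> carrier ?F" "x \<otimes>\<^bsub>?F\<^esub> y \<in> carrier ?F" using ab cd by (simp_all add: S)
    show "x \<oplus>\<^bsub>?F\<^esub> y = y \<oplus>\<^bsub>?F\<^esub> x" "x \<otimes>\<^bsub>?F\<^esub> y = y \<otimes>\<^bsub>?F\<^esub> x"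
      using ab cd by (simp_all add: S m_ac a_ac)
    fix z assume "z \<in> carrier ?F"
    from E[OF this] obtain u v where uv: "u \<in> carrier R" "v \<in> carrier R - {\<zero>}" "z = fraction R u v"
      by blast
    show "x \<otimes>\<^bsub>?F\<^esub> y \<otimes>\<^bsub>?F\<^esub> z = x \<otimes>\<^bsub>?F\<^esub> (y \<otimes>\<^bsub>?F\<^esub> z)"
      using ab cd uv by (simp add: S m_ac)
    have "(a \<otimes> d \<oplus> c \<otimes> b) \<otimes> v \<oplus> u \<otimes> (b \<otimes> d) = a \<otimes> (d \<otimes> v) \<oplus> (c \<otimes> v \<oplus> u \<otimes> d) \<otimes> b"
      using ab cd uv by (simp add: l_distr r_distr m_ac a_ac)
    thus "x \<oplus>\<^bsub>?F\<^esub> y \<oplus>\<^bsub>?F\<^esub> z = x \<oplus>\<^bsub>?F\<^esub> (y \<oplus>\<^bsub>?F\<^esub> z)"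
      using ab cd uv by (simp add: S m_assoc)
    have "(a \<otimes> d \<oplus> c \<otimes> b) \<otimes> u \<otimes> ((b \<otimes> v) \<otimes> (d \<otimes> v)) =
      (a \<otimes> u \<otimes> (d \<otimes> v) \<oplus> c \<otimes> u \<otimes> (b \<otimes> v)) \<otimes> (b \<otimes> d \<otimes> v)"
      using ab cd uv by (simp add: l_distr r_distr m_ac)
    thus "(x \<oplus>\<^bsub>?F\<^esub> y) \<otimes>\<^bsub>?F\<^esub> z = x \<otimes>\<^bsub>?F\<^esub> z \<oplus>\<^bsub>?F\<^esub> y \<otimes>\<^bsub>?F\<^esub> z"
      using ab cd uv by (simp add: S)
  qed (simp_all add: S)
  then interpret F: cring ?F .
  show ?thesis
  proof (rule F.cring_fieldI2)
    show "\<zero>\<^bsub>?F\<^esub> \<noteq> \<one>\<^bsub>?F\<^esub>" by (simp add: S)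
    fix x assume "x \<in> carrier ?F" "x \<noteq> \<zero>\<^bsub>?F\<^esub>"
    from E[OF this(1)] obtain a b where ab: "a \<in> carrier R" "b \<in> carrier R - {\<zero>}" "x = fraction R a b"
      by blast
    from ab \<open>x \<noteq> \<zero>\<^bsub>?F\<^esub>\<close> have "a \<noteq> \<zero>" by (auto simp: zero fraction_eq_iff)
    show "\<exists>y\<in>carrier ?F. x \<otimes>\<^bsub>?F\<^esub> y = \<one>\<^bsub>?F\<^esub>"
      by (rule bexI[of _ "fraction R b a"]) (use ab \<open>a \<noteq> \<zero>\<close> in \<open>simp_all add: S m_comm\<close>)
  qed
qed

lemma field_residue_field:
  assumes "primeideal P R"
  shows "field (residue_field R P)"
  unfolding residue_field_def
  using primeideal.quotient_is_domain[OF assms] domain.field_fraction_field by blast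

section \<open>Rank and left kernel of a matrix over a field\<close>

text \<open>A matrix with row index set \<open>I\<close> and column index set \<open>J\<close> is a function \<open>M\<close> of two
  arguments; \<^const>\<open>ring.func_space\<close> is the space of all functions from an index set to the field.
  The rank is the dimension of the column space.\<close>

definition mat_rank ::
    "('a, 'm) ring_scheme \<Rightarrow> 'i set \<Rightarrow> 'j set \<Rightarrow> ('i \<Rightarrow> 'j \<Rightarrow> 'a) \<Rightarrow> nat" where
  "mat_rank k I J M = (let V = ring.func_space k I in
     vectorspace.dim k
       (V\<lparr>carrier := LinearCombinations.module.span k V ((\<lambda>j. \<lambda>i\<in>I. M i j) ` J)\<rparr>))"

definition left_kernel ::
    "('a, 'm) ring_scheme \<Rightarrow> 'i set \<Rightarrow> 'j set \<Rightarrow> ('i \<Rightarrow> 'j \<Rightarrow> 'a) \<Rightarrow> ('i \<Rightarrow> 'a) set" where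
  "left_kernel k I J M = {x \<in> carrier (ring.func_space k I).
     \<forall>j\<in>J. (\<Oplus>\<^bsub>k\<^esub>i\<in>I. M i j \<otimes>\<^bsub>k\<^esub> x i) = \<zero>\<^bsub>k\<^esub>}"

definition left_kernel_dim ::
    "('a, 'm) ring_scheme \<Rightarrow> 'i set \<Rightarrow> 'j set \<Rightarrow> ('i \<Rightarrow> 'j \<Rightarrow> 'a) \<Rightarrow> nat" where
  "left_kernel_dim k I J M =
     vectorspace.dim k ((ring.func_space k I)\<lparr>carrier := left_kernel k I J M\<rparr>)"

section \<open>Difference rings\<close>

definition sigma_ideal :: "('a, 'm) ring_scheme \<Rightarrow> ('a \<Rightarrow> 'a) \<Rightarrow> 'a set \<Rightarrow> bool" where
  "sigma_ideal R \<sigma> I \<longleftrightarrow> ideal I R \<and> \<sigma> ` I \<subseteq> I"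

definition sigma_reflexive :: "('a, 'm) ring_scheme \<Rightarrow> ('a \<Rightarrow> 'a) \<Rightarrow> 'a set \<Rightarrow> bool" where
  "sigma_reflexive R \<sigma> I \<longleftrightarrow> (\<forall>a\<in>carrier R. \<sigma> a \<in> I \<longrightarrow> a \<in> I)"

definition sigma_prime :: "('a, 'm) ring_scheme \<Rightarrow> ('a \<Rightarrow> 'a) \<Rightarrow> 'a set \<Rightarrow> bool" where
  "sigma_prime R \<sigma> I \<longleftrightarrow> sigma_ideal R \<sigma> I \<and> sigma_reflexive R \<sigma> I \<and> primeideal I R"

definition sigma_genideal :: "('a, 'm) ring_scheme \<Rightarrow> ('a \<Rightarrow> 'a) \<Rightarrow> 'a set \<Rightarrow> 'a set" where
  "sigma_genideal R \<sigma> S = \<Inter>{I. sigma_ideal R \<sigma> I \<and> S \<subseteq> I}"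

definition minimal_sigma_prime ::
    "('a, 'm) ring_scheme \<Rightarrow> ('a \<Rightarrow> 'a) \<Rightarrow> 'a set \<Rightarrow> 'a set \<Rightarrow> bool" where
  "minimal_sigma_prime R \<sigma> S P \<longleftrightarrow>
     sigma_prime R \<sigma> P \<and> sigma_genideal R \<sigma> S \<subseteq> P \<and>
     (\<forall>Q. sigma_prime R \<sigma> Q \<and> sigma_genideal R \<sigma> S \<subseteq> Q \<and> Q \<subseteq> P \<longrightarrow> Q = P)"

text \<open>The extension of an injective ring endomorphism to the field of fractions.\<close>

definition fract_map :: "('a::idom \<Rightarrow> 'a) \<Rightarrow> 'a fract \<Rightarrow> 'a fract" where
  "fract_map h x =
     (THE y. \<exists>a b. b \<noteq> 0 \<and> x = to_fract a / to_fract b \<and> y = to_fract (h a) / to_fract (h b))"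

lemma fract_map_eq:
  assumes "comm_ring_hom h" "inj h" "b \<noteq> 0"
  shows "fract_map h (to_fract a / to_fract b) = to_fract (h a) / to_fract (h b)"
proof -
  interpret comm_ring_hom h by fact
  have nz: "h x \<noteq> 0" if "x \<noteq> 0" for x
    using that injD[OF \<open>inj h\<close>, of x 0] by auto
  have key: "to_fract (h a) / to_fract (h b) = to_fract (h c) / to_fract (h d)"
    if "d \<noteq> 0" "to_fract a / to_fract b = to_fract c / to_fract d" for c d
  proof -
    have "to_fract (a * d) = to_fract (c * b)"
      using that assms(3) by (simp add: frac_eq_eq)
    hence "h (a * d) = h (c * b)" by (simp only: to_fract_eq_iff)
    hence "to_fract (h a) * to_fract (h d) = to_fract (h c) * to_fract (h b)"
      by (simp only: hom_mult to_fract_mult [symmetric])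
    thus ?thesis using that assms(3) nz by (simp add: frac_eq_eq)
  qed
  show ?thesis
    unfolding fract_map_def
  proof (rule the_equality)
    show "\<exists>c d. d \<noteq> 0 \<and> to_fract a / to_fract b = to_fract c / to_fract d \<and>
            to_fract (h a) / to_fract (h b) = to_fract (h c) / to_fract (h d)"
      by (intro exI[of _ a] exI[of _ b] conjI refl assms(3))
  qed (auto dest!: key)
qed

section \<open>Difference polynomials\<close>

text \<open>The variable \<open>y\<^sub>j\<^sup>(\<^sup>l\<^sup>)\<close> is the pair \<open>(j, l)\<close>, so that the whole type \<open>('n, 'k) dpoly\<close> is
  the ring \<open>K{Y}\<close>. The order on \<open>'n\<close> has no mathematical role: the library derives from it
  that polynomials form an integral domain.\<close>

type_synonym ('n, 'k) dpoly = "(('n \<times> nat) \<Rightarrow>\<^sub>0 nat) \<Rightarrow>\<^sub>0 'k"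

definition shift_monom :: "('n \<times> nat \<Rightarrow>\<^sub>0 nat) \<Rightarrow> ('n \<times> nat \<Rightarrow>\<^sub>0 nat)" where
  "shift_monom m =
     (\<Sum>v\<in>Poly_Mapping.keys m. Poly_Mapping.single (fst v, Suc (snd v)) (Poly_Mapping.lookup m v))"

text \<open>The endomorphism of \<open>K{Y}\<close> given by \<open>\<sigma>\<close> on \<open>K\<close> and \<open>y\<^sub>j\<^sup>(\<^sup>l\<^sup>) \<mapsto> y\<^sub>j\<^sup>(\<^sup>l\<^sup>+\<^sup>1\<^sup>)\<close>.\<close>

definition sigma_poly :: "('k::comm_ring_1 \<Rightarrow> 'k) \<Rightarrow> ('n, 'k) dpoly \<Rightarrow> ('n, 'k) dpoly" where
  "sigma_poly \<sigma> g =
     (\<Sum>m\<in>Poly_Mapping.keys g. Poly_Mapping.single (shift_monom m) (\<sigma> (Poly_Mapping.lookup g m)))"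

lemma sigma_poly_superset:
  assumes "comm_ring_hom \<sigma>" "finite S" "Poly_Mapping.keys g \<subseteq> S"
  shows "sigma_poly \<sigma> g =
    (\<Sum>m\<in>S. Poly_Mapping.single (shift_monom m) (\<sigma> (Poly_Mapping.lookup g m)))"
proof -
  interpret comm_ring_hom \<sigma> by fact
  show ?thesis unfolding sigma_poly_def
    by (rule sum.mono_neutral_left) (use assms in \<open>auto simp: in_keys_iff\<close>)
qed

lemma shift_monom_superset:
  assumes "finite S" "Poly_Mapping.keys g \<subseteq> S"
  shows "shift_monom g =
    (\<Sum>v\<in>S. Poly_Mapping.single (fst v, Suc (snd v)) (Poly_Mapping.lookup g v))"
  unfolding shift_monom_def
  by (rule sum.mono_neutral_left) (use assms in \<open>auto simp: in_keys_iff\<close>)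

lemma shift_monom_add: "shift_monom (a + b) = shift_monom a + shift_monom b"
proof -
  let ?S = "Poly_Mapping.keys a \<union> Poly_Mapping.keys b"
  have "Poly_Mapping.keys (a + b) \<subseteq> ?S" by (rule Poly_Mapping.keys_add)
  thus ?thesis
    by (simp add: shift_monom_superset[of ?S] lookup_add single_add sum.distrib)
qed

lemma lookup_shift_monom [simp]: "Poly_Mapping.lookup (shift_monom a) (j, Suc l) = Poly_Mapping.lookup a (j, l)"
proof -
  have "Poly_Mapping.lookup (shift_monom a) (j, Suc l) =
     (\<Sum>v\<in>insert (j,l) (Poly_Mapping.keys a). if v = (j,l) then Poly_Mapping.lookup a v else 0)"
    by (subst shift_monom_superset[of "insert (j,l) (Poly_Mapping.keys a)"])
       (auto simp: lookup_sum lookup_single when_def prod_eq_iff intro!: sum.cong)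
  also have "\<dots> = Poly_Mapping.lookup a (j, l)" by (subst sum.delta) auto
  finally show ?thesis .
qed

lemma inj_shift_monom: "inj shift_monom"
proof (rule injI)
  fix a b :: "'n \<times> nat \<Rightarrow>\<^sub>0 nat" assume *: "shift_monom a = shift_monom b"
  show "a = b"
  proof (rule poly_mapping_eqI)
    fix v show "Poly_Mapping.lookup a v = Poly_Mapping.lookup b v"
      using lookup_shift_monom[of a "fst v" "snd v"] lookup_shift_monom[of b "fst v" "snd v"] * by simp
  qed
qed

lemma lookup_sigma_poly:
  assumes "comm_ring_hom \<sigma>"
  shows "Poly_Mapping.lookup (sigma_poly \<sigma> g) (shift_monom m) = \<sigma> (Poly_Mapping.lookup g m)"
proof -
  interpret comm_ring_hom \<sigma> by fact
  have "Poly_Mapping.lookup (sigma_poly \<sigma> g) (shift_monom m) =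
     (\<Sum>v\<in>insert m (Poly_Mapping.keys g). if v = m then \<sigma> (Poly_Mapping.lookup g v) else 0)"
    by (subst sigma_poly_superset[OF assms, of "insert m (Poly_Mapping.keys g)"])
       (auto simp: lookup_sum lookup_single when_def inj_eq[OF inj_shift_monom] intro!: sum.cong)
  also have "\<dots> = \<sigma> (Poly_Mapping.lookup g m)" by (subst sum.delta) auto
  finally show ?thesis .
qed

lemma inj_sigma_poly:
  assumes "comm_ring_hom \<sigma>" "inj \<sigma>"
  shows "inj (sigma_poly \<sigma>)"
proof (rule injI)
  fix g h :: "('n, 'a) dpoly" assume *: "sigma_poly \<sigma> g = sigma_poly \<sigma> h"
  show "g = h"
    by (rule poly_mapping_eqI) (metis "*" assms(1,2) injD lookup_sigma_poly)
qed

lemma sigma_poly_single: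
  assumes "comm_ring_hom \<sigma>"
  shows "sigma_poly \<sigma> (Poly_Mapping.single m c) = Poly_Mapping.single (shift_monom m) (\<sigma> c)"
proof -
  interpret comm_ring_hom \<sigma> by fact
  show ?thesis by (simp add: sigma_poly_def)
qed

lemma sigma_poly_add:
  assumes "comm_ring_hom \<sigma>"
  shows "sigma_poly \<sigma> (g + h) = sigma_poly \<sigma> g + sigma_poly \<sigma> h"
proof -
  interpret comm_ring_hom \<sigma> by fact
  let ?S = "Poly_Mapping.keys g \<union> Poly_Mapping.keys h"
  have "Poly_Mapping.keys (g + h) \<subseteq> ?S" by (rule Poly_Mapping.keys_add)
  thus ?thesis
    by (simp add: sigma_poly_superset[OF assms, of ?S] lookup_add hom_add single_add sum.distrib)
qed

lemma poly_mapping_eq_sum_single: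
  "g = (\<Sum>m\<in>Poly_Mapping.keys g. Poly_Mapping.single m (Poly_Mapping.lookup g m))"
  by (rule poly_mapping_eqI) (simp add: lookup_sum lookup_single when_def sum.delta' in_keys_iff)

lemma sigma_poly_sum:
  assumes "comm_ring_hom \<sigma>"
  shows "sigma_poly \<sigma> (\<Sum>i\<in>I. g i) = (\<Sum>i\<in>I. sigma_poly \<sigma> (g i))"
  by (induction I rule: infinite_finite_induct)
     (simp_all add: sigma_poly_add[OF assms] sigma_poly_def[of _ 0])

lemma comm_ring_hom_sigma_poly:
  assumes "comm_ring_hom \<sigma>"
  shows "comm_ring_hom (sigma_poly \<sigma> :: ('n, 'k::comm_ring_1) dpoly \<Rightarrow> ('n, 'k) dpoly)"
proof -
  interpret comm_ring_hom \<sigma> by fact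
  have mult: "sigma_poly \<sigma> (g * h) = sigma_poly \<sigma> g * sigma_poly \<sigma> h" for g h :: "('n, 'k) dpoly"
  proof -
    have "g * h = (\<Sum>m\<in>Poly_Mapping.keys g. \<Sum>m'\<in>Poly_Mapping.keys h.
        Poly_Mapping.single (m + m') (Poly_Mapping.lookup g m * Poly_Mapping.lookup h m'))"
      by (subst (1) poly_mapping_eq_sum_single[of g], subst (1) poly_mapping_eq_sum_single[of h])
         (simp add: sum_product mult_single)
    hence "sigma_poly \<sigma> (g * h) = (\<Sum>m\<in>Poly_Mapping.keys g. \<Sum>m'\<in>Poly_Mapping.keys h.
        Poly_Mapping.single (shift_monom m) (\<sigma> (Poly_Mapping.lookup g m)) *
        Poly_Mapping.single (shift_monom m') (\<sigma> (Poly_Mapping.lookup h m')))"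
      by (simp add: sigma_poly_sum[OF assms] sigma_poly_single[OF assms] mult_single
            shift_monom_add hom_mult)
    also have "\<dots> = sigma_poly \<sigma> g * sigma_poly \<sigma> h"
      by (simp add: sigma_poly_def sum_product)
    finally show ?thesis .
  qed
  have one: "sigma_poly \<sigma> (1 :: ('n, 'k) dpoly) = 1"
    by (simp add: sigma_poly_single[OF assms] shift_monom_def flip: single_one)
  show ?thesis
    by unfold_locales (use mult one sigma_poly_add[OF assms] in \<open>auto simp: sigma_poly_def[of _ 0]\<close>)
qed

definition dpartial :: "'n \<times> nat \<Rightarrow> ('n, 'k::comm_ring_1) dpoly \<Rightarrow> ('n, 'k) dpoly" where
  "dpartial v g = (\<Sum>m\<in>Poly_Mapping.keys g.
     Poly_Mapping.single (m - Poly_Mapping.single v 1)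
       (of_nat (Poly_Mapping.lookup m v) * Poly_Mapping.lookup g m))"

definition dvars :: "('n, 'k::zero) dpoly \<Rightarrow> ('n \<times> nat) set" where
  "dvars g = (\<Union>m\<in>Poly_Mapping.keys g. Poly_Mapping.keys m)"

definition dord :: "'n \<Rightarrow> ('n, 'k::zero) dpoly \<Rightarrow> nat" where
  "dord j g = (if \<exists>l. (j, l) \<in> dvars g then Max {l. (j, l) \<in> dvars g} else 0)"

definition max_ord :: "('r::finite \<Rightarrow> ('n::finite, 'k::zero) dpoly) \<Rightarrow> nat" where
  "max_ord f = Max (range (\<lambda>(a, j). dord j (f a)))"

definition A_ring :: "nat \<Rightarrow> ('n, 'k::zero) dpoly set" where
  "A_ring k = {g. dvars g \<subseteq> UNIV \<times> {..k}}"

definition B_ring :: "('n::linorder, 'k::field) dpoly set \<Rightarrow> nat \<Rightarrow> ('n, 'k) dpoly fract set" where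
  "B_ring P k = localization (A_ring k) (A_ring k \<inter> P)"

text \<open>In the next two definitions the index \<open>k + max_ord f - 1\<close> is to be read with
  \<open>max_ord f \<ge> 1\<close>.\<close>

definition P_trunc ::
    "('r::finite \<Rightarrow> ('n::finite, 'k::zero) dpoly) \<Rightarrow> ('n, 'k) dpoly set \<Rightarrow> nat \<Rightarrow> ('n, 'k) dpoly set"
  where "P_trunc f P k = A_ring (k + max_ord f - 1) \<inter> P"

text \<open>For \<open>k = 0\<close> the set of generators is empty, which gives the zero ideal.\<close>

definition Delta_trunc ::
    "('k::field \<Rightarrow> 'k) \<Rightarrow> ('r::finite \<Rightarrow> ('n::{finite,linorder}, 'k) dpoly) \<Rightarrow>
     ('n, 'k) dpoly set \<Rightarrow> nat \<Rightarrow> ('n, 'k) dpoly fract set" where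
  "Delta_trunc \<sigma> f P k = genideal (ring_on (B_ring P (k + max_ord f - 1)))
     {to_fract ((sigma_poly \<sigma> ^^ l) (f a)) | a l. l < k}"

definition Delta ::
    "('k::field \<Rightarrow> 'k) \<Rightarrow> ('r::finite \<Rightarrow> ('n::{finite,linorder}, 'k) dpoly) \<Rightarrow>
     ('n, 'k) dpoly set \<Rightarrow> ('n, 'k) dpoly fract set" where
  "Delta \<sigma> f P = sigma_genideal (ring_on (localization UNIV P)) (fract_map (sigma_poly \<sigma>))
     (range (\<lambda>a. to_fract (f a)))"

section \<open>Quasi-regularity, pseudo-Jacobian matrices and the difference index\<close>

definition prolonged_jacobian ::
    "('k::field \<Rightarrow> 'k) \<Rightarrow> ('r \<Rightarrow> ('n, 'k) dpoly) \<Rightarrow> nat \<times> 'r \<Rightarrow> nat \<times> 'n \<Rightarrow> ('n, 'k) dpoly" where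
  "prolonged_jacobian \<sigma> f = (\<lambda>(l, a) (m, b). dpartial (b, m) ((sigma_poly \<sigma> ^^ l) (f a)))"

definition quasi_regular ::
    "('k::field \<Rightarrow> 'k) \<Rightarrow> ('r::finite \<Rightarrow> ('n::{finite,linorder}, 'k) dpoly) \<Rightarrow>
     ('n, 'k) dpoly set \<Rightarrow> bool" where
  "quasi_regular \<sigma> f P \<longleftrightarrow>
     (\<forall>k\<ge>1. let R = ring_on (A_ring (k - 1 + max_ord f)); Q = P_trunc f P k in
        mat_rank (residue_field R Q) ({..k - 1} \<times> UNIV) ({..k - 1 + max_ord f} \<times> UNIV)
          (\<lambda>u v. residue_map R Q (prolonged_jacobian \<sigma> f u v)) = k * card (UNIV :: 'r set)) \<and>
     sigma_reflexive (ring_on (localization UNIV P)) (fract_map (sigma_poly \<sigma>)) (Delta \<sigma> f P)"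

text \<open>The row index \<open>(p, a)\<close> denotes row \<open>a\<close> of block row \<open>p\<close>, the column index \<open>(q, b)\<close> column
  \<open>b\<close> of block column \<open>q\<close>, with \<open>1 \<le> p, q \<le> k\<close>. For \<open>i \<ge> max_ord f - 1\<close> the subtraction
  below does not truncate.\<close>

definition pseudo_jacobian ::
    "('k::field \<Rightarrow> 'k) \<Rightarrow> ('r::finite \<Rightarrow> ('n::finite, 'k) dpoly) \<Rightarrow> nat \<Rightarrow>
     nat \<times> 'r \<Rightarrow> nat \<times> 'n \<Rightarrow> ('n, 'k) dpoly" where
  "pseudo_jacobian \<sigma> f i =
     (\<lambda>(p, a) (q, b). dpartial (b, i + q) ((sigma_poly \<sigma> ^^ (i + p - max_ord f)) (f a)))"

definition pseudo_rank ::
    "('a, 'm) ring_scheme \<Rightarrow> 'a set \<Rightarrow> (('n, 'k) dpoly \<Rightarrow> 'a) \<Rightarrow> ('k::field \<Rightarrow> 'k) \<Rightarrow>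
     ('r::finite \<Rightarrow> ('n::finite, 'k) dpoly) \<Rightarrow> nat \<Rightarrow> nat \<Rightarrow> nat" where
  "pseudo_rank R Q \<phi> \<sigma> f k i = mat_rank (residue_field R Q) ({1..k} \<times> UNIV) ({1..k} \<times> UNIV)
     (\<lambda>u v. residue_map R Q (\<phi> (pseudo_jacobian \<sigma> f i u v)))"

definition rank_hypothesis ::
    "('k::field \<Rightarrow> 'k) \<Rightarrow> ('r::finite \<Rightarrow> ('n::{finite,linorder}, 'k) dpoly) \<Rightarrow>
     ('n, 'k) dpoly set \<Rightarrow> bool" where
  "rank_hypothesis \<sigma> f P \<longleftrightarrow> (\<forall>k i. i \<ge> max_ord f - 1 \<longrightarrow>
     (let e = max_ord f;
          m = i + 1 - e + k;
          rank_Delta = (\<lambda>h. pseudo_rank (ring_on (B_ring P (h + e - 1))) (Delta_trunc \<sigma> f P h)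
                              to_fract \<sigma> f k i);
          rank_trunc = pseudo_rank (ring_on (A_ring (m + e - 1))) (P_trunc f P m) id \<sigma> f k i;
          rank_full = pseudo_rank class_ring P id \<sigma> f k i
      in (\<forall>s. rank_Delta (m + s) = rank_Delta m) \<and>
         rank_Delta m = rank_trunc \<and> rank_trunc = rank_full))"

definition mu_at ::
    "('k::field \<Rightarrow> 'k) \<Rightarrow> ('r::finite \<Rightarrow> ('n::finite, 'k) dpoly) \<Rightarrow>
     ('n, 'k) dpoly set \<Rightarrow> nat \<Rightarrow> nat \<Rightarrow> nat" where
  "mu_at \<sigma> f P k i = left_kernel_dim (residue_field class_ring P) ({1..k} \<times> UNIV) ({1..k} \<times> UNIV)
     (\<lambda>u v. residue_map class_ring P (pseudo_jacobian \<sigma> f i u v))"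

text \<open>The value \<open>mu_at \<sigma> f P k i\<close> is the same for all \<open>i \<ge> max_ord f - 1\<close>; the smallest such
  \<open>i\<close> is used to define \<open>\<mu>\<^sub>k\<close>.\<close>

definition mu ::
    "('k::field \<Rightarrow> 'k) \<Rightarrow> ('r::finite \<Rightarrow> ('n::finite, 'k) dpoly) \<Rightarrow>
     ('n, 'k) dpoly set \<Rightarrow> nat \<Rightarrow> nat" where
  "mu \<sigma> f P k = mu_at \<sigma> f P k (max_ord f - 1)"

definition is_difference_index ::
    "('k::field \<Rightarrow> 'k) \<Rightarrow> ('r::finite \<Rightarrow> ('n::finite, 'k) dpoly) \<Rightarrow>
     ('n, 'k) dpoly set \<Rightarrow> nat \<Rightarrow> bool" where
  "is_difference_index \<sigma> f P \<omega> \<longleftrightarrow>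
     (\<forall>k<\<omega>. mu \<sigma> f P k < mu \<sigma> f P (Suc k)) \<and> (\<forall>k\<ge>\<omega>. mu \<sigma> f P k = mu \<sigma> f P (Suc k))"

lemma difference_index_unique:
  assumes "is_difference_index \<sigma> f P a" "is_difference_index \<sigma> f P b"
  shows "a = b"
proof (cases a b rule: linorder_cases)
  case less
  thus ?thesis using assms unfolding is_difference_index_def by (metis less_irrefl order_refl)
next
  case greater
  thus ?thesis using assms unfolding is_difference_index_def by (metis less_irrefl order_refl)
qed

end

theory Submission
  imports Defs
begin

text \<open>Write \<open>\<Delta>\<^sub>k\<close>, \<open>B\<^sub>i\<close>, \<open>\<mu>\<^sub>k\<close> as in the paper. By quasi-regularity the generators of \<open>\<Delta>\<^sub>k\<close> have a
  Jacobian matrix of full row rank at \<open>P\<close>, so there are derivations of the local ring that are dual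
  to the generators and derivations that kill them. The latter preserve \<open>\<Delta>\<^sub>k\<close>, they act on the
  maximal ideal modulo \<open>\<Delta>\<^sub>k\<close> like partial derivatives, and every proper ideal stable under them lies in
  \<open>\<Delta>\<^sub>k\<close>, by an Euler operator and Krull's intersection theorem. The elements of the maximal ideal
  all of whose iterated derivatives stay in it form such an ideal, which is moreover prime; it is
  therefore \<open>\<Delta>\<^sub>k\<close>. Hence the ideals \<open>\<Delta>\<^sub>i\<^sub>-\<^sub>e\<^sub>+\<^sub>1\<^sub>+\<^sub>k \<inter> B\<^sub>i\<close> form an ascending chain of primes. The transcendence
  degree of the residue field of the \<open>k\<close>-th one can be read off from derivations into the residue
  field of \<open>\<Delta>\<^sub>i\<^sub>-\<^sub>e\<^sub>+\<^sub>1\<^sub>+\<^sub>k\<close>, that is, from ranks of Jacobian matrices; by the rank hypothesis it is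
  \<open>n (i + 1) - r (i - e + 1) - \<mu>\<^sub>k\<close>. Nested primes with residue fields of equal transcendence degree
  coincide, so the chain grows exactly where \<open>\<mu>\<close> does.\<close>

section \<open>Ideals of subrings\<close>

text \<open>\<open>mu\<close> is a corank over the residue field of P, whereas each ideal of the
  chain has a residue field of its own; the rank hypothesis bridges the two. For the ideal with
  index h = i - e + 1 + k, the gradients of its generators are taken together with the unit vectors
  of the variables of order at most i. Modulo the ideal these rows have two bases: all gradients
  with a transcendence basis E of the residue field in the variables of order at most i, and all
  unit vectors with a row basis of the pseudo-Jacobian block, which has k r - \<open>mu\<close> k
  elements. Equal sizes give card E. The count happens over the residue field of the ideal and so
  presupposes its primality. Characteristic 0 enters through the separability of minimal relations,
  the division by n after the Euler operator, and the cancellation of an integer in the Leibniz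
  rule. Rings and ideals are plain subsets of a type, and linear algebra over a residue field is
  done on representatives, so that all local rings lie in one field of fractions and can be
  intersected directly.\<close>

locale set_ring =
  fixes R :: "'a::comm_ring_1 set"
  assumes one_closed: "1 \<in> R"
    and diff_closed: "x \<in> R \<Longrightarrow> y \<in> R \<Longrightarrow> x - y \<in> R"
    and mult_closed: "x \<in> R \<Longrightarrow> y \<in> R \<Longrightarrow> x * y \<in> R"
begin

lemma zero_closed: "0 \<in> R"
  using diff_closed[OF one_closed one_closed] by simp

lemma uminus_closed: "x \<in> R \<Longrightarrow> - x \<in> R"
  using diff_closed[OF zero_closed] by fastforce

lemma add_closed: "x \<in> R \<Longrightarrow> y \<in> R \<Longrightarrow> x + y \<in> R"
  using diff_closed[of x "- y"] uminus_closed by simp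

lemma sum_closed: "(\<And>i. i \<in> A \<Longrightarrow> g i \<in> R) \<Longrightarrow> sum g A \<in> R"
  by (induction A rule: infinite_finite_induct) (auto intro: zero_closed add_closed)

lemma power_closed: "x \<in> R \<Longrightarrow> x ^ n \<in> R"
  by (induction n) (auto intro: one_closed mult_closed)

lemma of_nat_closed: "of_nat n \<in> R"
  by (induction n) (auto intro: zero_closed one_closed add_closed)

lemmas closed = zero_closed one_closed add_closed diff_closed uminus_closed mult_closed
  sum_closed power_closed of_nat_closed

end

locale set_ideal = set_ring R for R :: "'a::comm_ring_1 set" +
  fixes I :: "'a set"
  assumes subset: "I \<subseteq> R"
    and zero: "0 \<in> I"
    and add: "x \<in> I \<Longrightarrow> y \<in> I \<Longrightarrow> x + y \<in> I"
    and mult_left: "x \<in> R \<Longrightarrow> y \<in> I \<Longrightarrow> x * y \<in> I"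
begin

lemma mult_right: "x \<in> I \<Longrightarrow> y \<in> R \<Longrightarrow> x * y \<in> I"
  using mult_left[of y x] by (simp add: mult.commute)

lemma uminus: "x \<in> I \<Longrightarrow> - x \<in> I"
  using mult_left[OF uminus_closed[OF one_closed]] by fastforce

lemma diff: "x \<in> I \<Longrightarrow> y \<in> I \<Longrightarrow> x - y \<in> I"
  using add[of x "- y"] uminus by simp

lemma sum: "(\<And>i. i \<in> A \<Longrightarrow> g i \<in> I) \<Longrightarrow> sum g A \<in> I"
  by (induction A rule: infinite_finite_induct) (auto intro: zero add)

lemma in_R: "x \<in> I \<Longrightarrow> x \<in> R"
  using subset by blast

lemma add_cancel_left: "x \<in> I \<Longrightarrow> x + y \<in> I \<longleftrightarrow> y \<in> I"
  using add diff[of "x + y" x] by auto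

lemma add_cancel_right: "y \<in> I \<Longrightarrow> x + y \<in> I \<longleftrightarrow> x \<in> I"
  using add_cancel_left[of y x] by (simp add: add.commute)

end

locale set_prime = set_ideal +
  assumes one_notin: "1 \<notin> I"
    and prime: "x \<in> R \<Longrightarrow> y \<in> R \<Longrightarrow> x * y \<in> I \<Longrightarrow> x \<in> I \<or> y \<in> I"
begin

lemma prime_power: "x \<in> R \<Longrightarrow> x ^ n \<in> I \<Longrightarrow> x \<in> I"
  by (induction n) (use one_notin prime power_closed in auto)

end

section \<open>Translation between ideals as plain sets and ideals of ring records\<close>

lemma (in set_ring) cring_ring_on: "cring (ring_on R)"
proof (intro cringI abelian_groupI comm_monoidI)
  fix x assume "x \<in> carrier (ring_on R)"
  thus "\<exists>y\<in>carrier (ring_on R). y \<oplus>\<^bsub>ring_on R\<^esub> x = \<zero>\<^bsub>ring_on R\<^esub>"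
    by (intro bexI[of _ "- x"]) (auto intro: closed)
qed (auto intro: closed simp: algebra_simps)

lemma (in set_ring) ideal_iff: "ideal I (ring_on R) \<longleftrightarrow> set_ideal R I"
proof
  interpret c: cring "ring_on R" by (rule cring_ring_on)
  show "set_ideal R I" if "ideal I (ring_on R)"
  proof -
    interpret i: ideal I "ring_on R" by fact
    show ?thesis
      by unfold_locales (use i.a_Hcarr i.zero_closed i.a_closed i.I_l_closed in auto)
  qed
  show "ideal I (ring_on R)" if "set_ideal R I"
  proof -
    interpret i: set_ideal R I by fact
    show ?thesis
    proof (rule idealI[OF c.ring_axioms])
      have neg: "\<ominus>\<^bsub>ring_on R\<^esub> x = - x" if "x \<in> R" for x
        using that by (intro c.minus_equality) (auto intro: closed)
      have "inv\<^bsub>add_monoid (ring_on R)\<^esub> x \<in> I" if "x \<in> I" for x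
        using neg[OF i.in_R[OF that]] i.uminus[OF that] unfolding a_inv_def by simp
      thus "subgroup I (add_monoid (ring_on R))"
        by (intro subgroup.intro) (use i.subset i.add i.zero in auto)
    qed (auto intro: i.mult_left i.mult_right)
  qed
qed

lemma (in set_ring) primeideal_iff: "primeideal I (ring_on R) \<longleftrightarrow> set_prime R I"
proof
  interpret c: cring "ring_on R" by (rule cring_ring_on)
  show "set_prime R I" if "primeideal I (ring_on R)"
  proof -
    interpret p: primeideal I "ring_on R" by fact
    interpret i: set_ideal R I using p.ideal_axioms ideal_iff by blast
    have "1 \<notin> I"
    proof
      assume "1 \<in> I"
      hence "R \<subseteq> I" using i.mult_right[of 1] by fastforce
      thus False using p.I_notcarr i.subset by auto
    qed
    thus ?thesis by unfold_locales (use p.I_prime in auto)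
  qed
  show "primeideal I (ring_on R)" if "set_prime R I"
  proof -
    interpret p: set_prime R I by fact
    show ?thesis
      by (rule primeidealI)
         (use ideal_iff p.set_ideal_axioms p.one_notin one_closed p.prime c.cring_axioms in auto)
  qed
qed

lemma (in set_ring) genideal_eq: "genideal (ring_on R) S = \<Inter>{J. set_ideal R J \<and> S \<subseteq> J}"
  unfolding genideal_def ideal_iff ..

lemma (in set_ring) set_ideal_genideal:
  assumes "S \<subseteq> R"
  shows "set_ideal R (genideal (ring_on R) S)"
proof -
  interpret c: cring "ring_on R" by (rule cring_ring_on)
  show ?thesis using c.genideal_ideal[of S] assms ideal_iff by simp
qed

lemma set_ideal_restrict:
  assumes "set_ideal R I" "set_ring S" "S \<subseteq> R"
  shows "set_ideal S (S \<inter> I)"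
proof -
  interpret set_ideal R I by fact
  interpret S: set_ring S by fact
  show ?thesis
    by unfold_locales
       (use assms(3) zero S.zero_closed in \<open>auto intro: add S.add_closed mult_left S.mult_closed\<close>)
qed

lemma set_prime_restrict:
  assumes "set_prime R I" "set_ring S" "S \<subseteq> R"
  shows "set_prime S (S \<inter> I)"
proof -
  interpret set_prime R I by fact
  interpret S: set_ring S by fact
  show ?thesis
    by unfold_locales
       (use assms(3) zero S.zero_closed one_notin prime in \<open>auto intro: add S.add_closed mult_left S.mult_closed\<close>)
qed

section \<open>Linear independence modulo a prime ideal\<close>

text \<open>Linear algebra over the residue field of \<open>I\<close> in terms of representatives: the factor \<open>d \<notin> I\<close>
  clears the denominators.\<close>

definition indep_mod :: "'a::comm_ring_1 set \<Rightarrow> 'a set \<Rightarrow> 'i set \<Rightarrow> 'j set \<Rightarrow> ('i \<Rightarrow> 'j \<Rightarrow> 'a) \<Rightarrow> bool" where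
  "indep_mod R I S J M \<longleftrightarrow>
     (\<forall>c. (\<forall>s\<in>S. c s \<in> R) \<and> (\<forall>j\<in>J. (\<Sum>s\<in>S. c s * M s j) \<in> I) \<longrightarrow> (\<forall>s\<in>S. c s \<in> I))"

definition dep_mod ::
    "'a::comm_ring_1 set \<Rightarrow> 'a set \<Rightarrow> 'i set \<Rightarrow> 'j set \<Rightarrow> ('i \<Rightarrow> 'j \<Rightarrow> 'a) \<Rightarrow> 'i \<Rightarrow> bool" where
  "dep_mod R I S J M l \<longleftrightarrow> (\<exists>c d. d \<in> R \<and> d \<notin> I \<and> (\<forall>s\<in>S. c s \<in> R) \<and>
     (\<forall>j\<in>J. d * M l j - (\<Sum>s\<in>S. c s * M s j) \<in> I))"

text \<open>The rows in S give a basis of the row space over the residue field, so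
  \<open>card S\<close> is the rank. In this form ranks can be moved along homomorphisms and
  re-indexings without touching the residue field.\<close>

definition row_basis_mod ::
    "'a::comm_ring_1 set \<Rightarrow> 'a set \<Rightarrow> 'i set \<Rightarrow> 'j set \<Rightarrow> ('i \<Rightarrow> 'j \<Rightarrow> 'a) \<Rightarrow> 'i set \<Rightarrow> bool" where
  "row_basis_mod R I A J M S \<longleftrightarrow> S \<subseteq> A \<and> indep_mod R I S J M \<and> (\<forall>l\<in>A. dep_mod R I S J M l)"

lemma indep_modD:
  assumes "indep_mod R I S J M" "\<And>s. s \<in> S \<Longrightarrow> c s \<in> R"
    "\<And>j. j \<in> J \<Longrightarrow> (\<Sum>s\<in>S. c s * M s j) \<in> I" "s \<in> S"
  shows "c s \<in> I"
  using assms unfolding indep_mod_def by blast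

lemma (in set_ideal) indep_mod_subset:
  assumes "indep_mod R I S J M" "T \<subseteq> S" "finite S"
  shows "indep_mod R I T J M"
  unfolding indep_mod_def
proof (intro allI impI ballI, elim conjE)
  fix c t assume c: "\<forall>s\<in>T. c s \<in> R" "\<forall>j\<in>J. (\<Sum>s\<in>T. c s * M s j) \<in> I" "t \<in> T"
  let ?c = "\<lambda>s. if s \<in> T then c s else 0"
  have "(\<Sum>s\<in>S. ?c s * M s j) = (\<Sum>s\<in>T. c s * M s j)" for j
    using assms(2,3) by (intro sum.mono_neutral_cong_right) auto
  note eq = this
  have "?c t \<in> I"
    by (rule indep_modD[OF assms(1)]) (use c assms(2) eq zero_closed in auto)
  thus "c t \<in> I" using c by simp
qed

text \<open>The equations hold exactly and not just modulo \<open>I\<close>. So the right inverse stays one under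
  ring homomorphisms, and it is a genuine right inverse over any ring in which \<open>d\<close> is a unit.\<close>

lemma (in set_prime) indep_mod_right_inverse:
  assumes "finite S" "finite J" "\<And>s j. s \<in> S \<Longrightarrow> j \<in> J \<Longrightarrow> M s j \<in> R" "indep_mod R I S J M"
  shows "\<exists>d H. d \<in> R \<and> d \<notin> I \<and> (\<forall>j\<in>J. \<forall>s\<in>S. H j s \<in> R) \<and>
     (\<forall>s\<in>S. \<forall>t\<in>S. (\<Sum>j\<in>J. M s j * H j t) = (if s = t then d else 0))"
  using assms(1,3,4)
proof (induction S rule: finite_induct)
  case empty
  show ?case by (rule exI[of _ 1]) (use one_notin in \<open>auto intro: closed\<close>)
next
  case (insert l S)
  have "indep_mod R I S J M"
    by (rule indep_mod_subset[OF insert.prems(2)]) (use insert.hyps in auto)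
  with insert obtain d H where d: "d \<in> R" "d \<notin> I" and H: "\<And>j s. j \<in> J \<Longrightarrow> s \<in> S \<Longrightarrow> H j s \<in> R"
    and MH: "\<And>s t. s \<in> S \<Longrightarrow> t \<in> S \<Longrightarrow> (\<Sum>j\<in>J. M s j * H j t) = (if s = t then d else 0)"
    by (metis insertCI)
  define a where "a t = (\<Sum>j\<in>J. M l j * H j t)" for t
  have a: "a t \<in> R" if "t \<in> S" for t
    unfolding a_def using insert.prems(1) H that by (auto intro!: closed)
  \<comment> \<open>Row l scaled by d, minus its component along S; every old column of H is
    orthogonal to it. By independence some entry lies outside I, and that entry serves as a
    pivot.\<close>
  define N where "N j = d * M l j - (\<Sum>t\<in>S. a t * M t j)" for j
  have "\<exists>j0\<in>J. N j0 \<notin> I"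
  proof (rule ccontr)
    assume *: "\<not> ?thesis"
    let ?c = "\<lambda>s. if s = l then d else - a s"
    have "(\<Sum>s\<in>insert l S. ?c s * M s j) = N j" for j
    proof -
      have "(\<Sum>s\<in>S. ?c s * M s j) = (\<Sum>t\<in>S. - (a t * M t j))"
        using insert.hyps by (intro sum.cong) auto
      thus ?thesis using insert.hyps by (simp add: N_def sum_negf)
    qed
    note eq = this
    have "?c l \<in> I"
      by (rule indep_modD[OF insert.prems(2)]) (use * a d eq uminus_closed in auto)
    thus False using d by simp
  qed
  then obtain j0 where j0: "j0 \<in> J" "N j0 \<notin> I" by blast
  \<comment> \<open>The unit vector at j0, scaled by d and corrected so that all rows of S kill it;
    row l sends it to the pivot \<open>N j0\<close>.\<close>
  define h where "h j = (if j = j0 then d else 0) - (\<Sum>t\<in>S. H j t * M t j0)" for j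
  have h: "h j \<in> R" if "j \<in> J" for j
    unfolding h_def using d H that insert.prems(1) j0 by (auto intro!: closed)
  have NR: "N j0 \<in> R"
    unfolding N_def using d a j0 insert.prems(1) by (auto intro!: closed)
  have Mh: "(\<Sum>j\<in>J. M s j * h j) = d * M s j0 - (\<Sum>t\<in>S. (\<Sum>j\<in>J. M s j * H j t) * M t j0)" for s
  proof -
    have "(\<Sum>j\<in>J. M s j * h j) = (\<Sum>j\<in>J. if j = j0 then d * M s j0 else 0)
        - (\<Sum>j\<in>J. \<Sum>t\<in>S. M s j * H j t * M t j0)"
      unfolding h_def right_diff_distrib sum_subtractf
      by (intro arg_cong2[of _ _ _ _ "(-)"] sum.cong refl) (auto simp: sum_distrib_left mult_ac)
    also have "(\<Sum>j\<in>J. if j = j0 then d * M s j0 else 0) = d * M s j0"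
      using assms(2) j0 by (simp add: sum.delta')
    finally show ?thesis by (subst (asm) sum.swap) (simp add: sum_distrib_right)
  qed
  have Mlh: "(\<Sum>j\<in>J. M l j * h j) = N j0" by (simp add: Mh N_def a_def)
  have Msh: "(\<Sum>j\<in>J. M s j * h j) = 0" if "s \<in> S" for s
  proof -
    have "(\<Sum>t\<in>S. (\<Sum>j\<in>J. M s j * H j t) * M t j0) = (\<Sum>t\<in>S. if t = s then d * M s j0 else 0)"
      using MH that by (intro sum.cong) auto
    thus ?thesis using that insert.hyps by (simp add: Mh sum.delta')
  qed
  \<comment> \<open>The new column is a multiple of h. The old columns are scaled by the pivot and
    freed of their value on row l. The factors are chosen to make \<open>d * N j0\<close> the common
    diagonal entry.\<close>
  define H' where "H' j t = (if t = l then d * h j else N j0 * H j t - a t * h j)" for j t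
  have comb: "(\<Sum>j\<in>J. M s j * H' j t) = (if t = l then d * (\<Sum>j\<in>J. M s j * h j)
      else N j0 * (\<Sum>j\<in>J. M s j * H j t) - a t * (\<Sum>j\<in>J. M s j * h j))" for s t
    by (auto simp: H'_def sum_distrib_left algebra_simps sum_subtractf)
  show ?case
  proof (intro exI conjI ballI)
    show "d * N j0 \<in> R" using d NR by (auto intro: closed)
    show "d * N j0 \<notin> I" using prime d NR j0 by blast
    show "H' j s \<in> R" if "j \<in> J" "s \<in> insert l S" for j s
      using that d h H a NR by (auto simp: H'_def intro!: closed)
    show "(\<Sum>j\<in>J. M s j * H' j t) = (if s = t then d * N j0 else 0)"
      if "s \<in> insert l S" "t \<in> insert l S" for s t
      using that insert.hyps MH Mlh Msh
      unfolding comb by (auto simp: a_def[symmetric] mult.commute[of "N j0"])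
  qed
qed

lemma (in set_prime) exists_row_basis_mod:
  assumes "finite A" "\<And>l j. l \<in> A \<Longrightarrow> j \<in> J \<Longrightarrow> M l j \<in> R"
  shows "\<exists>S. row_basis_mod R I A J M S"
proof -
  let ?P = "\<lambda>S. S \<subseteq> A \<and> indep_mod R I S J M"
  have "?P {}" by (auto simp: indep_mod_def)
  moreover have "\<And>S. ?P S \<Longrightarrow> card S \<le> card A" using assms(1) card_mono by blast
  ultimately obtain S where S: "?P S" and max: "\<And>T. ?P T \<Longrightarrow> card T \<le> card S"
    using ex_has_greatest_nat[of ?P "{}" card "Suc (card A)"] by (metis less_Suc_eq_le)
  have fin: "finite S" using S assms(1) finite_subset by blast
  have "dep_mod R I S J M l" if l: "l \<in> A" for l
  proof (cases "l \<in> S")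
    case True
    have "(\<Sum>s\<in>S. (if s = l then 1 else 0) * M s j) = M l j" for j
      using True fin by (simp add: if_distrib[of "\<lambda>x. x * _"] sum.delta' cong: if_cong)
    thus ?thesis unfolding dep_mod_def
      by (intro exI[of _ "\<lambda>s. if s = l then 1 else 0"] exI[of _ 1])
         (use one_notin zero in \<open>auto intro: closed\<close>)
  next
    case False
    have "\<not> ?P (insert l S)" using max[of "insert l S"] fin False by auto
    with S l have "\<not> indep_mod R I (insert l S) J M" by blast
    then obtain c where c': "(\<forall>s\<in>insert l S. c s \<in> R) \<and> (\<forall>j\<in>J. (\<Sum>s\<in>insert l S. c s * M s j) \<in> I)"
      and "\<not> (\<forall>s\<in>insert l S. c s \<in> I)"
      unfolding indep_mod_def not_all not_imp by (elim exE conjE) metis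
    then obtain t where t: "t \<in> insert l S" "c t \<notin> I" by blast
    from c' have c: "\<And>s. s \<in> insert l S \<Longrightarrow> c s \<in> R"
      "\<And>j. j \<in> J \<Longrightarrow> (\<Sum>s\<in>insert l S. c s * M s j) \<in> I" by blast+
    have eq: "(\<Sum>s\<in>insert l S. c s * M s j) = c l * M l j - (\<Sum>s\<in>S. - c s * M s j)" for j
      using fin False by (simp add: sum_negf)
    \<comment> \<open>Otherwise the row l would drop out modulo I, and the rest would be a relation
      among the independent rows of S, with all coefficients in I.\<close>
    have "c l \<notin> I"
    proof
      assume "c l \<in> I"
      hence "(\<Sum>s\<in>S. c s * M s j) \<in> I" if "j \<in> J" for j
        using c(2)[OF that] fin False assms(2)[OF l that] add_cancel_left mult_right by auto
      from indep_modD[OF conjunct2[OF S] _ this] c(1) t \<open>c l \<in> I\<close> show False by auto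
    qed
    thus ?thesis unfolding dep_mod_def
      by (intro exI[of _ "\<lambda>s. - c s"] exI[of _ "c l"]) (use c eq in \<open>auto intro: closed\<close>)
  qed
  with S show ?thesis unfolding row_basis_mod_def by blast
qed

lemma dep_modE:
  assumes "dep_mod R I S J M l"
  obtains c d where "d \<in> R" "d \<notin> I" "\<forall>s\<in>S. c s \<in> R" "\<forall>j\<in>J. d * M l j - (\<Sum>s\<in>S. c s * M s j) \<in> I"
  using assms unfolding dep_mod_def by (elim exE conjE) (rule that)

lemma dep_modI:
  assumes "d \<in> R" "d \<notin> I" "\<forall>s\<in>S. c s \<in> R" "\<forall>j\<in>J. d * M l j - (\<Sum>s\<in>S. c s * M s j) \<in> I"
  shows "dep_mod R I S J M l"
  unfolding dep_mod_def using assms by (intro exI[of _ c] exI[of _ d] conjI)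

lemma indep_mod_columns:
  assumes "indep_mod R I S J M" "\<gamma> ` J \<subseteq> J'" "\<And>s j. s \<in> S \<Longrightarrow> j \<in> J \<Longrightarrow> M' s (\<gamma> j) = M s j"
  shows "indep_mod R I S J' M'"
  unfolding indep_mod_def
proof (intro allI impI ballI, elim conjE)
  fix c s assume c: "\<forall>s\<in>S. c s \<in> R" "\<forall>j\<in>J'. (\<Sum>s\<in>S. c s * M' s j) \<in> I" "s \<in> S"
  show "c s \<in> I"
  proof (rule indep_modD[OF assms(1) _ _ c(3)])
    fix j assume j: "j \<in> J"
    have "(\<Sum>s\<in>S. c s * M s j) = (\<Sum>s\<in>S. c s * M' s (\<gamma> j))" using assms(3) j by simp
    thus "(\<Sum>s\<in>S. c s * M s j) \<in> I" using c(2) assms(2) j by auto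
  qed (use c(1) in blast)
qed

lemma row_basis_mod_reindex:
  assumes "row_basis_mod R I A J (\<lambda>u v. M (\<rho> u) (\<gamma> v)) S" "inj_on \<rho> A" "\<gamma> ` J = J'"
  shows "row_basis_mod R I (\<rho> ` A) J' M (\<rho> ` S)"
proof -
  have SA: "S \<subseteq> A" and ind: "indep_mod R I S J (\<lambda>u v. M (\<rho> u) (\<gamma> v))"
    and dep: "\<And>l. l \<in> A \<Longrightarrow> dep_mod R I S J (\<lambda>u v. M (\<rho> u) (\<gamma> v)) l"
    using assms(1) unfolding row_basis_mod_def by blast+
  have injS: "inj_on \<rho> S" using assms(2) SA inj_on_subset by blast
  have sum: "(\<Sum>s\<in>\<rho> ` S. c s * M s j) = (\<Sum>s\<in>S. c (\<rho> s) * M (\<rho> s) j)" for c j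
    by (simp add: sum.reindex[OF injS])
  show ?thesis
    unfolding row_basis_mod_def
  proof (intro conjI ballI)
    show "\<rho> ` S \<subseteq> \<rho> ` A" using SA by blast
    show "indep_mod R I (\<rho> ` S) J' M"
      unfolding indep_mod_def sum
    proof (intro allI impI ballI, elim conjE imageE)
      fix c s t assume c: "\<forall>s\<in>\<rho> ` S. c s \<in> R" "\<forall>j\<in>J'. (\<Sum>s\<in>S. c (\<rho> s) * M (\<rho> s) j) \<in> I"
        and s: "s = \<rho> t" "t \<in> S"
      have "c (\<rho> t) \<in> I"
        by (rule indep_modD[OF ind, of "c \<circ> \<rho>", unfolded comp_apply, OF _ _ s(2)]) (use c assms(3) in auto)
      thus "c s \<in> I" using s by simp
    qed
    fix l assume "l \<in> \<rho> ` A"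
    then obtain l0 where l0: "l0 \<in> A" "l = \<rho> l0" by blast
    from dep[OF l0(1)] obtain c d where d: "d \<in> R" "d \<notin> I" and c: "\<forall>s\<in>S. c s \<in> R"
      and dc: "\<forall>j\<in>J. d * M (\<rho> l0) (\<gamma> j) - (\<Sum>s\<in>S. c s * M (\<rho> s) (\<gamma> j)) \<in> I"
      by (rule dep_modE)
    let ?c = "\<lambda>s. c (the_inv_into S \<rho> s)"
    have "(\<Sum>s\<in>S. ?c (\<rho> s) * M (\<rho> s) j) = (\<Sum>s\<in>S. c s * M (\<rho> s) j)" for j
      by (intro sum.cong) (simp_all add: the_inv_into_f_f[OF injS])
    hence dc': "\<forall>j\<in>J'. d * M l j - (\<Sum>s\<in>S. ?c (\<rho> s) * M (\<rho> s) j) \<in> I" using dc assms(3) l0(2) by auto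
    have cR: "\<forall>s\<in>\<rho> ` S. ?c s \<in> R" using c by (auto simp: the_inv_into_f_f[OF injS])
    show "dep_mod R I (\<rho> ` S) J' M l" by (rule dep_modI[OF d cR dc'[folded sum[of ?c]]])
  qed
qed

text \<open>An injective endomorphism that reflects a prime ideal induces an extension of residue fields,
  and this does not change the row rank.\<close>

lemma (in set_prime) row_basis_mod_hom:
  assumes s: "comm_ring_hom s" "\<And>x. x \<in> R \<Longrightarrow> s x \<in> R" "\<And>x. x \<in> R \<Longrightarrow> s x \<in> I \<longleftrightarrow> x \<in> I"
    and fin: "finite A" "finite J" and M: "\<And>l j. l \<in> A \<Longrightarrow> j \<in> J \<Longrightarrow> M l j \<in> R"
    and S: "row_basis_mod R I A J M S"
  shows "row_basis_mod R I A J (\<lambda>u v. s (M u v)) S"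
proof -
  interpret s: comm_ring_hom s by fact
  have SA: "S \<subseteq> A" and ind: "indep_mod R I S J M" and dep: "\<And>l. l \<in> A \<Longrightarrow> dep_mod R I S J M l"
    using S unfolding row_basis_mod_def by blast+
  have finS: "finite S" using SA fin finite_subset by blast
  have s_sum: "s (\<Sum>i\<in>B. x i) = (\<Sum>i\<in>B. s (x i))" for B and x :: "'z \<Rightarrow> 'a"
    by (induction B rule: infinite_finite_induct) (simp_all add: s.hom_add)
  have "\<exists>d H. d \<in> R \<and> d \<notin> I \<and> (\<forall>j\<in>J. \<forall>t\<in>S. H j t \<in> R) \<and>
      (\<forall>u\<in>S. \<forall>t\<in>S. (\<Sum>j\<in>J. M u j * H j t) = (if u = t then d else 0))"
    by (rule indep_mod_right_inverse[OF finS fin(2) _ ind]) (use M SA in blast)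
  then obtain d H where "d \<in> R \<and> d \<notin> I \<and> (\<forall>j\<in>J. \<forall>t\<in>S. H j t \<in> R) \<and>
      (\<forall>u\<in>S. \<forall>t\<in>S. (\<Sum>j\<in>J. M u j * H j t) = (if u = t then d else 0))" by (elim exE)
  hence d: "d \<in> R" "d \<notin> I" and H: "\<And>j t. j \<in> J \<Longrightarrow> t \<in> S \<Longrightarrow> H j t \<in> R"
    and MH: "\<And>u t. u \<in> S \<Longrightarrow> t \<in> S \<Longrightarrow> (\<Sum>j\<in>J. M u j * H j t) = (if u = t then d else 0)"
    by blast+
  show ?thesis
    unfolding row_basis_mod_def
  proof (intro conjI ballI SA)
    show "indep_mod R I S J (\<lambda>u v. s (M u v))"
      unfolding indep_mod_def
    proof (intro allI impI ballI, elim conjE)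
      fix c t assume c: "\<forall>u\<in>S. c u \<in> R" "\<forall>j\<in>J. (\<Sum>u\<in>S. c u * s (M u j)) \<in> I" and t: "t \<in> S"
      have "(\<Sum>j\<in>J. (\<Sum>u\<in>S. c u * s (M u j)) * s (H j t)) = (\<Sum>u\<in>S. c u * (\<Sum>j\<in>J. s (M u j) * s (H j t)))"
        unfolding sum_distrib_right sum_distrib_left by (subst sum.swap) (simp add: mult.assoc)
      also have "\<dots> = (\<Sum>u\<in>S. c u * s (\<Sum>j\<in>J. M u j * H j t))"
        by (simp add: s_sum s.hom_mult)
      also have "\<dots> = (\<Sum>u\<in>S. if u = t then c t * s d else 0)"
        using t by (intro sum.cong) (auto simp: MH)
      also have "\<dots> = c t * s d" using finS t by simp
      finally have "c t * s d = (\<Sum>j\<in>J. (\<Sum>u\<in>S. c u * s (M u j)) * s (H j t))" ..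
      also have "\<dots> \<in> I" by (rule sum, rule mult_right[OF bspec[OF c(2)] s(2)[OF H[OF _ t]]])
      finally show "c t \<in> I" using prime[of "c t" "s d"] c(1) t d s(2,3) by blast
    qed
    fix l assume l: "l \<in> A"
    from dep[OF l] obtain c e where e: "e \<in> R" "e \<notin> I" and c: "\<forall>u\<in>S. c u \<in> R"
      and ec: "\<forall>j\<in>J. e * M l j - (\<Sum>u\<in>S. c u * M u j) \<in> I"
      by (rule dep_modE)
    have "s e * s (M l j) - (\<Sum>u\<in>S. s (c u) * s (M u j)) \<in> I" if j: "j \<in> J" for j
    proof -
      have "s (e * M l j - (\<Sum>u\<in>S. c u * M u j)) \<in> I"
        using ec j s(3)[OF in_R] by blast
      thus ?thesis by (simp add: s.hom_minus s.hom_mult s_sum)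
    qed
    thus "dep_mod R I S J (\<lambda>u v. s (M u v)) l"
      unfolding dep_mod_def using e c s(2,3)
      by (intro exI[of _ "\<lambda>u. s (c u)"] exI[of _ "s e"]) auto
  qed
qed

section \<open>Matrix ranks modulo a prime ideal\<close>

lemma (in cring) finsum_func_space:
  assumes "finite B" "g \<in> B \<rightarrow> carrier (func_space A)" "i \<in> A"
  shows "finsum (func_space A) g B i = (\<Oplus>w\<in>B. g w i)"
proof -
  interpret V: Module.module R "func_space A" by (rule func_space_is_module)
  from assms(1,2) show ?thesis
  proof (induction B rule: finite_induct)
    case empty
    show ?case using assms(3) V.M.finsum_empty[of g] by (simp add: func_space_def)
  next
    case (insert w B)
    have "(\<lambda>w. g w i) \<in> insert w B \<rightarrow> carrier R"
      using insert.prems assms(3) by (auto simp: func_space_def)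
    moreover have "finsum (func_space A) g (insert w B) = g w \<oplus>\<^bsub>func_space A\<^esub> finsum (func_space A) g B"
      using insert by (intro V.M.finsum_insert) auto
    ultimately show ?case
      using insert assms(3) by (simp add: func_space_def)
  qed
qed

lemma (in cring) submodule_hyperplane:
  assumes "finite A" "a \<in> A \<rightarrow> carrier R"
  shows "submodule R {w \<in> carrier (func_space A). (\<Oplus>i\<in>A. a i \<otimes> w i) = \<zero>} (func_space A)"
proof -
  interpret V: Module.module R "func_space A" by (rule func_space_is_module)
  have w: "(\<lambda>i. a i \<otimes> w i) \<in> A \<rightarrow> carrier R" if "w \<in> carrier (func_space A)" for w
    using that assms(2) by (auto simp: func_space_def)
  have zero: "(\<Oplus>i\<in>A. a i \<otimes> \<zero>\<^bsub>func_space A\<^esub> i) = (\<Oplus>i\<in>A. \<zero>)"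
    using assms(2) by (intro finsum_cong') (auto simp: func_space_def Pi_def)
  have add: "(\<Oplus>i\<in>A. a i \<otimes> (v \<oplus>\<^bsub>func_space A\<^esub> w) i) = (\<Oplus>i\<in>A. a i \<otimes> v i) \<oplus> (\<Oplus>i\<in>A. a i \<otimes> w i)"
    if "v \<in> carrier (func_space A)" "w \<in> carrier (func_space A)" for v w
  proof -
    have "(\<Oplus>i\<in>A. a i \<otimes> (v \<oplus>\<^bsub>func_space A\<^esub> w) i) = (\<Oplus>i\<in>A. a i \<otimes> v i \<oplus> a i \<otimes> w i)"
      using assms(2) that by (intro finsum_cong') (auto simp: func_space_def r_distr Pi_def PiE_def)
    thus ?thesis using finsum_addf[OF w[OF that(1)] w[OF that(2)]] by simp
  qed
  have smult: "(\<Oplus>i\<in>A. a i \<otimes> (c \<odot>\<^bsub>func_space A\<^esub> w) i) = c \<otimes> (\<Oplus>i\<in>A. a i \<otimes> w i)"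
    if "c \<in> carrier R" "w \<in> carrier (func_space A)" for c w
  proof -
    have "(\<Oplus>i\<in>A. a i \<otimes> (c \<odot>\<^bsub>func_space A\<^esub> w) i) = (\<Oplus>i\<in>A. c \<otimes> (a i \<otimes> w i))"
      using assms(2) that by (intro finsum_cong') (auto simp: func_space_def m_lcomm Pi_def PiE_def)
    thus ?thesis using finsum_rdistr[OF assms(1) that(1) w[OF that(2)]] by simp
  qed
  show ?thesis
    by (rule submodule.intro)
       (use zero add smult V.module_axioms in \<open>auto intro: V.smult_closed\<close>)
qed

text \<open>Restriction to the coordinates in S is an isomorphism from W onto the functions on S:
  \<open>inj\<close> makes the kernel trivial, and \<open>surj\<close> yields the unit vectors up to
  scaling. Both the column space and the left kernel of a matrix are measured in this way.\<close>

lemma (in field) dim_func_space_restrict: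
  assumes A: "finite A" "S \<subseteq> A" and W: "submodule R W (func_space A)"
    and inj: "\<And>w i. w \<in> W \<Longrightarrow> (\<And>s. s \<in> S \<Longrightarrow> w s = \<zero>) \<Longrightarrow> i \<in> A \<Longrightarrow> w i = \<zero>"
    and surj: "\<And>t. t \<in> S \<Longrightarrow> \<exists>w\<in>W. \<exists>d\<in>carrier R. d \<noteq> \<zero> \<and> (\<forall>s\<in>S. w s = (if s = t then d else \<zero>))"
  shows "vectorspace.dim R ((func_space A)\<lparr>carrier := W\<rparr>) = card S"
proof -
  let ?V = "func_space A"
  interpret V: Module.module R ?V by (rule func_space_is_module)
  interpret V: vectorspace R ?V by unfold_locales
  interpret W: vectorspace R "?V\<lparr>carrier := W\<rparr>"
    by (rule V.subspace_is_vs) (use W V.vectorspace_axioms in \<open>simp add: subspace_def\<close>)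
  have finS: "finite S" using A finite_subset by blast
  have WV: "W \<subseteq> carrier ?V" using W by (simp add: submodule_def)
  have Wadd: "v \<oplus>\<^bsub>?V\<^esub> w \<in> W" if "v \<in> W" "w \<in> W" for v w
    using W that by (simp add: submodule_def)
  have Wsm: "c \<odot>\<^bsub>?V\<^esub> w \<in> W" if "c \<in> carrier R" "w \<in> W" for c w
    using W that by (simp add: submodule_def)
  have "\<exists>w\<in>W. \<forall>s\<in>S. w s = (if s = t then \<one> else \<zero>)" if t: "t \<in> S" for t
  proof -
    obtain w d where wd: "w \<in> W" "d \<in> carrier R" "d \<noteq> \<zero>" "\<forall>s\<in>S. w s = (if s = t then d else \<zero>)"
      using surj[OF t] by blast
    have "(inv d \<odot>\<^bsub>?V\<^esub> w) s = inv d \<otimes> w s" if "s \<in> S" for s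
      using that A by (auto simp: func_space_def)
    with wd A show ?thesis
      by (intro bexI[of _ "inv d \<odot>\<^bsub>?V\<^esub> w"]) (auto simp: field_Units intro!: Wsm)
  qed
  then obtain b where bW: "\<And>t. t \<in> S \<Longrightarrow> b t \<in> W"
    and b: "\<And>t s. t \<in> S \<Longrightarrow> s \<in> S \<Longrightarrow> b t s = (if s = t then \<one> else \<zero>)"
    by metis
  have inj_b: "inj_on b S"
    by (rule inj_onI) (metis b zero_not_one)
  let ?B = "b ` S"
  have finB: "finite ?B" using finS by simp
  have BW: "?B \<subseteq> W" and BV: "?B \<subseteq> carrier ?V" using bW WV by auto
  have wR: "w i \<in> carrier R" if "w \<in> carrier ?V" "i \<in> A" for w i
    using that by (auto simp: func_space_def)
  have lc: "V.lincomb a ?B t = a (b t)" if a: "a \<in> ?B \<rightarrow> carrier R" and t: "t \<in> S" for a t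
  proof -
    have tA: "t \<in> A" using t A by blast
    have "V.lincomb a ?B t = (\<Oplus>w\<in>?B. (a w \<odot>\<^bsub>?V\<^esub> w) t)"
      unfolding V.lincomb_def using finB tA a BV by (intro finsum_func_space) (auto intro!: V.smult_closed)
    also have "\<dots> = (\<Oplus>w\<in>?B. if b t = w then a w else \<zero>)"
    proof (rule finsum_cong')
      fix w assume "w \<in> ?B"
      then obtain s where s: "s \<in> S" "w = b s" by blast
      have "(a w \<odot>\<^bsub>?V\<^esub> w) t = a w \<otimes> b s t" using s tA by (simp add: func_space_def)
      also have "\<dots> = (if b t = w then a w else \<zero>)"
        using s t a b[of s t] inj_on_eq_iff[OF inj_b] by (auto simp: Pi_def)
      finally show "(a w \<odot>\<^bsub>?V\<^esub> w) t = (if b t = w then a w else \<zero>)" .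
    qed (use a in auto)
    also have "\<dots> = a (b t)" using finB t a by (intro finsum_singleton) auto
    finally show ?thesis .
  qed
  have li: "V.lin_indpt ?B"
  proof (rule V.finite_lin_indpt2[OF finB BV], rule ballI)
    fix a v assume a: "a \<in> ?B \<rightarrow> carrier R" "V.lincomb a ?B = \<zero>\<^bsub>?V\<^esub>" "v \<in> ?B"
    then obtain t where t: "t \<in> S" "v = b t" by blast
    hence "a v = \<zero>\<^bsub>?V\<^esub> t" using lc[OF a(1) t(1)] a(2) by simp
    thus "a v = \<zero>" using t A by (auto simp: func_space_def)
  qed
  have "V.span ?B = W"
  proof
    show "V.span ?B \<subseteq> W" by (rule V.span_is_subset[OF BW W])
    show "W \<subseteq> V.span ?B"
    proof
      fix w assume w: "w \<in> W"
      define a where "a v = w (the_inv_into S b v)" for v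
      have ab: "a (b t) = w t" if "t \<in> S" for t
        using the_inv_into_f_f[OF inj_b that] by (simp add: a_def)
      have a: "a \<in> ?B \<rightarrow> carrier R"
      proof (intro Pi_I, elim imageE)
        fix v t assume "v = b t" "t \<in> S"
        thus "a v \<in> carrier R" using ab[of t] wR[of w t] w WV A by auto
      qed
      let ?u = "V.lincomb a ?B"
      have span: "?u \<in> V.span ?B" using V.finite_span[OF finB BV] a by blast
      hence u: "?u \<in> W" using V.span_is_subset[OF BW W] by blast
      \<comment> \<open>This is w minus the combination, which vanishes on S and hence, by
        \<open>inj\<close>, everywhere.\<close>
      let ?z = "w \<oplus>\<^bsub>?V\<^esub> (\<ominus> \<one>) \<odot>\<^bsub>?V\<^esub> ?u"
      have z: "?z \<in> W" using w u by (intro Wadd Wsm) auto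
      have zi: "?z i = w i \<ominus> ?u i" if "i \<in> A" for i
        using that wR[of ?u i] wR[of w i] u w WV
        by (auto simp: func_space_def minus_eq l_minus)
      have "?z s = \<zero>" if "s \<in> S" for s
      proof -
        have sA: "s \<in> A" using that A by blast
        hence "w s \<in> carrier R" using wR w WV by blast
        thus ?thesis unfolding zi[OF sA] lc[OF a that] ab[OF that] by (simp add: r_neg minus_eq)
      qed
      hence "?z i = \<zero>" if "i \<in> A" for i using inj[OF z _ that] by blast
      hence "w i = ?u i" if "i \<in> A" for i
      proof -
        have "w i \<in> carrier R" "?u i \<in> carrier R" using that wR u w WV by blast+
        moreover have "w i \<oplus> \<ominus> ?u i = \<zero>"
          using zi[OF that] \<open>\<And>i. i \<in> A \<Longrightarrow> ?z i = \<zero>\<close>[OF that] unfolding minus_eq by metis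
        ultimately show ?thesis
          using minus_equality[of "w i" "\<ominus> ?u i"] minus_minus[of "?u i"] a_inv_closed by metis
      qed
      moreover have "w \<in> extensional A" "?u \<in> extensional A"
        using w u WV by (auto simp: func_space_def PiE_def)
      ultimately have "w = ?u" by (intro extensionalityI) auto
      with span show "w \<in> V.span ?B" by simp
    qed
  qed
  hence "W.basis ?B"
    unfolding W.basis_def using V.span_li_not_depend[OF BW W] li BW by simp
  from W.dim_basis[OF finB this] show ?thesis
    using card_image[OF inj_b] by simp
qed

lemma (in domain) fraction_one_hom:
  shows "(\<lambda>a. fraction R a \<one>) \<in> Ring.ring_hom R (fraction_field R)"
    and "a \<in> carrier R \<Longrightarrow> fraction R a \<one> = \<zero>\<^bsub>fraction_field R\<^esub> \<longleftrightarrow> a = \<zero>"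
proof -
  show "(\<lambda>a. fraction R a \<one>) \<in> Ring.ring_hom R (fraction_field R)"
  proof (rule ring_hom_memI)
    show "fraction R a \<one> \<in> carrier (fraction_field R)" if "a \<in> carrier R" for a
      using that one_closed one_not_zero unfolding carrier_fraction_field by blast
    show "fraction R \<one> \<one> = \<one>\<^bsub>fraction_field R\<^esub>" by (simp add: fraction_field_def)
  qed (simp_all add: fraction_field_mult fraction_field_add)
  have "\<zero>\<^bsub>fraction_field R\<^esub> = fraction R \<zero> \<one>" by (simp add: fraction_field_def)
  thus "a \<in> carrier R \<Longrightarrow> fraction R a \<one> = \<zero>\<^bsub>fraction_field R\<^esub> \<longleftrightarrow> a = \<zero>"
    by (simp add: fraction_eq_iff)
qed

section \<open>The residue map and its kernel\<close>

context set_prime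
begin

lemma primeideal: "primeideal I (ring_on R)"
  using primeideal_iff set_prime_axioms by blast

lemma field_residue_field: "field (residue_field (ring_on R) I)"
  by (rule field_residue_field[OF primeideal])

lemma residue_map_hom:
    "residue_map (ring_on R) I \<in> Ring.ring_hom (ring_on R) (residue_field (ring_on R) I)"
  and residue_map_zero_iff: "x \<in> R \<Longrightarrow>
    residue_map (ring_on R) I x = \<zero>\<^bsub>residue_field (ring_on R) I\<^esub> \<longleftrightarrow> x \<in> I"
proof -
  let ?kap = "residue_field (ring_on R) I" and ?phi = "residue_map (ring_on R) I"
  interpret P: primeideal I "ring_on R" by (rule primeideal)
  interpret D: domain "ring_on R Quot I" by (rule P.quotient_is_domain)
  have eq: "?phi = (\<lambda>a. fraction (ring_on R Quot I) a \<one>\<^bsub>ring_on R Quot I\<^esub>) \<circ> (+>\<^bsub>ring_on R\<^esub>) I"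
    unfolding residue_map_def by (rule ext) (simp only: o_def)
  show "?phi \<in> Ring.ring_hom (ring_on R) ?kap"
    unfolding eq residue_field_def
    by (rule ring_hom_trans[OF P.rcos_ring_hom D.fraction_one_hom(1)])
  show "?phi x = \<zero>\<^bsub>?kap\<^esub> \<longleftrightarrow> x \<in> I" if x: "x \<in> R"
  proof -
    have x': "x \<in> carrier (ring_on R)" using x by simp
    have "?phi x = \<zero>\<^bsub>?kap\<^esub> \<longleftrightarrow> I +>\<^bsub>ring_on R\<^esub> x = \<zero>\<^bsub>ring_on R Quot I\<^esub>"
      unfolding residue_map_def residue_field_def
      by (rule D.fraction_one_hom(2)[OF ring_hom_closed[OF P.rcos_ring_hom x']])
    also have "\<dots> \<longleftrightarrow> I +>\<^bsub>ring_on R\<^esub> x = I" by (simp add: FactRing_def)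
    also have "\<dots> \<longleftrightarrow> x \<in> I" using P.a_rcos_self[OF x'] P.a_rcos_const by auto
    finally show ?thesis .
  qed
qed

end

text \<open>All that the rank computation asks of a residue field: a field with an additive and
  multiplicative map from R whose zero set is I.\<close>

locale residue_hom = set_prime R I + K: field K
  for R I and K :: "('b, 'c) ring_scheme" +
  fixes phi
  assumes map_in: "x \<in> R \<Longrightarrow> phi x \<in> carrier K"
    and map_add: "x \<in> R \<Longrightarrow> y \<in> R \<Longrightarrow> phi (x + y) = phi x \<oplus>\<^bsub>K\<^esub> phi y"
    and map_mult: "x \<in> R \<Longrightarrow> y \<in> R \<Longrightarrow> phi (x * y) = phi x \<otimes>\<^bsub>K\<^esub> phi y"
    and map_zero_iff: "x \<in> R \<Longrightarrow> phi x = \<zero>\<^bsub>K\<^esub> \<longleftrightarrow> x \<in> I"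
begin

lemma map_zero: "phi 0 = \<zero>\<^bsub>K\<^esub>"
  using map_zero_iff[OF zero_closed] zero by blast

lemma map_sum_mult:
  assumes "finite A" "\<And>i. i \<in> A \<Longrightarrow> x i \<in> R" "\<And>i. i \<in> A \<Longrightarrow> y i \<in> R"
  shows "phi (\<Sum>i\<in>A. x i * y i) = (\<Oplus>\<^bsub>K\<^esub>i\<in>A. phi (x i) \<otimes>\<^bsub>K\<^esub> phi (y i))"
proof -
  show ?thesis using assms
  proof (induction A rule: finite_induct)
    case (insert i A)
    have "(\<Sum>i\<in>A. x i * y i) \<in> R" using insert by (auto intro!: sum_closed mult_closed)
    moreover have "(\<lambda>i. phi (x i) \<otimes>\<^bsub>K\<^esub> phi (y i)) \<in> A \<rightarrow> carrier K"
      using insert.prems by (auto intro!: map_in)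
    ultimately show ?case
      using insert by (simp add: map_add map_mult map_in mult_closed)
  qed (simp add: map_zero)
qed

text \<open>Elements of the column space are determined by their coordinates in S, those of the left
  kernel by their coordinates outside S. The right inverse H supplies multiples of unit vectors on S
  in the column space; the relations that express the other rows through S supply them off S in the
  left kernel. Injectivity follows in both cases from pairing the two spaces, which always gives
  zero.\<close>

lemma
  assumes fin: "finite A" "finite J" and M: "\<And>l j. l \<in> A \<Longrightarrow> j \<in> J \<Longrightarrow> M l j \<in> R"
    and S: "row_basis_mod R I A J M S"
  shows mat_rank_eq_card_row_basis: "mat_rank K A J (\<lambda>u v. phi (M u v)) = card S"
    and left_kernel_dim_eq_card_row_basis:
      "left_kernel_dim K A J (\<lambda>u v. phi (M u v)) = card A - card S"
proof -
  let ?V = "K.func_space A" and ?M = "\<lambda>u v. phi (M u v)"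
  interpret V: Module.module K ?V by (rule K.func_space_is_module)
  have SA: "S \<subseteq> A" and indep: "indep_mod R I S J M" and dep: "\<And>l. l \<in> A \<Longrightarrow> dep_mod R I S J M l"
    using S by (auto simp: row_basis_mod_def)
  have finS: "finite S" using SA fin finite_subset by blast
  have "\<exists>c d. d \<in> R \<and> d \<notin> I \<and> (\<forall>s\<in>S. c s \<in> R) \<and> (\<forall>j\<in>J. d * M l j - (\<Sum>s\<in>S. c s * M s j) \<in> I)"
    if "l \<in> A" for l using dep[OF that] unfolding dep_mod_def by blast
  hence "\<forall>l\<in>A. \<exists>p. snd p \<in> R \<and> snd p \<notin> I \<and> (\<forall>s\<in>S. fst p s \<in> R) \<and>
      (\<forall>j\<in>J. snd p * M l j - (\<Sum>s\<in>S. fst p s * M s j) \<in> I)"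
    by (intro ballI) (simp only: split_paired_Ex fst_conv snd_conv)
  from bchoice[OF this] obtain p where p: "\<forall>l\<in>A. snd (p l) \<in> R \<and> snd (p l) \<notin> I \<and>
      (\<forall>s\<in>S. fst (p l) s \<in> R) \<and> (\<forall>j\<in>J. snd (p l) * M l j - (\<Sum>s\<in>S. fst (p l) s * M s j) \<in> I)"
    by (elim exE)
  define c d where "c = (\<lambda>l. fst (p l))" and "d = (\<lambda>l. snd (p l))"
  have d: "\<And>l. l \<in> A \<Longrightarrow> d l \<in> R" "\<And>l. l \<in> A \<Longrightarrow> d l \<notin> I"
    and c: "\<And>l s. l \<in> A \<Longrightarrow> s \<in> S \<Longrightarrow> c l s \<in> R"
    and cd: "\<And>l j. l \<in> A \<Longrightarrow> j \<in> J \<Longrightarrow> d l * M l j - (\<Sum>s\<in>S. c l s * M s j) \<in> I"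
    using p unfolding c_def d_def by blast+
  have "\<exists>d H. d \<in> R \<and> d \<notin> I \<and> (\<forall>j\<in>J. \<forall>s\<in>S. H j s \<in> R) \<and>
      (\<forall>s\<in>S. \<forall>t\<in>S. (\<Sum>j\<in>J. M s j * H j t) = (if s = t then d else 0))"
    by (rule indep_mod_right_inverse[OF finS fin(2) _ indep]) (use M SA in blast)
  then obtain e H where eH: "e \<in> R \<and> e \<notin> I \<and> (\<forall>j\<in>J. \<forall>s\<in>S. H j s \<in> R) \<and>
      (\<forall>s\<in>S. \<forall>t\<in>S. (\<Sum>j\<in>J. M s j * H j t) = (if s = t then e else 0))"
    by (elim exE)
  hence e: "e \<in> R" "e \<notin> I" and H: "\<And>j s. j \<in> J \<Longrightarrow> s \<in> S \<Longrightarrow> H j s \<in> R"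
    and MH: "\<And>s t. s \<in> S \<Longrightarrow> t \<in> S \<Longrightarrow> (\<Sum>j\<in>J. M s j * H j t) = (if s = t then e else 0)"
    by blast+
  \<comment> \<open>For l outside S these are the coefficients of the relation between row l and the
    rows of S: a left-kernel vector modulo I whose only entry outside S is d l, at l.\<close>
  define y where "y l i = (if i = l then d l else if i \<in> S then - c l i else 0)" for l i
  have y: "y l i \<in> R" if "l \<in> A" for l i
    using that d c by (auto simp: y_def intro: zero_closed uminus_closed)
  have yM: "(\<Sum>i\<in>A. y l i * M i j) \<in> I" if "l \<in> A - S" "j \<in> J" for l j
  proof -
    have "(\<Sum>i\<in>A. y l i * M i j) = (\<Sum>i\<in>insert l S. y l i * M i j)"
      using that fin SA by (intro sum.mono_neutral_right) (auto simp: y_def)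
    also have "\<dots> = d l * M l j + (\<Sum>i\<in>S. y l i * M i j)"
      using that finS by (simp add: y_def)
    also have "(\<Sum>i\<in>S. y l i * M i j) = (\<Sum>i\<in>S. - (c l i * M i j))"
      using that by (intro sum.cong) (auto simp: y_def)
    finally show ?thesis using cd that by (simp add: sum_negf)
  qed
  define col where "col j = (\<lambda>i\<in>A. ?M i j)" for j
  have col: "col j \<in> carrier ?V" if "j \<in> J" for j
    using that M by (auto simp: col_def K.func_space_def intro: map_in)
  let ?W = "V.span (col ` J)"
  have W: "submodule K ?W ?V" by (rule V.span_is_submodule) (use col in auto)
  have colW: "col j \<in> ?W" if "j \<in> J" for j using V.in_own_span[of "col ` J"] col that by auto
  have pair: "(\<Oplus>\<^bsub>K\<^esub>i\<in>A. a i \<otimes>\<^bsub>K\<^esub> w i) = \<zero>\<^bsub>K\<^esub>"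
    if a: "a \<in> A \<rightarrow> carrier K" and "w \<in> ?W"
      and z: "\<And>j. j \<in> J \<Longrightarrow> (\<Oplus>\<^bsub>K\<^esub>i\<in>A. a i \<otimes>\<^bsub>K\<^esub> ?M i j) = \<zero>\<^bsub>K\<^esub>" for a w
  proof -
    have "col j \<in> {w \<in> carrier ?V. (\<Oplus>\<^bsub>K\<^esub>i\<in>A. a i \<otimes>\<^bsub>K\<^esub> w i) = \<zero>\<^bsub>K\<^esub>}" if "j \<in> J" for j
    proof -
      have "(\<Oplus>\<^bsub>K\<^esub>i\<in>A. a i \<otimes>\<^bsub>K\<^esub> col j i) = (\<Oplus>\<^bsub>K\<^esub>i\<in>A. a i \<otimes>\<^bsub>K\<^esub> ?M i j)"
        using a M that by (intro K.finsum_cong') (auto simp: col_def intro!: map_in K.m_closed)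
      thus ?thesis using z[OF that] col[OF that] by simp
    qed
    hence "?W \<subseteq> {w \<in> carrier ?V. (\<Oplus>\<^bsub>K\<^esub>i\<in>A. a i \<otimes>\<^bsub>K\<^esub> w i) = \<zero>\<^bsub>K\<^esub>}"
      by (intro V.span_is_subset K.submodule_hyperplane fin a) auto
    thus ?thesis using \<open>w \<in> ?W\<close> by blast
  qed
  have one_term: "(\<Oplus>\<^bsub>K\<^esub>i\<in>A. g i) = g t"
    if "t \<in> A" "g t \<in> carrier K" "\<And>i. i \<in> A \<Longrightarrow> i \<noteq> t \<Longrightarrow> g i = \<zero>\<^bsub>K\<^esub>" for g t
  proof -
    have "(\<Oplus>\<^bsub>K\<^esub>i\<in>A. g i) = (\<Oplus>\<^bsub>K\<^esub>i\<in>A. if t = i then g i else \<zero>\<^bsub>K\<^esub>)"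
      using that by (intro K.finsum_cong') auto
    also have "\<dots> = g t"
    proof (rule K.finsum_singleton)
      show "g \<in> A \<rightarrow> carrier K" using that by (metis K.zero_closed Pi_I)
    qed (use that fin in auto)
    finally show ?thesis .
  qed
  have surj: "\<exists>w\<in>?W. \<exists>d\<in>carrier K. d \<noteq> \<zero>\<^bsub>K\<^esub> \<and> (\<forall>s\<in>S. w s = (if s = t then d else \<zero>\<^bsub>K\<^esub>))"
    if t: "t \<in> S" for t
  proof -
    let ?w = "finsum ?V (\<lambda>j. phi (H j t) \<odot>\<^bsub>?V\<^esub> col j) J"
    have HtK: "phi (H j t) \<in> carrier K" if "j \<in> J" for j using map_in H t that by blast
    have "finsum ?V (\<lambda>j. phi (H j t) \<odot>\<^bsub>?V\<^esub> col j) B \<in> ?W" if "B \<subseteq> J" for B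
    proof -
      have "finite B" using that fin finite_subset by blast
      thus ?thesis using that
      proof (induction B rule: finite_induct)
        case empty
        show ?case using W by (simp add: submodule_def)
      next
        case (insert j B)
        have *: "phi (H i t) \<odot>\<^bsub>?V\<^esub> col i \<in> ?W" if "i \<in> J" for i
          using W HtK[OF that] colW[OF that] by (simp add: submodule_def)
        have "finsum ?V (\<lambda>j. phi (H j t) \<odot>\<^bsub>?V\<^esub> col j) (insert j B)
            = phi (H j t) \<odot>\<^bsub>?V\<^esub> col j \<oplus>\<^bsub>?V\<^esub> finsum ?V (\<lambda>j. phi (H j t) \<odot>\<^bsub>?V\<^esub> col j) B"
          using insert HtK col by (intro V.M.finsum_insert) (auto intro!: V.smult_closed)
        thus ?case using insert * W by (simp add: submodule_def)
      qed
    qed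
    hence wW: "?w \<in> ?W" by blast
    have "?w s = phi (if s = t then e else 0)" if s: "s \<in> S" for s
    proof -
      have sA: "s \<in> A" using s SA by blast
      have "?w s = (\<Oplus>\<^bsub>K\<^esub>j\<in>J. (phi (H j t) \<odot>\<^bsub>?V\<^esub> col j) s)"
        using fin sA HtK col by (intro K.finsum_func_space) (auto intro!: V.smult_closed)
      also have "\<dots> = (\<Oplus>\<^bsub>K\<^esub>j\<in>J. ?M s j \<otimes>\<^bsub>K\<^esub> phi (H j t))"
        using sA HtK M
        by (intro K.finsum_cong') (auto simp: K.func_space_def col_def K.m_comm map_in)
      also have "\<dots> = phi (\<Sum>j\<in>J. M s j * H j t)"
        using fin M H sA t by (simp add: map_sum_mult)
      finally show ?thesis using MH[OF s t] by simp
    qed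
    with wW show ?thesis
      using e map_in[of e] map_zero_iff[of e] map_zero
      by (intro bexI[of _ ?w] bexI[of _ "phi e"]) auto
  qed
  show "mat_rank K A J ?M = card S"
  proof -
    have "vectorspace.dim K (?V\<lparr>carrier := ?W\<rparr>) = card S"
    proof (rule K.dim_func_space_restrict[OF fin(1) SA W _ surj])
      fix w l assume w: "w \<in> ?W" and w0: "\<And>s. s \<in> S \<Longrightarrow> w s = \<zero>\<^bsub>K\<^esub>" and l: "l \<in> A"
      show "w l = \<zero>\<^bsub>K\<^esub>"
      proof (cases "l \<in> S")
        case False
        have wl: "w i \<in> carrier K" if "i \<in> A" for i
          using w that W by (auto simp: submodule_def K.func_space_def)
        have "\<zero>\<^bsub>K\<^esub> = (\<Oplus>\<^bsub>K\<^esub>i\<in>A. phi (y l i) \<otimes>\<^bsub>K\<^esub> w i)"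
        proof (rule pair[symmetric, OF _ w])
          show "(\<lambda>i. phi (y l i)) \<in> A \<rightarrow> carrier K" using y l by (auto intro: map_in)
          fix j assume j: "j \<in> J"
          have "(\<Oplus>\<^bsub>K\<^esub>i\<in>A. phi (y l i) \<otimes>\<^bsub>K\<^esub> ?M i j) = phi (\<Sum>i\<in>A. y l i * M i j)"
            using fin y l M j by (simp add: map_sum_mult)
          also have "\<dots> = \<zero>\<^bsub>K\<^esub>"
            using yM[of l j] l False j map_zero_iff subset by blast
          finally show "(\<Oplus>\<^bsub>K\<^esub>i\<in>A. phi (y l i) \<otimes>\<^bsub>K\<^esub> ?M i j) = \<zero>\<^bsub>K\<^esub>" .
        qed
        also have "\<dots> = phi (y l l) \<otimes>\<^bsub>K\<^esub> w l"
        proof (rule one_term[OF l])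
          show "phi (y l l) \<otimes>\<^bsub>K\<^esub> w l \<in> carrier K" using y l wl by (auto intro: map_in)
          show "phi (y l i) \<otimes>\<^bsub>K\<^esub> w i = \<zero>\<^bsub>K\<^esub>" if "i \<in> A" "i \<noteq> l" for i
            using that w0 wl[of i] y[OF l, of i] map_in[of "y l i"] map_zero
            by (cases "i \<in> S") (auto simp: y_def)
        qed
        finally have "phi (d l) \<otimes>\<^bsub>K\<^esub> w l = \<zero>\<^bsub>K\<^esub>" by (simp add: y_def)
        thus ?thesis
          using K.integral_iff[of "phi (d l)" "w l"] d[OF l] map_in[of "d l"] wl[OF l]
            map_zero_iff[of "d l"] by blast
      qed (use w0 in auto)
    qed
    thus ?thesis by (simp add: mat_rank_def Let_def col_def)
  qed
  show "left_kernel_dim K A J ?M = card A - card S"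
  proof -
    let ?L = "left_kernel K A J ?M"
    have MK: "?M i j \<in> carrier K" if "i \<in> A" "j \<in> J" for i j using M that map_in by blast
    have hyp: "submodule K {w \<in> carrier ?V. (\<Oplus>\<^bsub>K\<^esub>i\<in>A. ?M i j \<otimes>\<^bsub>K\<^esub> w i) = \<zero>\<^bsub>K\<^esub>} ?V"
      if "j \<in> J" for j using MK that by (intro K.submodule_hyperplane fin) auto
    have L: "submodule K ?L ?V"
      using hyp V.module_axioms unfolding submodule_def left_kernel_def by auto
    have "vectorspace.dim K (?V\<lparr>carrier := ?L\<rparr>) = card (A - S)"
    proof (rule K.dim_func_space_restrict[OF fin(1) Diff_subset L])
      fix x l assume x: "x \<in> ?L" and x0: "\<And>s. s \<in> A - S \<Longrightarrow> x s = \<zero>\<^bsub>K\<^esub>" and l: "l \<in> A"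
      show "x l = \<zero>\<^bsub>K\<^esub>"
      proof (cases "l \<in> S")
        case True
        obtain w f where w: "w \<in> ?W" "f \<in> carrier K" "f \<noteq> \<zero>\<^bsub>K\<^esub>"
          and ws: "\<And>s. s \<in> S \<Longrightarrow> w s = (if s = l then f else \<zero>\<^bsub>K\<^esub>)"
          using surj[OF True] by blast
        have xK: "x i \<in> carrier K" if "i \<in> A" for i
          using x that by (auto simp: left_kernel_def K.func_space_def)
        have wK: "w i \<in> carrier K" if "i \<in> A" for i
          using w that W by (auto simp: submodule_def K.func_space_def)
        have "(\<Oplus>\<^bsub>K\<^esub>i\<in>A. x i \<otimes>\<^bsub>K\<^esub> w i) = \<zero>\<^bsub>K\<^esub>"
        proof (rule pair[OF _ w(1)])
          fix j assume j: "j \<in> J"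
          have "(\<Oplus>\<^bsub>K\<^esub>i\<in>A. x i \<otimes>\<^bsub>K\<^esub> ?M i j) = (\<Oplus>\<^bsub>K\<^esub>i\<in>A. ?M i j \<otimes>\<^bsub>K\<^esub> x i)"
            using xK MK j by (intro K.finsum_cong') (auto simp: K.m_comm)
          thus "(\<Oplus>\<^bsub>K\<^esub>i\<in>A. x i \<otimes>\<^bsub>K\<^esub> ?M i j) = \<zero>\<^bsub>K\<^esub>"
            using x j by (simp add: left_kernel_def)
        qed (use xK in auto)
        moreover have "(\<Oplus>\<^bsub>K\<^esub>i\<in>A. x i \<otimes>\<^bsub>K\<^esub> w i) = x l \<otimes>\<^bsub>K\<^esub> w l"
        proof (rule one_term[OF l])
          show "x i \<otimes>\<^bsub>K\<^esub> w i = \<zero>\<^bsub>K\<^esub>" if "i \<in> A" "i \<noteq> l" for i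
            using that x0[of i] ws[of i] xK[of i] wK[of i] by (cases "i \<in> S") auto
        qed (use xK wK l in auto)
        ultimately have "x l \<otimes>\<^bsub>K\<^esub> f = \<zero>\<^bsub>K\<^esub>" using ws[OF True] by simp
        thus ?thesis using K.integral_iff[of "x l" f] xK[OF l] w by blast
      qed (use x0 l in auto)
    next
      fix t assume t: "t \<in> A - S"
      define x where "x = (\<lambda>i\<in>A. phi (y t i))"
      have xV: "x \<in> carrier ?V"
        using y t by (auto simp: x_def K.func_space_def intro: map_in)
      have "(\<Oplus>\<^bsub>K\<^esub>i\<in>A. ?M i j \<otimes>\<^bsub>K\<^esub> x i) = \<zero>\<^bsub>K\<^esub>" if j: "j \<in> J" for j
      proof -
        have "(\<Oplus>\<^bsub>K\<^esub>i\<in>A. ?M i j \<otimes>\<^bsub>K\<^esub> x i) = (\<Oplus>\<^bsub>K\<^esub>i\<in>A. phi (y t i) \<otimes>\<^bsub>K\<^esub> ?M i j)"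
          using MK j y t
          by (intro K.finsum_cong') (auto simp: K.m_comm x_def map_in)
        also have "\<dots> = phi (\<Sum>i\<in>A. y t i * M i j)"
          using fin y t M j by (simp add: map_sum_mult)
        also have "\<dots> = \<zero>\<^bsub>K\<^esub>"
          using yM[OF t j] map_zero_iff subset by blast
        finally show ?thesis .
      qed
      hence "x \<in> ?L" using xV by (simp add: left_kernel_def)
      moreover have "x s = (if s = t then phi (d t) else \<zero>\<^bsub>K\<^esub>)" if "s \<in> A - S" for s
        using that by (auto simp: x_def y_def map_zero)
      ultimately show "\<exists>w\<in>?L. \<exists>f\<in>carrier K. f \<noteq> \<zero>\<^bsub>K\<^esub> \<and>
          (\<forall>s\<in>A - S. w s = (if s = t then f else \<zero>\<^bsub>K\<^esub>))"
        using d[of t] t map_in[of "d t"] map_zero_iff[of "d t"]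
        by (intro bexI[of _ x] bexI[of _ "phi (d t)"]) auto
    qed
    thus ?thesis using card_Diff_subset[OF finS SA] by (simp add: left_kernel_dim_def)
  qed
qed

end

lemma (in set_prime) residue_hom:
  "residue_hom R I (residue_field (ring_on R) I) (residue_map (ring_on R) I)"
proof -
  interpret K: field "residue_field (ring_on R) I" by (rule field_residue_field)
  note h = residue_map_hom
  show ?thesis
    using ring_hom_closed[OF h] ring_hom_add[OF h] ring_hom_mult[OF h] residue_map_zero_iff
    by unfold_locales simp_all
qed

text \<open>Both cardinalities are the rank of one matrix over the residue field. The count of
  parameters compares its two row bases through this.\<close>

lemma (in set_prime) card_row_basis_unique:
  assumes "finite A" "finite J" "\<And>l j. l \<in> A \<Longrightarrow> j \<in> J \<Longrightarrow> M l j \<in> R"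
    "row_basis_mod R I A J M S" "row_basis_mod R I A J M T"
  shows "card S = card T"
proof -
  have "mat_rank (residue_field (ring_on R) I) A J (\<lambda>u v. residue_map (ring_on R) I (M u v)) = card U"
    if "row_basis_mod R I A J M U" for U
    by (rule residue_hom.mat_rank_eq_card_row_basis[OF residue_hom assms(1,2) _ that])
       (rule assms(3))
  from this[OF assms(4)] this[OF assms(5)] show ?thesis by simp
qed

section \<open>Polynomials in a given set of variables\<close>

definition polys_in :: "('n \<times> nat) set \<Rightarrow> ('n, 'k::zero) dpoly set" where
  "polys_in V = {g. dvars g \<subseteq> V}"

definition dvar :: "'n \<times> nat \<Rightarrow> ('n, 'k::{zero,one}) dpoly" where
  "dvar v = Poly_Mapping.single (Poly_Mapping.single v 1) 1"

lemma A_ring_eq_polys_in: "A_ring k = polys_in (UNIV \<times> {..k})"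
  by (simp add: A_ring_def polys_in_def)

lemma polys_in_mono: "V \<subseteq> W \<Longrightarrow> polys_in V \<subseteq> polys_in W"
  by (auto simp: polys_in_def)

lemma finite_dvars [simp]: "finite (dvars g)"
  by (simp add: dvars_def)

lemma dvars_single: "dvars (Poly_Mapping.single m c) \<subseteq> Poly_Mapping.keys m"
  by (auto simp: dvars_def)

lemma dvars_add: "dvars (g + h) \<subseteq> dvars g \<union> dvars h"
  unfolding dvars_def using Poly_Mapping.keys_add[of g h] by blast

lemma dvars_uminus: "dvars (- g) = dvars (g :: ('n, 'k::ab_group_add) dpoly)"
  by (simp add: dvars_def)

lemma dvars_mult: "dvars (g * h) \<subseteq> dvars g \<union> dvars h"
  unfolding dvars_def using Poly_Mapping.keys_mult[of g h] Poly_Mapping.keys_add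
  by fastforce

lemma dvars_sum: "dvars (sum g S) \<subseteq> (\<Union>i\<in>S. dvars (g i))"
  by (induction S rule: infinite_finite_induct)
     (use dvars_add in \<open>fastforce simp: dvars_def\<close>)+

lemma single_in_polys_in: "Poly_Mapping.keys m \<subseteq> V \<Longrightarrow> Poly_Mapping.single m c \<in> polys_in V"
  using dvars_single[of m c] by (auto simp: polys_in_def)

lemma const_in_polys_in: "Poly_Mapping.single 0 c \<in> polys_in V"
  by (rule single_in_polys_in) simp

lemma set_ring_polys_in: "set_ring (polys_in V :: ('n, 'k::comm_ring_1) dpoly set)"
proof
  show "(1 :: ('n, 'k) dpoly) \<in> polys_in V"
    using const_in_polys_in[of 1 V] by (simp flip: single_one)
  fix g h :: "('n, 'k) dpoly" assume "g \<in> polys_in V" "h \<in> polys_in V"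
  thus "g - h \<in> polys_in V" "g * h \<in> polys_in V"
    using dvars_add[of g "- h"] dvars_uminus[of h] dvars_mult[of g h] by (auto simp: polys_in_def)
qed

lemma dvar_in_polys_in: "v \<in> V \<Longrightarrow> dvar v \<in> polys_in V"
  unfolding dvar_def by (rule single_in_polys_in) simp

lemma dvar_power:
  "(dvar v :: ('n, 'k::comm_ring_1) dpoly) ^ t = Poly_Mapping.single (Poly_Mapping.single v t) 1"
  by (induction t) (simp_all add: dvar_def mult_single flip: single_add single_one)

text \<open>The case of a single term is restricted to monomials of g, so that bounds on the
  variables of g are available there.\<close>

lemma dpoly_induct [case_names single add zero]:
  fixes g :: "'a \<Rightarrow>\<^sub>0 'b::comm_monoid_add"
  assumes "\<And>m c. m \<in> Poly_Mapping.keys g \<Longrightarrow> Q (Poly_Mapping.single m c)"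
    "\<And>a b. Q a \<Longrightarrow> Q b \<Longrightarrow> Q (a + b)" "Q 0"
  shows "Q g"
proof -
  have "S \<subseteq> Poly_Mapping.keys g \<Longrightarrow>
      Q (\<Sum>m\<in>S. Poly_Mapping.single m (Poly_Mapping.lookup g m))" if "finite S" for S
    using that by (induction S rule: finite_induct) (use assms in auto)
  thus ?thesis
    using poly_mapping_eq_sum_single[of g] finite_keys by (metis order_refl)
qed

lemma polys_in_empty: "g \<in> polys_in {} \<Longrightarrow> \<exists>c. g = Poly_Mapping.single 0 c"
  by (intro exI[of _ "Poly_Mapping.lookup g 0"] poly_mapping_eqI)
     (auto simp: polys_in_def dvars_def lookup_single when_def in_keys_iff)

lemma poly_in:
  assumes "set_ring B" "\<forall>t. coeff p t \<in> B" "x \<in> B"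
  shows "poly p x \<in> B"
proof -
  interpret set_ring B by fact
  show ?thesis unfolding poly_altdef using assms(2,3) by (auto intro!: closed)
qed

text \<open>Arguments that add one variable at a time use this form: division and differentiation of
  univariate polynomials then apply to multivariate ones, with coefficients kept in the smaller ring
  by a side condition.\<close>

lemma polys_in_insert:
  assumes "g \<in> polys_in (insert z W)"
  shows "\<exists>p. (\<forall>t. coeff p t \<in> polys_in W) \<and> poly p (dvar z) = (g :: ('n::linorder, 'k::field) dpoly)"
proof -
  interpret set_ring "polys_in W :: ('n, 'k) dpoly set" by (rule set_ring_polys_in)
  show ?thesis
  proof (induction g rule: dpoly_induct)
    case (single m c)
    let ?m = "m - Poly_Mapping.single z (Poly_Mapping.lookup m z)"
    have m: "m = ?m + Poly_Mapping.single z (Poly_Mapping.lookup m z)"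
      by (rule poly_mapping_eqI) (simp add: lookup_add lookup_minus lookup_single when_def)
    have "Poly_Mapping.keys m \<subseteq> insert z W"
      using single assms by (auto simp: polys_in_def dvars_def)
    moreover have "v \<in> Poly_Mapping.keys m" "v \<noteq> z" if "v \<in> Poly_Mapping.keys ?m" for v
      using that by (auto simp: in_keys_iff lookup_minus lookup_single when_def split: if_splits)
    ultimately have "Poly_Mapping.keys ?m \<subseteq> W" by blast
    hence "coeff (monom (Poly_Mapping.single ?m c) (Poly_Mapping.lookup m z)) t \<in> polys_in W" for t
      using single_in_polys_in zero_closed by auto
    moreover have "poly (monom (Poly_Mapping.single ?m c) (Poly_Mapping.lookup m z)) (dvar z)
        = Poly_Mapping.single m c"
      by (subst (4) m) (simp add: poly_monom dvar_power mult_single)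
    ultimately show ?case by blast
  next
    case (add a b)
    then obtain p1 p2 where "\<forall>t. coeff p1 t \<in> polys_in W" "poly p1 (dvar z) = a"
      "\<forall>t. coeff p2 t \<in> polys_in W" "poly p2 (dvar z) = b"      by blast
    thus ?case by (intro exI[of _ "p1 + p2"]) (auto intro: add_closed)
  next
    case zero
    show ?case by (intro exI[of _ 0]) (auto intro: closed)
  qed
qed

section \<open>Partial derivatives\<close>

lemma dpartial_superset:
  assumes "finite S" "Poly_Mapping.keys g \<subseteq> S"
  shows "dpartial v g = (\<Sum>m\<in>S. Poly_Mapping.single (m - Poly_Mapping.single v 1)
           (of_nat (Poly_Mapping.lookup m v) * Poly_Mapping.lookup g m))"
  unfolding dpartial_def by (rule sum.mono_neutral_left) (use assms in \<open>auto simp: in_keys_iff\<close>)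

lemma dpartial_single:
  "dpartial v (Poly_Mapping.single m c) =
     Poly_Mapping.single (m - Poly_Mapping.single v 1) (of_nat (Poly_Mapping.lookup m v) * c)"
  by (subst dpartial_superset[of "{m}"]) auto

lemma dpartial_zero [simp]: "dpartial v 0 = 0"
  by (simp add: dpartial_def)

lemma dpartial_add: "dpartial v (g + h) = dpartial v g + dpartial v h"
proof -
  let ?S = "Poly_Mapping.keys g \<union> Poly_Mapping.keys h"
  have "Poly_Mapping.keys (g + h) \<subseteq> ?S" by (rule Poly_Mapping.keys_add)
  thus ?thesis
    by (simp add: dpartial_superset[of ?S] lookup_add single_add distrib_left sum.distrib)
qed

lemma dpartial_mult: "dpartial v (g * h) = g * dpartial v h + h * dpartial v g"
proof -
  have single: "dpartial v (Poly_Mapping.single m c * Poly_Mapping.single m' c') =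
    Poly_Mapping.single m c * dpartial v (Poly_Mapping.single m' c') +
    Poly_Mapping.single m' c' * dpartial v (Poly_Mapping.single m c)" for m m' and c c' :: 'b
  proof -
    \<comment> \<open>Exponents are subtracted with truncation. Regrouping can change the exponent
      only if v does not occur in \<open>m'\<close>, and then the coefficient is 0.\<close>
    have *: "Poly_Mapping.single (m + m' - Poly_Mapping.single v 1) (of_nat (Poly_Mapping.lookup m' v) * c) =
        Poly_Mapping.single (m + (m' - Poly_Mapping.single v 1)) (of_nat (Poly_Mapping.lookup m' v) * c)"
      for m m' :: "'a \<times> nat \<Rightarrow>\<^sub>0 nat" and c :: 'b
    proof (cases "Poly_Mapping.lookup m' v = 0")
      case False
      hence "m + m' - Poly_Mapping.single v 1 = m + (m' - Poly_Mapping.single v 1)"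
        by (intro poly_mapping_eqI) (auto simp: lookup_add lookup_minus lookup_single when_def)
      thus ?thesis by simp
    qed simp
    have "dpartial v (Poly_Mapping.single m c * Poly_Mapping.single m' c') =
        Poly_Mapping.single (m + m' - Poly_Mapping.single v 1) (of_nat (Poly_Mapping.lookup m' v) * (c * c')) +
        Poly_Mapping.single (m' + m - Poly_Mapping.single v 1) (of_nat (Poly_Mapping.lookup m v) * (c * c'))"
      by (simp add: mult_single dpartial_single lookup_add algebra_simps flip: single_add)
    also have "\<dots> = Poly_Mapping.single m c * dpartial v (Poly_Mapping.single m' c') +
        Poly_Mapping.single m' c' * dpartial v (Poly_Mapping.single m c)"
      unfolding * by (simp add: mult_single dpartial_single algebra_simps)
    finally show ?thesis .
  qed
  have "dpartial v (Poly_Mapping.single m c * h) =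
      Poly_Mapping.single m c * dpartial v h + h * dpartial v (Poly_Mapping.single m c)" for m c
    by (induction h rule: dpoly_induct) (simp_all add: single dpartial_add algebra_simps)
  thus ?thesis
    by (induction g rule: dpoly_induct) (simp_all add: dpartial_add algebra_simps)
qed

lemma dpartial_dvar: "dpartial v (dvar w) = (if v = w then 1 else 0)"
  by (auto simp: dvar_def dpartial_single lookup_single when_def single_one)

lemma dpartial_notin: "v \<notin> dvars g \<Longrightarrow> dpartial v g = 0"
  unfolding dpartial_def dvars_def by (intro sum.neutral) (auto simp: in_keys_iff)

lemma dvars_dpartial: "dvars (dpartial v g) \<subseteq> dvars g"
proof -
  have "Poly_Mapping.keys (m - Poly_Mapping.single v 1) \<subseteq> Poly_Mapping.keys m" for m :: "'a \<times> nat \<Rightarrow>\<^sub>0 nat"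
    by (auto simp: in_keys_iff lookup_minus)
  hence "dvars (dpartial v g) \<subseteq> (\<Union>m\<in>Poly_Mapping.keys g. Poly_Mapping.keys m)"
    unfolding dpartial_def using dvars_single by (intro order.trans[OF dvars_sum]) fastforce
  thus ?thesis by (simp add: dvars_def)
qed

lemma dpartial_in_polys_in: "g \<in> polys_in V \<Longrightarrow> dpartial v g \<in> polys_in V"
  using dvars_dpartial[of v g] by (auto simp: polys_in_def)

lemma dpartial_poly_dvar:
  fixes p :: "('n::linorder, 'k::field) dpoly poly"
  assumes "\<forall>t. coeff p t \<in> polys_in W" "z \<notin> W"
  shows "dpartial z (poly p (dvar z)) = poly (pderiv p) (dvar z)"
  using assms(1)
proof (induction p)
  case (pCons c p)
  have "c \<in> polys_in W" "\<forall>t. coeff p t \<in> polys_in W"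
    using pCons.prems spec[OF pCons.prems, of 0] spec[OF pCons.prems, of "Suc _"] by auto
  with pCons assms(2) have "dpartial z c = 0"
    by (intro dpartial_notin) (auto simp: polys_in_def)
  thus ?case
    using pCons.IH \<open>\<forall>t. coeff p t \<in> polys_in W\<close>
    by (simp add: dpartial_add dpartial_mult dpartial_dvar pderiv_pCons algebra_simps)
qed simp

text \<open>Multiplying by powers of the leading coefficient of G replaces dividing by it, so all
  coefficients stay in B. The clause on the top coefficient of u serves to show that a cofactor is
  nontrivial when minimal relations are compared.\<close>

lemma pseudo_division:
  fixes a G :: "'a::idom poly"
  assumes "set_ring B" "\<forall>t. coeff a t \<in> B" "\<forall>t. coeff G t \<in> B"
    "degree a \<le> n + degree G" "degree G > 0"
  shows "\<exists>u r. (\<forall>t. coeff u t \<in> B) \<and> (\<forall>t. coeff r t \<in> B) \<and>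
    Polynomial.smult (lead_coeff G ^ Suc n) a = u * G + r \<and> degree r < degree G \<and> degree u \<le> n \<and>
    coeff u n = lead_coeff G ^ n * coeff a (n + degree G)"
  using assms(2,4)
proof (induction n arbitrary: a)
  case 0
  interpret set_ring B by fact
  let ?u = "[:coeff a (degree G):]" and ?r = "Polynomial.smult (lead_coeff G) a - Polynomial.smult (coeff a (degree G)) G"
  have "coeff ?r t = 0" if "t \<ge> degree G" for t
    using that 0 by (cases "t = degree G") (auto simp: coeff_eq_0 mult.commute)
  hence "degree ?r < degree G"
    using assms(5) by (metis coeff_0_degree_minus_1 degree_0 leading_coeff_0_iff not_le)
  moreover have "coeff ?u t \<in> B" for t using 0 by (cases t) (auto intro: closed)
  moreover have "coeff ?r t \<in> B" for t using 0 assms(3) by (auto intro!: closed)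
  ultimately show ?case by (intro exI[of _ ?u] exI[of _ ?r]) simp
next
  case (Suc n)
  interpret set_ring B by fact
  let ?c = "coeff a (Suc n + degree G)" and ?l = "lead_coeff G"
  let ?b = "Polynomial.smult ?l a - monom ?c (Suc n) * G"
  have bB: "\<forall>t. coeff ?b t \<in> B"
    using Suc.prems assms(3) by (auto simp: coeff_monom_mult intro!: closed)
  have "coeff ?b t = 0" if "t > n + degree G" for t
  proof (cases "t = Suc n + degree G")
    case True
    thus ?thesis by (simp add: coeff_monom_mult)
  next
    case False
    hence "coeff a t = 0" "coeff G (t - Suc n) = 0"
      using that Suc.prems(2) by (auto intro!: coeff_eq_0)
    thus ?thesis by (simp add: coeff_monom_mult)
  qed
  hence "degree ?b \<le> n + degree G" by (intro degree_le) auto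
  from Suc.IH[OF bB this] obtain u r where u: "\<forall>t. coeff u t \<in> B" "\<forall>t. coeff r t \<in> B"
    "Polynomial.smult (?l ^ Suc n) ?b = u * G + r" "degree r < degree G" "degree u \<le> n" by blast
  let ?u = "u + monom (?l ^ Suc n * ?c) (Suc n)"
  have "Polynomial.smult (?l ^ Suc (Suc n)) a = Polynomial.smult (?l ^ Suc n) (Polynomial.smult ?l a)"
    by (simp add: mult.commute)
  also have "\<dots> = Polynomial.smult (?l ^ Suc n) ?b + Polynomial.smult (?l ^ Suc n) (monom ?c (Suc n) * G)"
    by (simp only: smult_diff_right diff_add_cancel)
  also have "\<dots> = Polynomial.smult (?l ^ Suc n) ?b + monom (?l ^ Suc n * ?c) (Suc n) * G"
    by (simp only: smult_monom mult_smult_left[symmetric])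
  also have "\<dots> = ?u * G + r" unfolding u(3) distrib_right by (rule add.assoc[THEN trans]) (simp only: add.assoc add.commute[of r])
  finally have "Polynomial.smult (?l ^ Suc (Suc n)) a = ?u * G + r" .
  moreover have "degree ?u \<le> Suc n"
    using u(5) by (intro degree_add_le) (auto intro: degree_monom_le)
  moreover have "coeff ?u (Suc n) = ?l ^ Suc n * ?c"
    using u(5) by (simp add: coeff_eq_0 del: power_Suc)
  moreover have "coeff ?u t \<in> B" for t
    using u(1) Suc.prems(1) assms(3) by (auto intro!: closed simp del: power_Suc)
  ultimately show ?case using u by blast
qed

section \<open>Minimal algebraic relations\<close>

text \<open>Modulo q, G is the minimal polynomial of z over the field generated by W, up to scaling:
  its leading coefficient survives, and every relation of smaller degree is trivial.\<close>

definition min_rel ::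
    "('n \<times> nat) set \<Rightarrow> 'n \<times> nat \<Rightarrow> ('n::linorder, 'k::field_char_0) dpoly set \<Rightarrow> ('n, 'k) dpoly poly \<Rightarrow> bool" where
  "min_rel W z q G \<longleftrightarrow> (\<forall>t. coeff G t \<in> polys_in W) \<and> poly G (dvar z) \<in> q \<and> lead_coeff G \<notin> q \<and>
     (\<forall>p. (\<forall>t. coeff p t \<in> polys_in W) \<longrightarrow> degree p < degree G \<longrightarrow> poly p (dvar z) \<in> q \<longrightarrow>
        (\<forall>t. coeff p t \<in> q))"

locale prime_polys = set_prime "polys_in V" q
  for V :: "('n::linorder \<times> nat) set" and q :: "('n, 'k::field_char_0) dpoly set"
begin

lemma polys_in_V: "W \<subseteq> V \<Longrightarrow> a \<in> polys_in W \<Longrightarrow> a \<in> polys_in V"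
  using polys_in_mono by blast

lemma poly_in_q:
  assumes "\<forall>t. coeff p t \<in> q" "z \<in> V"
  shows "poly p (dvar z) \<in> q"
  unfolding poly_altdef using assms dvar_in_polys_in[of z V]
  by (intro sum mult_right power_closed) auto

lemma exists_min_rel:
  assumes "W \<subseteq> V" "z \<in> V" "\<forall>t. coeff p t \<in> polys_in W" "poly p (dvar z) \<in> q" "coeff p s \<notin> q"
  shows "\<exists>G. min_rel W z q G"
proof -
  interpret W: set_ring "polys_in W :: ('n, 'k) dpoly set" by (rule set_ring_polys_in)
  let ?Q = "\<lambda>p. (\<forall>t. coeff p t \<in> polys_in W) \<and> poly p (dvar z) \<in> q \<and> (\<exists>t. coeff p t \<notin> q)"
  have "?Q p" using assms by blast
  then obtain G where G: "?Q G" and min: "\<And>p. ?Q p \<Longrightarrow> degree G \<le> degree p"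
    using ex_has_least_nat[of ?Q p degree] by blast
  \<comment> \<open>If it were in q, dropping the leading term would leave a nontrivial relation of
    smaller degree.\<close>
  have "lead_coeff G \<notin> q"
  proof
    assume lc: "lead_coeff G \<in> q"
    let ?G = "G - monom (lead_coeff G) (degree G)"
    have "poly (monom (lead_coeff G) (degree G)) (dvar z) \<in> q"
      using lc assms(2) by (auto intro!: poly_in_q simp: zero)
    hence "poly ?G (dvar z) \<in> q" using G diff by simp
    moreover have "\<forall>t. coeff ?G t \<in> polys_in W" using G by (auto intro!: W.closed)
    moreover from G obtain t where t: "coeff G t \<notin> q" by blast
    hence "t \<noteq> degree G" using lc by metis
    hence "coeff ?G t \<notin> q" using t by simp
    ultimately have "degree G \<le> degree ?G" by (intro min) blast
    moreover have "degree ?G \<le> degree G"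
      by (rule degree_diff_le) (auto intro: degree_monom_le)
    moreover have "coeff ?G (degree G) = 0" by simp
    ultimately have "?G = 0" by (metis leading_coeff_0_iff le_antisym)
    thus False using \<open>coeff ?G t \<notin> q\<close> zero by simp
  qed
  with G min show ?thesis unfolding min_rel_def by (metis not_le)
qed

lemma degree_min_rel_pos:
  assumes "min_rel W z q G"
  shows "degree G > 0"
proof (rule ccontr)
  assume "\<not> ?thesis"
  then obtain c where "G = [:c:]" using degree_eq_zeroE by blast
  with assms show False by (simp add: min_rel_def)
qed

lemma of_nat_mult_in_q:
  assumes "of_nat n * a \<in> q" "n > 0"
  shows "a \<in> q"
proof -
  have "Poly_Mapping.single 0 (inverse (of_nat n)) * (of_nat n * a) \<in> q"
    by (rule mult_left[OF const_in_polys_in assms(1)])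
  moreover have "Poly_Mapping.single 0 (inverse (of_nat n)) * of_nat n = (1 :: ('n, 'k) dpoly)"
    using assms(2) by (simp add: mult_single flip: single_of_nat single_one)
  ultimately show ?thesis by (simp add: mult.assoc[symmetric])
qed

text \<open>Separability in characteristic 0: a derivative in q would be a relation of smaller
  degree, hence trivial, and its top coefficient is the leading coefficient of G times a positive
  integer.\<close>

lemma min_rel_pderiv:
  assumes "min_rel W z q G" "W \<subseteq> V"
  shows "poly (pderiv G) (dvar z) \<notin> q"
proof
  interpret W: set_ring "polys_in W :: ('n, 'k) dpoly set" by (rule set_ring_polys_in)
  assume "poly (pderiv G) (dvar z) \<in> q"
  moreover have pos: "degree G > 0" by (rule degree_min_rel_pos[OF assms(1)])
  moreover have "\<forall>t. coeff (pderiv G) t \<in> polys_in W"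
    using assms by (auto simp: min_rel_def coeff_pderiv intro!: W.closed simp del: of_nat_Suc)
  ultimately have cq: "coeff (pderiv G) (degree G - 1) \<in> q"
  proof -
    have "degree (pderiv G) < degree G" using pos by (simp add: degree_pderiv)
    thus ?thesis
      using assms(1) \<open>poly (pderiv G) (dvar z) \<in> q\<close> \<open>\<forall>t. coeff (pderiv G) t \<in> polys_in W\<close>
      unfolding min_rel_def by blast
  qed
  hence "of_nat (degree G) * lead_coeff G \<in> q"
    using pos by (simp add: coeff_pderiv del: of_nat_Suc)
  with of_nat_mult_in_q pos assms show False unfolding min_rel_def by blast
qed

lemma pseudo_division_eval:
  fixes p G :: "('n, 'k) dpoly poly"
  assumes "W \<subseteq> V" "z \<in> V" "\<forall>t. coeff p t \<in> polys_in W" "\<forall>t. coeff G t \<in> polys_in W"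
    "degree p \<le> n + degree G" "degree G > 0"
  obtains u r where "\<forall>t. coeff u t \<in> polys_in W" "\<forall>t. coeff r t \<in> polys_in W"
    "poly u (dvar z) \<in> polys_in V" "poly r (dvar z) \<in> polys_in V"
    "lead_coeff G ^ Suc n * poly p (dvar z) = poly u (dvar z) * poly G (dvar z) + poly r (dvar z)"
    "degree r < degree G" "degree u \<le> n" "coeff u n = lead_coeff G ^ n * coeff p (n + degree G)"
proof -
  from pseudo_division[OF set_ring_polys_in assms(3-6)] obtain u r where
    u: "\<forall>t. coeff u t \<in> polys_in W" "\<forall>t. coeff r t \<in> polys_in W"
    "Polynomial.smult (lead_coeff G ^ Suc n) p = u * G + r" "degree r < degree G" "degree u \<le> n"
    "coeff u n = lead_coeff G ^ n * coeff p (n + degree G)"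
    by blast
  have in_V: "poly v (dvar z) \<in> polys_in V" if "\<forall>t. coeff v t \<in> polys_in W" for v :: "('n, 'k) dpoly poly"
    by (rule poly_in[OF set_ring_polys_in]) (use that polys_in_V[OF assms(1)] dvar_in_polys_in[OF assms(2)] in auto)
  from u(3) have "poly (Polynomial.smult (lead_coeff G ^ Suc n) p) (dvar z) = poly (u * G + r) (dvar z)"
    by (rule arg_cong)
  hence "lead_coeff G ^ Suc n * poly p (dvar z) = poly u (dvar z) * poly G (dvar z) + poly r (dvar z)"
    by (simp only: poly_smult poly_add poly_mult)
  with u in_V show ?thesis by (intro that[of u r]) auto
qed

end

section \<open>Extension of derivations\<close>

text \<open>The derivation that sends a variable v in W to d v and every other variable to
  0.\<close>

definition der_on ::
    "('n::linorder \<times> nat) set \<Rightarrow> ('n \<times> nat \<Rightarrow> ('n, 'k::field) dpoly fract) \<Rightarrow> ('n, 'k) dpoly \<Rightarrow> ('n, 'k) dpoly fract"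
  where "der_on W d a = (\<Sum>v\<in>W. d v * to_fract (dpartial v a))"

lemma der_on_add: "der_on W d (a + b) = der_on W d a + der_on W d b"
  by (simp add: der_on_def dpartial_add distrib_left sum.distrib)

lemma der_on_mult: "der_on W d (a * b) = to_fract a * der_on W d b + to_fract b * der_on W d a"
  by (simp add: der_on_def dpartial_mult distrib_left sum.distrib sum_distrib_left mult_ac)

text \<open>X modulo Y is a vector space over the residue field of q, since q maps X into Y and
  elements outside q act invertibly. The derivations D of interest satisfy
  \<open>D a - eps * a\<close> in Y for a in q. Two uses occur: eps = 0 with X the local ring of q
  gives derivations of the residue field, and eps = 1 with X the maximal ideal and Y its square
  gives the Euler operator.\<close>

locale der_extension = prime_polys V q for V :: "('n::linorder \<times> nat) set" and q :: "('n, 'k::field_char_0) dpoly set" +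
  fixes X Y :: "('n, 'k) dpoly fract set" and eps :: "('n, 'k) dpoly fract"
  assumes finite_V: "finite V"
    and X_zero: "0 \<in> X" and X_add: "x \<in> X \<Longrightarrow> y \<in> X \<Longrightarrow> x + y \<in> X"
    and X_mult: "a \<in> polys_in V \<Longrightarrow> x \<in> X \<Longrightarrow> to_fract a * x \<in> X"
    and X_div: "s \<in> polys_in V \<Longrightarrow> s \<notin> q \<Longrightarrow> x \<in> X \<Longrightarrow> x / to_fract s \<in> X"
    and Y_zero: "0 \<in> Y" and Y_add: "x \<in> Y \<Longrightarrow> y \<in> Y \<Longrightarrow> x + y \<in> Y"
    and Y_mult: "a \<in> polys_in V \<Longrightarrow> x \<in> Y \<Longrightarrow> to_fract a * x \<in> Y"
    and Y_div: "s \<in> polys_in V \<Longrightarrow> s \<notin> q \<Longrightarrow> x \<in> Y \<Longrightarrow> x / to_fract s \<in> Y"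
    and q_X: "a \<in> q \<Longrightarrow> x \<in> X \<Longrightarrow> to_fract a * x \<in> Y"
    and eps: "a \<in> q \<Longrightarrow> eps * to_fract a \<in> X"
begin

lemma X_diff: "x \<in> X \<Longrightarrow> y \<in> X \<Longrightarrow> x - y \<in> X"
  using X_add[of x "to_fract (- 1) * y"] X_mult[of "- 1" y] by (simp add: closed)

lemma Y_diff: "x \<in> Y \<Longrightarrow> y \<in> Y \<Longrightarrow> x - y \<in> Y"
  using Y_add[of x "to_fract (- 1) * y"] Y_mult[of "- 1" y] by (simp add: closed)

lemma der_on_X:
  assumes "finite W" "\<And>v. v \<in> W \<Longrightarrow> d v \<in> X" "a \<in> polys_in V"
  shows "der_on W d a \<in> X"
  unfolding der_on_def using assms(1,2)
proof (induction W rule: finite_induct)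
  case (insert v W)
  thus ?case using X_mult[OF dpartial_in_polys_in[OF assms(3)], of "d v" v]
    by (auto intro!: X_add simp: mult.commute)
qed (simp add: X_zero)

text \<open>The classical extension of a derivation to one more variable. If z is transcendental
  modulo q, any value is allowed and 0 is taken. If z is algebraic, the condition at the minimal
  relation fixes the value, because the derivative of the relation at z is invertible.\<close>

lemma extend_step:
  assumes W: "W \<subseteq> V" and z: "z \<in> V" "z \<notin> W" and d: "\<And>v. v \<in> W \<Longrightarrow> d v \<in> X"
    and der: "\<And>a. a \<in> q \<Longrightarrow> a \<in> polys_in W \<Longrightarrow> der_on W d a - eps * to_fract a \<in> Y"
  shows "\<exists>x\<in>X. \<forall>a\<in>q \<inter> polys_in (insert z W).
     der_on (insert z W) (d(z := x)) a - eps * to_fract a \<in> Y"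
proof -
  define D where "D x a = der_on (insert z W) (d(z := x)) a" for x a
  have finW: "finite W" using W finite_V finite_subset by blast
  have D: "D x a = der_on W d a + x * to_fract (dpartial z a)" for x a
    using finW z(2) by (auto simp: D_def der_on_def intro!: sum.cong)
  have D_add: "D x (a + b) = D x a + D x b" and
    D_mult: "D x (a * b) = to_fract a * D x b + to_fract b * D x a" for x a b
    by (simp_all add: D_def der_on_add der_on_mult)
  have D_X: "D x a \<in> X" if "x \<in> X" "a \<in> polys_in V" for x a
    unfolding D_def using that d finW by (intro der_on_X) auto
  have zV: "dvar z \<in> polys_in V" by (rule dvar_in_polys_in[OF z(1)])
  have in_V: "poly p (dvar z) \<in> polys_in V" if "\<forall>t. coeff p t \<in> polys_in W" for p :: "('n, 'k) dpoly poly"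
    by (rule poly_in[OF set_ring_polys_in]) (use that polys_in_V[OF W] zV in auto)
  \<comment> \<open>Relations that are trivial, in the sense that all coefficients lie in q, impose
    no condition on the value x at z.\<close>
  have coeffs_q: "D x (poly p (dvar z)) - eps * to_fract (poly p (dvar z)) \<in> Y"
    if "\<forall>t. coeff p t \<in> polys_in W" "\<forall>t. coeff p t \<in> q" "x \<in> X" for p x
    using that(1,2)
  proof (induction p)
    case 0
    show ?case by (simp add: D_def der_on_def Y_zero)
  next
    case (pCons c p)
    let ?b = "poly p (dvar z)"
    have c: "c \<in> polys_in W" "c \<in> q"
      using spec[OF pCons.prems(1), of 0] spec[OF pCons.prems(2), of 0] by auto
    have p: "\<forall>t. coeff p t \<in> polys_in W" "\<forall>t. coeff p t \<in> q"
      using spec[OF pCons.prems(1), of "Suc _"] spec[OF pCons.prems(2), of "Suc _"] by auto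
    have "dpartial z c = 0" using c(1) z(2) by (intro dpartial_notin) (auto simp: polys_in_def)
    hence 1: "D x c - eps * to_fract c \<in> Y" using der c by (simp add: D)
    have 2: "to_fract (dvar z) * (D x ?b - eps * to_fract ?b) \<in> Y"
      using pCons.IH p zV by (intro Y_mult) auto
    have 3: "to_fract ?b * D x (dvar z) \<in> Y"
      using p z D_X[OF that(3) zV] by (intro q_X poly_in_q) auto
    have "D x (poly (pCons c p) (dvar z)) - eps * to_fract (poly (pCons c p) (dvar z)) =
      (D x c - eps * to_fract c) + to_fract (dvar z) * (D x ?b - eps * to_fract ?b) + to_fract ?b * D x (dvar z)"
      by (simp add: D_add D_mult algebra_simps)
    thus ?case using 1 2 3 Y_add by simp
  qed
  show ?thesis
  proof (cases "\<forall>p. (\<forall>t. coeff p t \<in> polys_in W) \<longrightarrow> poly p (dvar z) \<in> q \<longrightarrow> (\<forall>t. coeff p t \<in> q)")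
    case True
    show ?thesis
    proof (intro bexI[of _ 0] ballI X_zero, elim IntE)
      fix a assume a: "a \<in> q" "a \<in> polys_in (insert z W)"
      from polys_in_insert[OF a(2)] obtain p where p: "\<forall>t. coeff p t \<in> polys_in W" "poly p (dvar z) = a"
        by blast
      with True a coeffs_q[of p 0] X_zero show "der_on (insert z W) (d(z := 0)) a - eps * to_fract a \<in> Y"
        unfolding D_def by blast
    qed
  next
    case False
    then obtain G where G: "min_rel W z q G" using exists_min_rel[OF W z(1)] by metis
    let ?g = "poly G (dvar z)" and ?g' = "poly (pderiv G) (dvar z)"
    have GW: "\<forall>t. coeff G t \<in> polys_in W" and gq: "?g \<in> q" and lead: "lead_coeff G \<notin> q"
      using G by (auto simp: min_rel_def)
    have g': "dpartial z ?g = ?g'" by (rule dpartial_poly_dvar[OF GW z(2)])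
    have g'V: "?g' \<in> polys_in V" using g' dpartial_in_polys_in[OF in_V[of G, OF GW], of z] by simp
    have g'q: "?g' \<notin> q" by (rule min_rel_pderiv[OF G W])
    \<comment> \<open>The solution of the linear equation \<open>D x ?g = eps * to_fract ?g\<close>,
      in which x has the coefficient \<open>?g'\<close>.\<close>
    define x where "x = (eps * to_fract ?g - der_on W d ?g) / to_fract ?g'"
    have x: "x \<in> X"
      unfolding x_def using g'V g'q gq eps der_on_X[OF finW d] subset by (intro X_div X_diff) auto
    have "?g' \<noteq> 0" using g'q zero by metis
    hence Dg: "D x ?g = eps * to_fract ?g" by (simp add: D g' x_def)
    show ?thesis
    proof (intro bexI[of _ x] ballI x, elim IntE)
      fix a assume a: "a \<in> q" "a \<in> polys_in (insert z W)"
      from polys_in_insert[OF a(2)] obtain p where p: "\<forall>t. coeff p t \<in> polys_in W" "poly p (dvar z) = a"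
        by blast
      \<comment> \<open>Pseudo-division by G leaves a remainder that lies in q and has smaller
        degree, so its coefficients lie in q and \<open>coeffs_q\<close> applies. The factor
        \<open>?l\<close> is outside q and can be divided out of Y.\<close>
      let ?l = "lead_coeff G ^ Suc (degree p)"
      have "degree p \<le> degree p + degree G" by simp
      from pseudo_division_eval[OF W z(1) p(1) GW this degree_min_rel_pos[OF G]]
      obtain u r where ur: "\<forall>t. coeff r t \<in> polys_in W"
        "poly u (dvar z) \<in> polys_in V" "poly r (dvar z) \<in> polys_in V"
        "?l * poly p (dvar z) = poly u (dvar z) * poly G (dvar z) + poly r (dvar z)" "degree r < degree G"
        by metis
      let ?u = "poly u (dvar z)" and ?r = "poly r (dvar z)"
      have lV: "?l \<in> polys_in V" using polys_in_V[OF W] GW by (auto intro!: closed)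
      have lq: "?l \<notin> q" using prime_power[of "lead_coeff G"] polys_in_V[OF W] GW lead by blast
      have "?r = ?l * a - ?u * ?g" using ur(4) p(2) by (simp add: algebra_simps)
      hence rq: "?r \<in> q" using lV a(1) ur(2) gq by (auto intro!: diff mult_left simp del: power_Suc)
      have "\<forall>t. coeff r t \<in> q" using G ur(1,5) rq unfolding min_rel_def by blast
      hence Yr: "D x ?r - eps * to_fract ?r \<in> Y" using coeffs_q[of r x] ur(1) x by blast
      have Yu: "to_fract ?g * D x ?u \<in> Y" using q_X[OF gq] D_X[OF x ur(2)] by blast
      have Yl: "to_fract a * D x ?l \<in> Y" using q_X[OF a(1)] D_X[OF x lV] by blast
      have "to_fract ?l * (D x a - eps * to_fract a) =
          D x (?l * a) - eps * to_fract (?l * a) - to_fract a * D x ?l"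
        by (simp add: D_mult algebra_simps del: power_Suc)
      also have "?l * a = ?u * ?g + ?r" using ur(4) p(2) by simp
      also have "D x (?u * ?g + ?r) - eps * to_fract (?u * ?g + ?r) - to_fract a * D x ?l =
          to_fract ?g * D x ?u + (D x ?r - eps * to_fract ?r) - to_fract a * D x ?l"
        by (simp add: D_add D_mult Dg algebra_simps del: power_Suc)
      finally have "to_fract ?l * (D x a - eps * to_fract a) \<in> Y"
        using Yr Yu Yl by (simp add: Y_add Y_diff del: power_Suc)
      hence "to_fract ?l * (D x a - eps * to_fract a) / to_fract ?l \<in> Y"
        by (rule Y_div[OF lV lq])
      moreover have "?l \<noteq> 0" using lq zero by metis
      ultimately show "der_on (insert z W) (d(z := x)) a - eps * to_fract a \<in> Y"
        by (simp add: D_def del: power_Suc)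
    qed
  qed
qed

theorem extend_derivation:
  assumes W: "W \<subseteq> V" and d: "\<And>v. v \<in> W \<Longrightarrow> d v \<in> X"
    and der: "\<And>a. a \<in> q \<Longrightarrow> a \<in> polys_in W \<Longrightarrow> der_on W d a - eps * to_fract a \<in> Y"
  shows "\<exists>d'. (\<forall>v\<in>V. d' v \<in> X) \<and> (\<forall>w\<in>W. d' w = d w) \<and>
     (\<forall>a\<in>q. der_on V d' a - eps * to_fract a \<in> Y)"
proof -
  have "\<exists>d'. (\<forall>v\<in>W \<union> T. d' v \<in> X) \<and> (\<forall>w\<in>W. d' w = d w) \<and>
     (\<forall>a\<in>q \<inter> polys_in (W \<union> T). der_on (W \<union> T) d' a - eps * to_fract a \<in> Y)"
    if "finite T" "T \<subseteq> V" for T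
    using that
  proof (induction T rule: finite_induct)
    case empty
    show ?case using d der by (intro exI[of _ d]) auto
  next
    case (insert z T)
    then obtain d' where "(\<forall>v\<in>W \<union> T. d' v \<in> X) \<and> (\<forall>w\<in>W. d' w = d w) \<and>
        (\<forall>a\<in>q \<inter> polys_in (W \<union> T). der_on (W \<union> T) d' a - eps * to_fract a \<in> Y)"
      by blast
    hence d': "\<And>v. v \<in> W \<union> T \<Longrightarrow> d' v \<in> X" "\<And>w. w \<in> W \<Longrightarrow> d' w = d w"
      "\<And>a. a \<in> q \<Longrightarrow> a \<in> polys_in (W \<union> T) \<Longrightarrow> der_on (W \<union> T) d' a - eps * to_fract a \<in> Y"
      by blast+
    show ?case
    proof (cases "z \<in> W")
      case True
      hence "W \<union> insert z T = W \<union> T" by auto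
      with d' show ?thesis by (intro exI[of _ d']) auto
    next
      case False
      hence "z \<notin> W \<union> T" "z \<in> V" "W \<union> T \<subseteq> V" using insert W by auto
      from extend_step[OF this(3,2,1) d'(1,3)] obtain x where x: "x \<in> X"
        "\<forall>a\<in>q \<inter> polys_in (insert z (W \<union> T)).
           der_on (insert z (W \<union> T)) (d'(z := x)) a - eps * to_fract a \<in> Y" by blast
      have eq: "W \<union> insert z T = insert z (W \<union> T)" by auto
      show ?thesis
      proof (intro exI[of _ "d'(z := x)"] conjI)
        show "\<forall>a\<in>q \<inter> polys_in (W \<union> insert z T).
            der_on (W \<union> insert z T) (d'(z := x)) a - eps * to_fract a \<in> Y"
          unfolding eq by (rule x(2))
      qed (use x(1) d' False in auto)
    qed
  qed
  moreover have "W \<union> V = V" "q \<inter> polys_in V = q" using W subset by auto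
  ultimately show ?thesis using finite_V by (metis order.refl)
qed

end

section \<open>Primes of equal transcendence degree\<close>

text \<open>E is a transcendence basis for both residue rings. Variables outside E are added one by
  one. At each stage the two primes agree on the polynomials in W, so the minimal relation of z for
  q' divides the one for q; the latter is irreducible because q is prime, so both have the same
  degree, and division by it carries membership in q' over to q.\<close>

lemma prime_eq_of_algebraic:
  assumes V: "finite V" and q: "set_prime (polys_in V) q" and q': "set_prime (polys_in V) q'"
    and sub: "q \<subseteq> q'" and E: "E \<subseteq> V" "polys_in E \<inter> q' \<subseteq> {0}"
    and alg: "\<And>w. w \<in> V - E \<Longrightarrow> \<exists>a\<in>polys_in (insert w E) \<inter> q. a \<noteq> 0"
  shows "q = (q' :: ('n::linorder, 'k::field_char_0) dpoly set)"
proof -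
  interpret q: prime_polys V q by (rule prime_polys.intro) (rule q)
  interpret q': prime_polys V q' by (rule prime_polys.intro) (rule q')
  have "q' \<inter> polys_in (E \<union> T) \<subseteq> q" if "finite T" "T \<subseteq> V - E" for T
    using that
  proof (induction T rule: finite_induct)
    case empty
    show ?case using E q.zero by auto
  next
    case (insert z T)
    let ?W = "E \<union> T"
    have W: "?W \<subseteq> V" and z: "z \<in> V" "z \<notin> E" using insert E by auto
    have IH: "a \<in> q" if "a \<in> q'" "a \<in> polys_in ?W" for a using insert that by auto
    obtain a where a: "a \<in> polys_in (insert z E)" "a \<in> q" "a \<noteq> 0" using alg z by blast
    from polys_in_insert[OF a(1)] obtain p where p: "\<forall>t. coeff p t \<in> polys_in E" "poly p (dvar z) = a"
      by blast
    have "p \<noteq> 0" using a p by auto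
    then obtain s where s: "coeff p s \<noteq> 0" by (metis leading_coeff_0_iff)
    hence "coeff p s \<notin> q" using p(1) E(2) sub by blast
    moreover have pW: "\<forall>t. coeff p t \<in> polys_in ?W" using p(1) polys_in_mono[of E ?W] by auto
    ultimately obtain G where G: "min_rel ?W z q G"
      using q.exists_min_rel[OF W z(1), of p s] a p by blast
    have GW: "\<forall>t. coeff G t \<in> polys_in ?W" and Gq: "poly G (dvar z) \<in> q" and lead: "lead_coeff G \<notin> q"
      using G by (auto simp: min_rel_def)
    have lead': "lead_coeff G \<notin> q'" using IH GW lead by blast
    obtain G' where G': "min_rel ?W z q' G'"
      using q'.exists_min_rel[OF W z(1), of G "degree G"] GW Gq sub lead' by blast
    have G'W: "\<forall>t. coeff G' t \<in> polys_in ?W" and G'q: "poly G' (dvar z) \<in> q'" and lead'': "lead_coeff G' \<notin> q'"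
      using G' by (auto simp: min_rel_def)
    have le: "degree G' \<le> degree G"
      using G' GW Gq sub lead' unfolding min_rel_def by (metis not_le subsetD)
    \<comment> \<open>Below the degree of \<open>G'\<close>, membership in q' passes to the
      coefficients, and for these the induction hypothesis gives membership in q.\<close>
    have in_q: "poly r (dvar z) \<in> q" if "\<forall>t. coeff r t \<in> polys_in ?W" "poly r (dvar z) \<in> q'" "degree r < degree G'" for r
    proof (rule q.poly_in_q[OF _ z(1)])
        show "\<forall>t. coeff r t \<in> q" using G' that IH unfolding min_rel_def by blast
    qed
    \<comment> \<open>A shorter \<open>G'\<close> would be a proper factor of G. Primality of q puts
      the cofactor u or \<open>G'\<close> into q at z; both have smaller degree than G and a top
      coefficient outside q, against the minimality of G.\<close>
    have "\<not> degree G' < degree G"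
    proof
      assume less: "degree G' < degree G"
      let ?n = "degree G - degree G'"
      have n: "degree G \<le> ?n + degree G'" "?n + degree G' = degree G" using le by auto
      from q.pseudo_division_eval[OF W z(1) GW G'W n(1) q'.degree_min_rel_pos[OF G']]
      obtain u r where u: "\<forall>t. coeff u t \<in> polys_in ?W" "\<forall>t. coeff r t \<in> polys_in ?W"
        "poly u (dvar z) \<in> polys_in V" "poly r (dvar z) \<in> polys_in V"
        "lead_coeff G' ^ Suc ?n * poly G (dvar z) = poly u (dvar z) * poly G' (dvar z) + poly r (dvar z)"
        "degree r < degree G'" "degree u \<le> ?n" "coeff u ?n = lead_coeff G' ^ ?n * coeff G (?n + degree G')"
        by metis
      have l: "lead_coeff G' ^ k \<in> polys_in V" for k
        using q.polys_in_V[OF W] G'W by (auto intro!: q.closed)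
      have lG: "lead_coeff G' ^ Suc ?n * poly G (dvar z) \<in> q" by (rule q.mult_left[OF l Gq])
      have "poly r (dvar z) = lead_coeff G' ^ Suc ?n * poly G (dvar z) - poly u (dvar z) * poly G' (dvar z)"
        using u(5) by simp
      also have "\<dots> \<in> q'" by (rule q'.diff[OF subsetD[OF sub lG] q'.mult_left[OF u(3) G'q]])
      finally have "poly r (dvar z) \<in> q" using in_q u by blast
      hence "poly u (dvar z) * poly G' (dvar z) \<in> q" using lG u(5) q.add_cancel_right by metis
      hence "poly u (dvar z) \<in> q \<or> poly G' (dvar z) \<in> q" using u(3) q'.subset G'q by (intro q.prime) auto
      thus False
      proof
        assume "poly u (dvar z) \<in> q"
        moreover have "degree u < degree G" using u(7) q'.degree_min_rel_pos[OF G'] less by simp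
        ultimately have "lead_coeff G' ^ ?n * lead_coeff G \<in> q"
          using G u(1,8) n(2) unfolding min_rel_def by metis
        hence "lead_coeff G' ^ ?n \<in> q" using q.prime l lead GW q.polys_in_V[OF W] by blast
        thus False using q'.prime_power lead'' sub q.polys_in_V[OF W] G'W by blast
      next
        assume "poly G' (dvar z) \<in> q"
        thus False using less G G'W lead'' sub unfolding min_rel_def by blast
      qed
    qed
    hence deg: "degree G' = degree G" using le by simp
    show ?case
    proof
      fix x assume x: "x \<in> q' \<inter> polys_in (E \<union> insert z T)"
      hence "x \<in> polys_in (insert z ?W)" by simp
      from polys_in_insert[OF this] obtain p where p: "\<forall>t. coeff p t \<in> polys_in ?W" "poly p (dvar z) = x"
        by blast
      have "degree p \<le> degree p + degree G" by simp
      from q.pseudo_division_eval[OF W z(1) p(1) GW this q.degree_min_rel_pos[OF G]]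
      obtain u r where u: "\<forall>t. coeff r t \<in> polys_in ?W" "poly u (dvar z) \<in> polys_in V"
        "lead_coeff G ^ Suc (degree p) * poly p (dvar z) = poly u (dvar z) * poly G (dvar z) + poly r (dvar z)"
        "degree r < degree G"
        by metis
      let ?l = "lead_coeff G ^ Suc (degree p)"
      have lG: "lead_coeff G \<in> polys_in V" using q.polys_in_V[OF W] GW by blast
      hence l: "?l \<in> polys_in V" by (rule q.power_closed)
      have uG: "poly u (dvar z) * poly G (dvar z) \<in> q" by (rule q.mult_left[OF u(2) Gq])
      have "poly r (dvar z) = ?l * x - poly u (dvar z) * poly G (dvar z)" using u(3) p(2) by simp
      also have "\<dots> \<in> q'" using l x uG sub q'.diff[of "?l * x"] q'.mult_left[of ?l x] by blast
      finally have "poly r (dvar z) \<in> q" using in_q u deg by simp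
      hence "?l * x \<in> q" using u(3) p(2) uG q.add by simp
      hence "x \<in> q" using q.prime[OF l] q.prime_power[OF lG] lead x q'.subset by blast
      thus "x \<in> q" .
    qed
  qed
  from this[of "V - E"] V E have "q' \<inter> polys_in V \<subseteq> q" by (simp add: Un_absorb1)
  thus ?thesis using sub q'.subset by blast
qed

section \<open>Noetherian rings\<close>

text \<open>Finite generation is put through the universal property of the generated ideal, which
  avoids explicit linear combinations.\<close>

definition noetherian :: "'a::comm_ring_1 set \<Rightarrow> bool" where
  "noetherian B \<longleftrightarrow> (\<forall>J. set_ideal B J \<longrightarrow>
     (\<exists>G\<subseteq>J. finite G \<and> (\<forall>K. set_ideal B K \<longrightarrow> G \<subseteq> K \<longrightarrow> J \<subseteq> K)))"

lemma noetherianE: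
  assumes "noetherian B" "set_ideal B J"
  obtains G where "G \<subseteq> J" "finite G" "\<And>K. set_ideal B K \<Longrightarrow> G \<subseteq> K \<Longrightarrow> J \<subseteq> K"
proof -
  from assms(1)[unfolded noetherian_def, rule_format, OF assms(2)]
  obtain G where "G \<subseteq> J \<and> finite G \<and> (\<forall>K. set_ideal B K \<longrightarrow> G \<subseteq> K \<longrightarrow> J \<subseteq> K)" ..
  thus ?thesis by (intro that[of G]) auto
qed

lemma set_ideal_Un_chain:
  fixes J :: "nat \<Rightarrow> 'a::comm_ring_1 set"
  assumes "\<And>n. set_ideal B (J n)" "\<And>n. J n \<subseteq> J (Suc n)"
  shows "set_ideal B (\<Union>n. J n)"
proof -
  interpret J0: set_ideal B "J 0" by (rule assms(1))
  have mono: "J m \<subseteq> J n" if "m \<le> n" for m n using lift_Suc_mono_le[of J, OF assms(2) that] .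
  show ?thesis
  proof
    show "(\<Union>n. J n) \<subseteq> B" using set_ideal.in_R[OF assms(1)] by blast
    show "0 \<in> (\<Union>n. J n)" using J0.zero by blast
    show "x + y \<in> (\<Union>n. J n)" if xy: "x \<in> (\<Union>n. J n)" "y \<in> (\<Union>n. J n)" for x y
    proof -
      obtain m n where "x \<in> J m" "y \<in> J n" using xy by blast
      hence "x \<in> J (max m n)" "y \<in> J (max m n)" using mono[of m "max m n"] mono[of n "max m n"] by auto
      thus ?thesis using set_ideal.add[OF assms(1)] by blast
    qed
    show "x * y \<in> (\<Union>n. J n)" if "x \<in> B" "y \<in> (\<Union>n. J n)" for x y
      using that set_ideal.mult_left[OF assms(1)] by blast
  qed
qed

lemma noetherian_chain:
  fixes J :: "nat \<Rightarrow> 'a::comm_ring_1 set"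
  assumes "noetherian B" "\<And>n. set_ideal B (J n)" "\<And>n. J n \<subseteq> J (Suc n)"
  shows "\<exists>N. \<forall>n. J n \<subseteq> J N"
proof -
  have mono: "J m \<subseteq> J n" if "m \<le> n" for m n using lift_Suc_mono_le[of J, OF assms(3) that] .
  from noetherianE[OF assms(1) set_ideal_Un_chain[of B J, OF assms(2,3)]]
  obtain G where G: "G \<subseteq> (\<Union>n. J n)" "finite G"
    "\<And>K. set_ideal B K \<Longrightarrow> G \<subseteq> K \<Longrightarrow> (\<Union>n. J n) \<subseteq> K" by metis
  have "\<exists>N. G \<subseteq> J N" using G(2,1)
  proof (induction G rule: finite_induct)
    case (insert g G)
    then obtain N n where "G \<subseteq> J N" "g \<in> J n" by auto
    hence "insert g G \<subseteq> J (max N n)" using mono[of N "max N n"] mono[of n "max N n"] by auto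
    thus ?case by blast
  qed auto
  then obtain N where "G \<subseteq> J N" by blast
  from G(3)[OF assms(2) this] show ?thesis by blast
qed

subsection \<open>Hilbert's basis theorem\<close>

text \<open>The ideals of leading coefficients from the standard proof. The degree is only bounded
  by n, which admits 0 and makes the ideals increase with n.\<close>

definition top_coeffs ::
    "('n \<times> nat) set \<Rightarrow> 'n \<times> nat \<Rightarrow> ('n::linorder, 'k::field) dpoly set \<Rightarrow> nat \<Rightarrow> ('n, 'k) dpoly set" where
  "top_coeffs W z J n = {coeff p n | p. (\<forall>t. coeff p t \<in> polys_in W) \<and> degree p \<le> n \<and> poly p (dvar z) \<in> J}"

lemma set_ideal_top_coeffs:
  assumes "set_ideal (polys_in (insert z W)) J"
  shows "set_ideal (polys_in W) (top_coeffs W z J n)"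
proof -
  interpret W: set_ring "polys_in W :: ('a, 'b) dpoly set" by (rule set_ring_polys_in)
  interpret J: set_ideal "polys_in (insert z W)" J by fact
  show ?thesis
  proof
    show "top_coeffs W z J n \<subseteq> polys_in W" by (auto simp: top_coeffs_def)
    show "0 \<in> top_coeffs W z J n"
      unfolding top_coeffs_def using J.zero W.zero_closed by (intro CollectI exI[of _ 0]) simp
    show "x + y \<in> top_coeffs W z J n" if "x \<in> top_coeffs W z J n" "y \<in> top_coeffs W z J n" for x y
    proof -
      from that obtain p r where "\<forall>t. coeff p t \<in> polys_in W" "degree p \<le> n" "poly p (dvar z) \<in> J" "x = coeff p n"
        "\<forall>t. coeff r t \<in> polys_in W" "degree r \<le> n" "poly r (dvar z) \<in> J" "y = coeff r n"
        by (auto simp: top_coeffs_def)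
      thus ?thesis unfolding top_coeffs_def
        by (intro CollectI exI[of _ "p + r"]) (auto intro: W.add_closed J.add degree_add_le)
    qed
    show "x * y \<in> top_coeffs W z J n" if "x \<in> polys_in W" "y \<in> top_coeffs W z J n" for x y
    proof -
      from that obtain p where "\<forall>t. coeff p t \<in> polys_in W" "degree p \<le> n" "poly p (dvar z) \<in> J" "y = coeff p n"
        by (auto simp: top_coeffs_def)
      moreover have "x \<in> polys_in (insert z W)" using that(1) polys_in_mono[of W "insert z W"] by auto
      ultimately show ?thesis unfolding top_coeffs_def
        using that(1) order.trans[OF degree_smult_le[of x p]]
        by (intro CollectI exI[of _ "Polynomial.smult x p"])
           (auto intro: W.mult_closed J.mult_left simp del: degree_smult_eq)
    qed
  qed
qed

lemma top_coeffs_Suc: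
  assumes "set_ideal (polys_in (insert z W)) J"
  shows "top_coeffs W z J n \<subseteq> top_coeffs W z J (Suc n)"
proof
  interpret W: set_ring "polys_in W :: ('a, 'b) dpoly set" by (rule set_ring_polys_in)
  interpret J: set_ideal "polys_in (insert z W)" J by fact
  fix c assume "c \<in> top_coeffs W z J n"
  then obtain p where p: "\<forall>t. coeff p t \<in> polys_in W" "degree p \<le> n" "poly p (dvar z) \<in> J" "c = coeff p n"
    by (auto simp: top_coeffs_def)
  have "coeff (pCons 0 p) t \<in> polys_in W" for t
    using p(1) W.zero_closed by (cases t) auto
  thus "c \<in> top_coeffs W z J (Suc n)"
    unfolding top_coeffs_def using p J.mult_left[OF dvar_in_polys_in] 
    by (intro CollectI exI[of _ "pCons 0 p"]) (auto intro: order.trans[OF degree_pCons_le])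
qed

text \<open>The top-coefficient ideals become stationary at some N. Lifts of finitely many
  generators of each of them up to N generate J, by descending on the degree of an element of J and
  cancelling its top coefficient.\<close>

lemma noetherian_polys_in_insert:
  assumes "noetherian (polys_in W :: ('n::linorder, 'k::field) dpoly set)"
  shows "noetherian (polys_in (insert z W) :: ('n, 'k) dpoly set)"
  unfolding noetherian_def
proof (intro allI impI)
  fix J :: "('n, 'k) dpoly set" assume J: "set_ideal (polys_in (insert z W)) J"
  interpret W: set_ring "polys_in W :: ('n, 'k) dpoly set" by (rule set_ring_polys_in)
  interpret J: set_ideal "polys_in (insert z W)" J by fact
  let ?L = "top_coeffs W z J"
  note L = set_ideal_top_coeffs[OF J]
  obtain N where N: "\<And>n. ?L n \<subseteq> ?L N"
    using noetherian_chain[of "polys_in W" ?L, OF assms L top_coeffs_Suc[OF J]] by blast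
  have "\<exists>G. G \<subseteq> ?L n \<and> finite G \<and> (\<forall>K. set_ideal (polys_in W) K \<longrightarrow> G \<subseteq> K \<longrightarrow> ?L n \<subseteq> K)" for n
    using noetherianE[OF assms L] by metis
  then obtain G where G: "\<And>n. G n \<subseteq> ?L n" "\<And>n. finite (G n)"
    "\<And>n K. set_ideal (polys_in W) K \<Longrightarrow> G n \<subseteq> K \<Longrightarrow> ?L n \<subseteq> K" by metis
  have ex: "\<exists>p. (\<forall>t. coeff p t \<in> polys_in W) \<and> degree p \<le> n \<and> poly p (dvar z) \<in> J \<and> c = coeff p n"
    if "c \<in> G n" for n c
    using G(1)[of n] that by (auto simp: top_coeffs_def)
  define p where "p n c = (SOME p. (\<forall>t. coeff p t \<in> polys_in W) \<and> degree p \<le> n \<and>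
      poly p (dvar z) \<in> J \<and> c = coeff p n)" for n c
  have p: "(\<forall>t. coeff (p n c) t \<in> polys_in W) \<and> degree (p n c) \<le> n \<and>
      poly (p n c) (dvar z) \<in> J \<and> c = coeff (p n c) n" if "c \<in> G n" for n c
    unfolding p_def by (rule someI_ex) (rule ex[OF that])
  let ?S = "\<Union>n\<in>{..N}. (\<lambda>c. poly (p n c) (dvar z)) ` G n"
  show "\<exists>S\<subseteq>J. finite S \<and> (\<forall>K. set_ideal (polys_in (insert z W)) K \<longrightarrow> S \<subseteq> K \<longrightarrow> J \<subseteq> K)"
  proof (intro exI[of _ ?S] conjI allI impI)
    show "?S \<subseteq> J" using p by auto
    show "finite ?S" using G(2) by auto
    fix K assume K: "set_ideal (polys_in (insert z W)) K" and SK: "?S \<subseteq> K"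
    interpret K: set_ideal "polys_in (insert z W)" K by fact
    \<comment> \<open>The descent subtracts an element of K and must not leave J; the top
      coefficients are therefore realized in the intersection.\<close>
    have KJ: "set_ideal (polys_in (insert z W)) (K \<inter> J)"
      by unfold_locales (use K.subset in \<open>auto intro: K.zero J.zero K.add J.add K.mult_left J.mult_left\<close>)
    have LK: "?L m \<subseteq> top_coeffs W z (K \<inter> J) m" if "m \<le> N" for m
    proof (rule G(3)[OF set_ideal_top_coeffs[OF KJ]])
      show "G m \<subseteq> top_coeffs W z (K \<inter> J) m"
      proof
        fix c assume c: "c \<in> G m"
        hence "poly (p m c) (dvar z) \<in> K" using SK that by auto
        with p[OF c] show "c \<in> top_coeffs W z (K \<inter> J) m"
          unfolding top_coeffs_def by blast
      qed
    qed
    have "poly r (dvar z) \<in> J \<Longrightarrow> poly r (dvar z) \<in> K" if "\<forall>t. coeff r t \<in> polys_in W" "\<forall>t\<ge>n. coeff r t = 0" for r n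
      using that
    proof (induction n arbitrary: r)
      case 0
      hence "r = 0" by (intro poly_eqI) auto
      thus ?case using K.zero by simp
    next
      case (Suc n)
      \<comment> \<open>Above N no new top coefficients appear, so a polynomial of degree at most N
        is taken and multiplied by a power of z.\<close>
      let ?m = "min n N"
      have "degree r \<le> n" using Suc.prems(3) by (intro degree_le) auto
      hence "coeff r n \<in> ?L n" using Suc.prems unfolding top_coeffs_def by blast
      hence "coeff r n \<in> ?L ?m" using N[of n] by (auto simp: min_def)
      hence "coeff r n \<in> top_coeffs W z (K \<inter> J) ?m" using LK[of ?m] by auto
      then obtain u where u: "\<forall>t. coeff u t \<in> polys_in W" "degree u \<le> ?m" "poly u (dvar z) \<in> K"
        "poly u (dvar z) \<in> J" "coeff u ?m = coeff r n" unfolding top_coeffs_def by auto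
      let ?v = "monom 1 (n - ?m) * u"
      have v: "poly ?v (dvar z) = dvar z ^ (n - ?m) * poly u (dvar z)" by (simp add: poly_monom)
      have Z: "(dvar z :: ('n, 'k) dpoly) ^ (n - ?m) \<in> polys_in (insert z W)"
        by (rule J.power_closed[OF dvar_in_polys_in]) simp
      have vK: "poly ?v (dvar z) \<in> K" "poly ?v (dvar z) \<in> J"
        unfolding v using Z u by (auto intro: K.mult_left J.mult_left)
      have "poly (r - ?v) (dvar z) \<in> J" using J.diff[OF Suc.prems(1) vK(2)] by simp
      moreover have "\<forall>t. coeff (r - ?v) t \<in> polys_in W"
        using Suc.prems(2) u(1) by (auto simp: coeff_monom_mult intro!: W.closed)
      moreover have "\<forall>t\<ge>n. coeff (r - ?v) t = 0"
      proof (intro allI impI)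
        fix t assume t: "t \<ge> n"
        show "coeff (r - ?v) t = 0"
        proof (cases "t = n")
          case True
          thus ?thesis using u(5) by (simp add: coeff_monom_mult)
        next
          case False
          hence "coeff r t = 0" using Suc.prems(3) t by auto
          moreover have "coeff u (t - (n - ?m)) = 0"
            using False t u(2) by (intro coeff_eq_0) auto
          ultimately show ?thesis by (simp add: coeff_monom_mult)
        qed
      qed
      ultimately have "poly (r - ?v) (dvar z) \<in> K" by (rule Suc.IH)
      from K.add[OF this vK(1)] show ?case by simp
    qed
    note in_K = this
    show "J \<subseteq> K"
    proof
      fix a assume a: "a \<in> J"
      hence "a \<in> polys_in (insert z W)" using J.subset by blast
      from polys_in_insert[OF this] obtain r where r: "\<forall>t. coeff r t \<in> polys_in W" "poly r (dvar z) = a"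
        by blast
      show "a \<in> K" using in_K[OF r(1), of "Suc (degree r)"] a r(2) by (simp add: coeff_eq_0)
    qed
  qed
qed

lemma noetherian_polys_in:
  assumes "finite V"
  shows "noetherian (polys_in V :: ('n::linorder, 'k::field) dpoly set)"
  using assms
proof (induction V rule: finite_induct)
  case empty
  show ?case
    unfolding noetherian_def
  proof (intro allI impI)
    fix J :: "('n, 'k) dpoly set" assume J: "set_ideal (polys_in {}) J"
    interpret J: set_ideal "polys_in {}" J by fact
    show "\<exists>G\<subseteq>J. finite G \<and> (\<forall>K. set_ideal (polys_in {}) K \<longrightarrow> G \<subseteq> K \<longrightarrow> J \<subseteq> K)"
    proof (cases "J \<subseteq> {0}")
      case True
      thus ?thesis by (intro exI[of _ "{}"]) (auto dest: set_ideal.zero)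
    next
      case False
      then obtain a where a: "a \<in> J" "a \<noteq> 0" by blast
      obtain c where c: "a = Poly_Mapping.single 0 c" using polys_in_empty J.in_R[OF a(1)] by blast
      have ca: "Poly_Mapping.single 0 (inverse c) * a = 1"
        using a(2) c by (cases "c = 0") (simp_all add: mult_single)
      show ?thesis
      proof (intro exI[of _ "{a}"] conjI allI impI)
        fix K :: "('n, 'k) dpoly set" assume "set_ideal (polys_in {}) K" and aK: "{a} \<subseteq> K"
        then interpret K: set_ideal "polys_in {}" K by simp
        have "1 \<in> K" using K.mult_left[OF const_in_polys_in] aK ca by (metis insert_subset)
        hence "x \<in> K" if "x \<in> polys_in {}" for x using K.mult_left[OF that] by fastforce
        thus "J \<subseteq> K" using J.subset by blast
      qed (use a in auto)
    qed
  qed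
qed (rule noetherian_polys_in_insert)

section \<open>Krull's intersection theorem\<close>

inductive_set ideal_mult :: "'a::comm_ring_1 set \<Rightarrow> 'a set \<Rightarrow> 'a set" for A B where
  zero: "0 \<in> ideal_mult A B"
| add: "a \<in> A \<Longrightarrow> b \<in> B \<Longrightarrow> x \<in> ideal_mult A B \<Longrightarrow> a * b + x \<in> ideal_mult A B"

lemma mult_in_ideal_mult: "a \<in> A \<Longrightarrow> b \<in> B \<Longrightarrow> a * b \<in> ideal_mult A B"
  using ideal_mult.add[OF _ _ ideal_mult.zero] by fastforce

lemma ideal_mult_add: "x \<in> ideal_mult A B \<Longrightarrow> y \<in> ideal_mult A B \<Longrightarrow> x + y \<in> ideal_mult A B"
  by (induction x rule: ideal_mult.induct) (auto simp: add.assoc intro: ideal_mult.add)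

lemma ideal_mult_subset:
  assumes "set_ideal R J" "\<And>a b. a \<in> A \<Longrightarrow> b \<in> B \<Longrightarrow> a * b \<in> J"
  shows "ideal_mult A B \<subseteq> J"
proof
  interpret J: set_ideal R J by fact
  show "x \<in> J" if "x \<in> ideal_mult A B" for x
    using that by induction (auto intro: J.zero J.add assms(2))
qed

lemma set_ideal_ideal_mult:
  assumes "set_ideal R A" "set_ideal R B"
  shows "set_ideal R (ideal_mult A B)"
proof -
  interpret A: set_ideal R A by fact
  interpret B: set_ideal R B by fact
  show ?thesis
  proof
    show "ideal_mult A B \<subseteq> R"
    proof
      show "x \<in> R" if "x \<in> ideal_mult A B" for x
        using that by induction (auto intro: A.closed A.in_R B.in_R)
    qed
    show "r * x \<in> ideal_mult A B" if "r \<in> R" "x \<in> ideal_mult A B" for r x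
      using that(2)
    proof induction
      case (add a b x)
      have "(r * a) * b + r * x \<in> ideal_mult A B"
        using add A.mult_left[OF that(1)] by (intro ideal_mult.add) auto
      thus ?case by (simp add: algebra_simps)
    qed (simp add: ideal_mult.zero)
  qed (auto intro: ideal_mult.zero ideal_mult_add)
qed

definition ideal_add :: "'a::comm_ring_1 set \<Rightarrow> 'a set \<Rightarrow> 'a set" where
  "ideal_add A B = {a + b | a b. a \<in> A \<and> b \<in> B}"

lemma set_ideal_ideal_add:
  assumes "set_ideal R A" "set_ideal R B"
  shows "set_ideal R (ideal_add A B)" "A \<subseteq> ideal_add A B" "B \<subseteq> ideal_add A B"
proof -
  interpret A: set_ideal R A by fact
  interpret B: set_ideal R B by fact
  show "set_ideal R (ideal_add A B)"
  proof
    show "ideal_add A B \<subseteq> R" by (auto simp: ideal_add_def intro: A.closed A.in_R B.in_R)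
    show "0 \<in> ideal_add A B"
      unfolding ideal_add_def using A.zero B.zero by (intro CollectI exI[of _ 0]) auto
    show "x + y \<in> ideal_add A B" if xy: "x \<in> ideal_add A B" "y \<in> ideal_add A B" for x y
    proof -
      obtain a b a' b' where "x = a + b" "y = a' + b'" "a \<in> A" "a' \<in> A" "b \<in> B" "b' \<in> B"
        using xy unfolding ideal_add_def by blast
      thus ?thesis unfolding ideal_add_def using A.add B.add
        by (intro CollectI exI[of _ "a + a'"] exI[of _ "b + b'"]) (auto simp: algebra_simps)
    qed
    show "r * x \<in> ideal_add A B" if "r \<in> R" "x \<in> ideal_add A B" for r x
      using that A.mult_left B.mult_left unfolding ideal_add_def by (fastforce simp: distrib_left)
  qed
  show "A \<subseteq> ideal_add A B"
  proof
    show "a \<in> ideal_add A B" if "a \<in> A" for a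
      unfolding ideal_add_def using that B.zero by (intro CollectI exI[of _ a] exI[of _ 0]) auto
  qed
  show "B \<subseteq> ideal_add A B"
  proof
    show "b \<in> ideal_add A B" if "b \<in> B" for b
      unfolding ideal_add_def using that A.zero by (intro CollectI exI[of _ 0] exI[of _ b]) auto
  qed
qed

lemma (in set_ring) set_ideal_principal:
  assumes "a \<in> R"
  shows "set_ideal R ((\<lambda>r. r * a) ` R)" "a \<in> (\<lambda>r. r * a) ` R"
proof -
  show "set_ideal R ((\<lambda>r. r * a) ` R)"
  proof
    show "0 \<in> (\<lambda>r. r * a) ` R" by (rule image_eqI[of _ _ 0]) (auto intro: closed)
    show "x + y \<in> (\<lambda>r. r * a) ` R" if "x \<in> (\<lambda>r. r * a) ` R" "y \<in> (\<lambda>r. r * a) ` R" for x y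
    proof -
      from that obtain r s where "x = r * a" "y = s * a" "r \<in> R" "s \<in> R" by blast
      thus ?thesis by (intro image_eqI[of _ _ "r + s"]) (auto simp: algebra_simps intro: add_closed)
    qed
    show "x * y \<in> (\<lambda>r. r * a) ` R" if "x \<in> R" "y \<in> (\<lambda>r. r * a) ` R" for x y
    proof -
      from that obtain r where "y = r * a" "r \<in> R" by blast
      thus ?thesis using that by (intro image_eqI[of _ _ "x * r"]) (auto simp: mult_ac intro: mult_closed)
    qed
  qed (use assms in \<open>auto intro: closed\<close>)
  show "a \<in> (\<lambda>r. r * a) ` R" by (rule image_eqI[of _ _ 1]) (auto intro: closed)
qed

section \<open>Local rings inside a field\<close>

locale local_ring = set_prime R M for R :: "'a::field set" and M +
  assumes unit: "x \<in> R \<Longrightarrow> x \<notin> M \<Longrightarrow> inverse x \<in> R"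
begin

primrec mpow :: "nat \<Rightarrow> 'a set" where
  "mpow 0 = R"
| "mpow (Suc n) = ideal_mult M (mpow n)"

lemma set_ideal_R: "set_ideal R R"
  by unfold_locales (auto intro: closed)

lemma set_ideal_mpow: "set_ideal R (mpow n)"
  by (induction n) (simp_all add: set_ideal_R set_ideal_ideal_mult set_ideal_axioms)

lemma M_subset_mpow_1: "M \<subseteq> mpow (Suc 0)"
  using mult_in_ideal_mult[OF _ one_closed, of _ M] by auto

lemma cancel_unit:
  assumes "set_ideal R J" "u \<in> R" "u \<notin> M" "u * x \<in> J"
  shows "x \<in> J"
proof -
  have "inverse u * (u * x) \<in> J" by (rule set_ideal.mult_left[OF assms(1) unit[OF assms(2,3)] assms(4)])
  moreover have "u \<noteq> 0" using assms(3) zero by metis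
  hence "inverse u * (u * x) = x" by (simp add: field_simps)
  ultimately show ?thesis by simp
qed

text \<open>For a single element, Nakayama's lemma reduces to the fact that 1 - m is a unit.\<close>

lemma nakayama:
  assumes "set_ideal R J" "m \<in> M" "x - m * x \<in> J"
  shows "x \<in> J"
proof (rule cancel_unit[OF assms(1)])
  show "1 - m \<in> R" using assms(2) in_R by (auto intro: closed)
  show "1 - m \<notin> M" using add[OF assms(2), of "1 - m"] one_notin by auto
  show "(1 - m) * x \<in> J" using assms(3) by (simp add: algebra_simps)
qed

text \<open>An ideal \<open>H\<close> maximal among those containing \<open>I\<close> and \<open>M x\<close> but not \<open>x\<close> is \<open>M\<close>-primary,
  so it contains a power of \<open>M\<close>.\<close>

theorem krull_intersection:
  assumes noeth: "noetherian R" and I: "set_ideal R I" and x: "x \<in> R"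
    and mem: "\<And>n. x \<in> ideal_add I (mpow n)"
  shows "x \<in> I"
proof (rule ccontr)
  assume xI: "x \<notin> I"
  let ?H = "{H. set_ideal R H \<and> I \<subseteq> H \<and> (\<forall>m\<in>M. m * x \<in> H) \<and> x \<notin> H}"
  let ?Mx = "ideal_mult M ((\<lambda>r. r * x) ` R)"
  interpret I: set_ideal R I by fact
  have Mx: "set_ideal R ?Mx"
    by (intro set_ideal_ideal_mult set_ideal_axioms set_ideal_principal x)
  have Mx_eq: "\<exists>m\<in>M. y = m * x" if "y \<in> ?Mx" for y
    using that
  proof induction
    case zero
    show ?case by (rule bexI[of _ 0]) (simp_all add: set_ideal.zero[OF set_ideal_axioms])
  next
    case (add a b y)
    then obtain r m where "b = r * x" "r \<in> R" "m \<in> M" "y = m * x" by blast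
    thus ?case using add.hyps(1) by (intro bexI[of _ "a * r + m"]) (auto simp: algebra_simps intro: set_ideal.add[OF set_ideal_axioms] mult_right)
  qed
  \<comment> \<open>I + M x is a candidate for Zorn's lemma: x = y + m x with y in I would put x
    into I by Nakayama.\<close>
  have H0: "ideal_add I ?Mx \<in> ?H"
  proof (intro CollectI conjI ballI)
    note IM = set_ideal_ideal_add[OF I Mx]
    show "set_ideal R (ideal_add I ?Mx)" "I \<subseteq> ideal_add I ?Mx" by (rule IM)+
    show "m * x \<in> ideal_add I ?Mx" if "m \<in> M" for m
      using IM(3) mult_in_ideal_mult[OF that set_ideal_principal(2)[OF x]] by blast
    show "x \<notin> ideal_add I ?Mx"
    proof
      assume "x \<in> ideal_add I ?Mx"
      then obtain y w where y: "y \<in> I" and w: "w \<in> ?Mx" and xyw: "x = y + w"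
        unfolding ideal_add_def by blast
      obtain m where m: "m \<in> M" "w = m * x" using Mx_eq[OF w] by blast
      have "x - w \<in> I" using y xyw by (metis add_diff_cancel_right')
      hence "x \<in> I" unfolding m(2) by (rule nakayama[OF I m(1)])
      thus False using xI by contradiction
    qed
  qed
  have "\<exists>U\<in>?H. \<forall>X\<in>C. X \<subseteq> U" if C: "C \<in> chains ?H" for C
  proof (cases "C = {}")
    case False
    have CH: "C \<subseteq> ?H" and ord: "\<And>X Y. X \<in> C \<Longrightarrow> Y \<in> C \<Longrightarrow> X \<subseteq> Y \<or> Y \<subseteq> X"
      using C by (auto simp: chains_def chain_subset_def)
    have CI: "set_ideal R X" if "X \<in> C" for X using CH that by blast
    obtain X where X: "X \<in> C" using False by blast
    have "set_ideal R (\<Union>C)"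
    proof
      show "\<Union>C \<subseteq> R" using set_ideal.in_R[OF CI] by blast
      show "0 \<in> \<Union>C" using set_ideal.zero[OF CI[OF X]] X by blast
      show "a + b \<in> \<Union>C" if ab: "a \<in> \<Union>C" "b \<in> \<Union>C" for a b
      proof -
        obtain X Y where "a \<in> X" "b \<in> Y" "X \<in> C" "Y \<in> C" using ab by blast
        hence "\<exists>Z\<in>C. a \<in> Z \<and> b \<in> Z" using ord by blast
        thus ?thesis using set_ideal.add[OF CI] by blast
      qed
      show "a * b \<in> \<Union>C" if "a \<in> R" "b \<in> \<Union>C" for a b
        using that set_ideal.mult_left[OF CI] by blast
    qed
    hence "\<Union>C \<in> ?H" using CH X by auto
    thus ?thesis by blast
  next
    case True
    thus ?thesis using H0 by (intro bexI[of _ "ideal_add I ?Mx"]) auto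
  qed
  hence "\<exists>U\<in>?H. \<forall>X\<in>?H. U \<subseteq> X \<longrightarrow> X = U" by (intro Zorn_Lemma2 ballI)
  then obtain H where H: "H \<in> ?H" and H_max: "\<forall>X\<in>?H. H \<subseteq> X \<longrightarrow> X = H" by (rule bexE)
  have max: "X = H" if "X \<in> ?H" "H \<subseteq> X" for X
    by (rule bspec[OF H_max that(1), rule_format, OF that(2)])
  interpret H: set_ideal R H using H by blast
  have xH: "x \<notin> H" and MxH: "\<And>m. m \<in> M \<Longrightarrow> m * x \<in> H" and IH: "I \<subseteq> H" using H by auto
  \<comment> \<open>The colon ideals (H : \<open>a ^ j\<close>) become stationary. If
    \<open>a ^ j\<close> were not in H, maximality would give x = h + r \<open>a ^ j\<close>;
    multiplying by a puts r \<open>a ^ Suc j\<close> into H, so already r \<open>a ^ j\<close> and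
    with it x would be in H.\<close>
  have nilp: "\<exists>j. a ^ j \<in> H" if a: "a \<in> M" for a
  proof -
    have aR: "a \<in> R" using a in_R by blast
    let ?C = "\<lambda>j. {r \<in> R. r * a ^ j \<in> H}"
    have "set_ideal R (?C j)" for j
    proof
      show "r + s \<in> ?C j" if "r \<in> ?C j" "s \<in> ?C j" for r s
        using that H.add by (auto intro: closed simp: algebra_simps)
      show "r * s \<in> ?C j" if "r \<in> R" "s \<in> ?C j" for r s
        using that H.mult_left by (auto intro: closed simp: mult.assoc)
    qed (auto intro: closed H.zero)
    moreover have "?C j \<subseteq> ?C (Suc j)" for j
    proof
      fix r assume r: "r \<in> ?C j"
      hence "a * (r * a ^ j) \<in> H" using H.mult_left[OF aR] by blast
      thus "r \<in> ?C (Suc j)" using r by (simp add: mult.left_commute)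
    qed
    ultimately obtain j where j: "\<And>n. ?C n \<subseteq> ?C j" using noetherian_chain[OF noeth, of ?C] by metis
    have "a ^ j \<in> H"
    proof (rule ccontr)
      assume nH: "a ^ j \<notin> H"
      have P: "set_ideal R ((\<lambda>r. r * a ^ j) ` R)" "a ^ j \<in> (\<lambda>r. r * a ^ j) ` R"
        using set_ideal_principal[OF power_closed[OF aR]] by auto
      note S = set_ideal_ideal_add[OF H.set_ideal_axioms P(1)]
      have "x \<in> ideal_add H ((\<lambda>r. r * a ^ j) ` R)"
        using max[of "ideal_add H ((\<lambda>r. r * a ^ j) ` R)"] S P(2) nH IH MxH by blast
      then obtain h r where hr: "h \<in> H" "r \<in> R" "x = h + r * a ^ j" unfolding ideal_add_def by blast
      have "a * x - a * h \<in> H" using MxH[OF a] H.mult_left[OF aR hr(1)] by (rule H.diff)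
      hence "r * a ^ Suc j \<in> H" using hr(3) by (simp add: algebra_simps)
      hence "r * a ^ j \<in> H" using j[of "Suc j"] hr(2) by blast
      thus False using hr H.add xH by blast
    qed
    thus ?thesis by blast
  qed
  \<comment> \<open>The colon ideals (H : \<open>mpow n\<close>). Their stable value
    \<open>K0\<close> contains every r with M r inside \<open>K0\<close>, and 1 in \<open>K0\<close>
    says that H contains a power of M.\<close>
  let ?C = "\<lambda>n. {r \<in> R. \<forall>y\<in>mpow n. r * y \<in> H}"
  have C: "set_ideal R (?C n)" for n
  proof
    show "r + s \<in> ?C n" if "r \<in> ?C n" "s \<in> ?C n" for r s
      using that H.add by (auto intro: closed simp: algebra_simps)
    show "r * s \<in> ?C n" if "r \<in> R" "s \<in> ?C n" for r s
      using that H.mult_left by (auto intro: closed simp: mult.assoc)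
  qed (auto intro: closed H.zero)
  have CSuc: "r \<in> ?C (Suc n)" if r: "r \<in> R" "\<And>a. a \<in> M \<Longrightarrow> a * r \<in> ?C n" for r n
  proof -
    have "r * y \<in> H" if "y \<in> ideal_mult M (mpow n)" for y
      using that
    proof induction
      case (add a b y)
      have "(a * r) * b \<in> H" using r(2)[OF add.hyps(1)] add.hyps(2) by blast
      from H.add[OF this add.IH] show ?case by (simp add: algebra_simps)
    qed (simp add: H.zero)
    thus ?thesis using r(1) by auto
  qed
  have C_Suc: "?C n \<subseteq> ?C (Suc n)" for n
  proof
    fix r assume r: "r \<in> ?C n"
    show "r \<in> ?C (Suc n)"
      by (rule CSuc) (use r set_ideal.mult_left[OF C in_R] in blast)+
  qed
  have "\<exists>N. \<forall>k. ?C k \<subseteq> ?C N"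
    by (rule noetherian_chain[OF noeth]) (rule C, rule C_Suc)
  then obtain n where "\<forall>k. ?C k \<subseteq> ?C n" by (rule exE)
  hence n: "\<And>k. ?C k \<subseteq> ?C n" by (rule spec)
  have HC: "H \<subseteq> ?C n"
    using H.mult_right set_ideal.in_R[OF set_ideal_mpow] H.in_R by blast
  define K0 where "K0 = ?C n"
  have K0: "set_ideal R K0" and HK0: "H \<subseteq> K0" unfolding K0_def by (rule C, rule HC)
  have K0_step: "r \<in> K0" if "r \<in> R" "\<And>a. a \<in> M \<Longrightarrow> a * r \<in> K0" for r
    using subsetD[OF n CSuc[OF that(1)]] that(2) unfolding K0_def by blast
  \<comment> \<open>Otherwise some r outside \<open>K0\<close> satisfies M r inside
    \<open>K0\<close>, a contradiction. It arises from 1 by multiplying, for each of finitely many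
    generators of M in turn, with the largest power that keeps the product outside
    \<open>K0\<close>; such a power exists by \<open>nilp\<close>.\<close>
  have "1 \<in> K0"
  proof (rule ccontr)
    assume 1: "1 \<notin> K0"
    obtain G where G: "G \<subseteq> M" "finite G" "\<And>K. set_ideal R K \<Longrightarrow> G \<subseteq> K \<Longrightarrow> M \<subseteq> K"
      using noetherianE[OF noeth set_ideal_axioms] by metis
    have "\<exists>r\<in>R. r \<notin> K0 \<and> (\<forall>a\<in>G. a * r \<in> K0)"
      using G(2,1)
    proof (induction G rule: finite_induct)
      case empty
      show ?case using 1 one_closed by blast
    next
      case (insert a G)
      have aM: "a \<in> M" and GM: "G \<subseteq> M" using insert.prems by blast+
      from insert.IH[OF GM] obtain r where r: "r \<in> R" "r \<notin> K0" "\<forall>a\<in>G. a * r \<in> K0" by blast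
      have aR: "a \<in> R" by (rule in_R[OF aM])
      obtain j where "a ^ j \<in> H" using nilp[OF aM] by (rule exE)
      hence ex: "a ^ j * r \<in> K0" using set_ideal.mult_right[OF K0 _ r(1)] HK0 by blast
      define j where "j = (LEAST j. a ^ j * r \<in> K0)"
      have jC: "a ^ j * r \<in> K0" unfolding j_def using ex by (rule LeastI)
      have "j \<noteq> 0"
      proof
        assume "j = 0"
        with jC have "r \<in> K0" by simp
        thus False using r(2) by blast
      qed
      then obtain i where i: "j = Suc i" using not0_implies_Suc by blast
      have "a ^ i * r \<notin> K0" using not_less_Least[of i "\<lambda>j. a ^ j * r \<in> K0"] i unfolding j_def by simp
      moreover have "a * (a ^ i * r) \<in> K0" using jC i by (simp add: mult.assoc)
      moreover have "b * (a ^ i * r) \<in> K0" if "b \<in> G" for b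
      proof -
        have "a ^ i * (b * r) \<in> K0"
          by (rule set_ideal.mult_left[OF K0 power_closed[OF aR]]) (use r(3) that in blast)
        thus ?thesis by (simp only: mult_ac)
      qed
      moreover have "a ^ i * r \<in> R" using aR r(1) by (auto intro: closed)
      ultimately show ?case by blast
    qed
    then obtain r where r: "r \<in> R" "r \<notin> K0" "\<And>a. a \<in> G \<Longrightarrow> a * r \<in> K0" by blast
    let ?K = "{a \<in> R. a * r \<in> K0}"
    have "set_ideal R ?K"
    proof
      show "a + b \<in> ?K" if "a \<in> ?K" "b \<in> ?K" for a b
        using that set_ideal.add[OF K0, of "a * r" "b * r"] unfolding distrib_right[symmetric]
        by (simp add: add_closed)
      show "a * b \<in> ?K" if "a \<in> R" "b \<in> ?K" for a b
        using that set_ideal.mult_left[OF K0, of a "b * r"] unfolding mult.assoc[symmetric]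
        by (simp add: mult_closed)
    qed (use set_ideal.zero[OF K0] zero_closed in auto)
    hence "M \<subseteq> ?K"
    proof (rule G(3))
      show "G \<subseteq> ?K"
      proof
        fix a assume "a \<in> G"
        thus "a \<in> ?K" using r(3)[of a] G(1) in_R[of a] by blast
      qed
    qed
    note MK = this
    have "r \<in> K0" by (rule K0_step[OF r(1)]) (use MK in blast)
    thus False using r(2) by blast
  qed
  hence "mpow n \<subseteq> H" unfolding K0_def by fastforce
  obtain y z where "y \<in> I" "z \<in> mpow n" and xyz: "x = y + z"
    using mem[of n] unfolding ideal_add_def by blast
  hence "y \<in> H" "z \<in> H" using IH \<open>mpow n \<subseteq> H\<close> by blast+
  hence "x \<in> H" unfolding xyz by (rule H.add)
  thus False using xH by contradiction
qed

end

section \<open>Ideals stable under derivations\<close>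

definition derivation :: "('a::comm_ring_1 \<Rightarrow> 'a) \<Rightarrow> bool" where
  "derivation D \<longleftrightarrow> (\<forall>x y. D (x + y) = D x + D y) \<and> (\<forall>x y. D (x * y) = x * D y + y * D x)"

lemma derivation_add: "derivation D \<Longrightarrow> D (x + y) = D x + D y"
  and derivation_mult: "derivation D \<Longrightarrow> D (x * y) = x * D y + y * D x"
  by (auto simp: derivation_def)

lemma derivation_zero: "derivation D \<Longrightarrow> D 0 = 0"
  using derivation_add[of D 0 0] by simp

lemma derivation_sum_mult: "(\<And>v. v \<in> V \<Longrightarrow> derivation (D v)) \<Longrightarrow> derivation (\<lambda>x. \<Sum>v\<in>V. a v * D v x)"
  by (simp add: derivation_def distrib_left sum.distrib sum_distrib_left mult_ac)

context set_prime
begin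

text \<open>If a and b are the first orders at which the derivatives of x and y leave I, then by the
  Leibniz rule the derivative of order a + b of x y is, modulo I, a positive integer times a product
  of two elements outside I. The hypothesis \<open>nat\<close> removes the integer, and primality of
  I finishes.\<close>

lemma prime_iterated_derivatives:
  assumes D: "derivation D" "\<And>x. x \<in> R \<Longrightarrow> D x \<in> R"
    and nat: "\<And>n x. x \<in> R \<Longrightarrow> n > 0 \<Longrightarrow> of_nat n * x \<in> I \<Longrightarrow> x \<in> I"
  shows "set_prime R {x \<in> R. \<forall>n. (D ^^ n) x \<in> I}" (is "set_prime R ?Q")
proof -
  have pow_R: "(D ^^ n) x \<in> R" if "x \<in> R" for x n
    using that D(2) by (induction n) auto
  have pow_add: "(D ^^ n) (x + y) = (D ^^ n) x + (D ^^ n) y" for x y n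
    by (induction n) (simp_all add: derivation_add[OF D(1)])
  have swap: "(D ^^ k) (D z) = (D ^^ Suc k) z" for k z by (simp only: funpow_Suc_right comp_apply)
  have pow_mult: "(D ^^ n) (r * x) \<in> I" if "r \<in> R" "x \<in> ?Q" for r x n
    using that
  proof (induction n arbitrary: r x)
    case 0
    have "(D ^^ 0) x \<in> I" using 0(2) by blast
    thus ?case using 0 mult_left by simp
  next
    case (Suc n)
    have "(D ^^ k) (D x) \<in> I" for k using Suc.prems(2) unfolding swap by blast
    hence "D x \<in> ?Q" using Suc.prems D(2) by auto
    hence "(D ^^ n) (r * D x) \<in> I" "(D ^^ n) (D r * x) \<in> I" using Suc D(2) by auto
    hence "(D ^^ n) (r * D x + x * D r) \<in> I" unfolding pow_add by (simp add: add mult.commute)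
    thus ?case by (simp only: funpow_Suc_right comp_apply derivation_mult[OF D(1)])
  qed
  \<comment> \<open>With fewer than a + b derivatives, every Leibniz term has a factor that is
    differentiated fewer than a or fewer than b times.\<close>
  have low: "(D ^^ m) (x * y) \<in> I"
    if "m < a + b" "x \<in> R" "y \<in> R" "\<forall>i<a. (D ^^ i) x \<in> I" "\<forall>i<b. (D ^^ i) y \<in> I" for m a b x y
    using that
  proof (induction m arbitrary: a b x y)
    case 0
    show ?case
    proof (cases "a = 0")
      case True
      hence "y \<in> I" using 0(1) spec[OF 0(5), of 0] by simp
      thus ?thesis using 0 mult_left by simp
    next
      case False
      hence "x \<in> I" using spec[OF 0(4), of 0] by simp
      thus ?thesis using 0 mult_right by simp
    qed
  next
    case (Suc m)
    have "(D ^^ m) (x * D y) \<in> I"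
    proof (cases "b = 0")
      case True
      thus ?thesis using Suc.prems D(2) by (intro Suc.IH[of a 0]) auto
    next
      case False
      have "\<forall>i<b - 1. (D ^^ i) (D y) \<in> I" using Suc.prems(5) by (simp add: swap del: funpow.simps)
      thus ?thesis using Suc.prems D(2) False by (intro Suc.IH[of a "b - 1"]) auto
    qed
    moreover have "(D ^^ m) (y * D x) \<in> I"
    proof (cases "a = 0")
      case True
      thus ?thesis using Suc.prems D(2) by (intro Suc.IH[of b 0]) auto
    next
      case False
      have "\<forall>i<a - 1. (D ^^ i) (D x) \<in> I" using Suc.prems(4) by (simp add: swap del: funpow.simps)
      thus ?thesis using Suc.prems D(2) False by (intro Suc.IH[of b "a - 1"]) auto
    qed
    ultimately have "(D ^^ m) (x * D y + y * D x) \<in> I" unfolding pow_add by (rule add)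
    thus ?case by (simp only: funpow_Suc_right comp_apply derivation_mult[OF D(1)])
  qed
  \<comment> \<open>The constant is the binomial coefficient of a + b over a, of which only the
    positivity is recorded. The induction peels off one derivative; the summand in which it hits a
    factor of order 0 lies in I by \<open>low\<close> and contributes nothing to the
    constant.\<close>
  have lead: "\<exists>c>0. (D ^^ (a + b)) (x * y) - of_nat c * ((D ^^ a) x * (D ^^ b) y) \<in> I"
    if "x \<in> R" "y \<in> R" "\<forall>i<a. (D ^^ i) x \<in> I" "\<forall>i<b. (D ^^ i) y \<in> I" for a b x y
    using that
  proof (induction "a + b" arbitrary: a b x y)
    case 0
    thus ?case by (intro exI[of _ 1]) (simp add: zero)
  next
    case (Suc m)
    have "\<exists>c. (a > 0 \<longrightarrow> c > 0) \<and> (D ^^ m) (y * D x) - of_nat c * ((D ^^ a) x * (D ^^ b) y) \<in> I"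
    proof (cases "a = 0")
      case True
      have "(D ^^ m) (y * D x) \<in> I"
        using True Suc.prems Suc.hyps(2) D(2) by (intro low[of m b 0]) auto
      thus ?thesis using True by (intro exI[of _ 0]) simp
    next
      case False
      then obtain a' where a': "a = Suc a'" using not0_implies_Suc by blast
      have "\<exists>c>0. (D ^^ (a' + b)) (D x * y) - of_nat c * ((D ^^ a') (D x) * (D ^^ b) y) \<in> I"
        using Suc.hyps(2) Suc.prems D(2) a' by (intro Suc.hyps(1)) (auto simp: swap simp del: funpow.simps)
      thus ?thesis using Suc.hyps(2) a' by (auto simp: swap mult.commute simp del: funpow.simps)
    qed
    then obtain c1 where c1: "a > 0 \<longrightarrow> c1 > 0"
      "(D ^^ m) (y * D x) - of_nat c1 * ((D ^^ a) x * (D ^^ b) y) \<in> I" by blast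
    have "\<exists>c. (b > 0 \<longrightarrow> c > 0) \<and> (D ^^ m) (x * D y) - of_nat c * ((D ^^ a) x * (D ^^ b) y) \<in> I"
    proof (cases "b = 0")
      case True
      have "(D ^^ m) (x * D y) \<in> I"
        using True Suc.prems Suc.hyps(2) D(2) by (intro low[of m a 0]) auto
      thus ?thesis using True by (intro exI[of _ 0]) simp
    next
      case False
      then obtain b' where b': "b = Suc b'" using not0_implies_Suc by blast
      have "\<exists>c>0. (D ^^ (a + b')) (x * D y) - of_nat c * ((D ^^ a) x * (D ^^ b') (D y)) \<in> I"
        using Suc.hyps(2) Suc.prems D(2) b' by (intro Suc.hyps(1)) (auto simp: swap simp del: funpow.simps)
      thus ?thesis using Suc.hyps(2) b' by (auto simp: swap simp del: funpow.simps)
    qed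
    then obtain c2 where c2: "b > 0 \<longrightarrow> c2 > 0"
      "(D ^^ m) (x * D y) - of_nat c2 * ((D ^^ a) x * (D ^^ b) y) \<in> I" by blast
    have "(D ^^ (a + b)) (x * y) = (D ^^ m) (x * D y) + (D ^^ m) (y * D x)"
      unfolding Suc.hyps(2)[symmetric] by (simp only: funpow_Suc_right comp_apply derivation_mult[OF D(1)] pow_add)
    hence "(D ^^ (a + b)) (x * y) - of_nat (c2 + c1) * ((D ^^ a) x * (D ^^ b) y) =
      ((D ^^ m) (x * D y) - of_nat c2 * ((D ^^ a) x * (D ^^ b) y)) +
      ((D ^^ m) (y * D x) - of_nat c1 * ((D ^^ a) x * (D ^^ b) y))"
      by (simp add: algebra_simps)
    also have "\<dots> \<in> I" using c1(2) c2(2) by (intro add)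
    finally have "(D ^^ (a + b)) (x * y) - of_nat (c2 + c1) * ((D ^^ a) x * (D ^^ b) y) \<in> I" .
    moreover have "c2 + c1 > 0" using c1(1) c2(1) Suc.hyps(2) by (cases a) auto
    ultimately show ?case by blast
  qed
  have first: "\<exists>a. (D ^^ a) x \<notin> I \<and> (\<forall>i<a. (D ^^ i) x \<in> I)" if "x \<in> R" "x \<notin> ?Q" for x
    using that exists_least_iff[of "\<lambda>n. (D ^^ n) x \<notin> I"] by blast
  show ?thesis
  proof
    show "0 \<in> ?Q"
    proof -
      have "(D ^^ n) 0 = 0" for n by (induction n) (simp_all add: derivation_zero[OF D(1)])
      thus ?thesis using zero zero_closed by simp
    qed
    show "x + y \<in> ?Q" if "x \<in> ?Q" "y \<in> ?Q" for x y
      using that by (auto simp: pow_add intro: add add_closed)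
    show "r * x \<in> ?Q" if "r \<in> R" "x \<in> ?Q" for r x
      using that pow_mult[OF that] by (auto intro: mult_closed)
    show "1 \<notin> ?Q"
    proof
      assume "1 \<in> ?Q"
      hence "(D ^^ 0) 1 \<in> I" by blast
      thus False using one_notin by simp
    qed
    show "x \<in> ?Q \<or> y \<in> ?Q" if xy: "x \<in> R" "y \<in> R" "x * y \<in> ?Q" for x y
    proof (rule ccontr)
      assume "\<not> ?thesis"
      hence nx: "x \<notin> ?Q" and ny: "y \<notin> ?Q" by blast+
      obtain a where a: "(D ^^ a) x \<notin> I" "\<forall>i<a. (D ^^ i) x \<in> I"
        using first[OF xy(1) nx] by (elim exE conjE)
      obtain b where b: "(D ^^ b) y \<notin> I" "\<forall>i<b. (D ^^ i) y \<in> I"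
        using first[OF xy(2) ny] by (elim exE conjE)
      note ab = a b
      from lead[OF xy(1,2) ab(2,4)] obtain c where c: "c > 0"
        "(D ^^ (a + b)) (x * y) - of_nat c * ((D ^^ a) x * (D ^^ b) y) \<in> I" by blast
      have "(D ^^ (a + b)) (x * y) \<in> I" using xy(3) by blast
      from diff[OF this c(2)] have "of_nat c * ((D ^^ a) x * (D ^^ b) y) \<in> I" by simp
      hence "(D ^^ a) x * (D ^^ b) y \<in> I"
        by (rule nat[OF mult_closed[OF pow_R[OF xy(1)] pow_R[OF xy(2)]] c(1)])
      thus False using prime[OF pow_R[OF xy(1)] pow_R[OF xy(2)]] ab by blast
    qed
  qed auto
qed

end

text \<open>The derivation \<open>\<Sum>v. e v * D v\<close> below is the identity on \<open>M / (M\<^sup>2 + I)\<close> and plays the role of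
  the Euler operator: it is multiplication by \<open>n\<close> on \<open>M\<^sup>n\<close> modulo \<open>M\<^sup>n\<^sup>+\<^sup>1 + I\<close>.\<close>

locale euler_ring = local_ring R M for R :: "'a::field set" and M +
  fixes I :: "'a set" and V :: "'v set" and D :: "'v \<Rightarrow> 'a \<Rightarrow> 'a" and e :: "'v \<Rightarrow> 'a"
  assumes noetherian: "noetherian R"
    and of_nat_nonzero: "n > 0 \<Longrightarrow> of_nat n \<noteq> (0::'a)"
    and of_nat_unit: "n > 0 \<Longrightarrow> inverse (of_nat n) \<in> R"
    and ideal_I: "set_ideal R I" and I_M: "I \<subseteq> M"
    and finite_V: "finite V" and V_nonempty: "V \<noteq> {}"
    and D: "v \<in> V \<Longrightarrow> derivation (D v)"
    and D_R: "v \<in> V \<Longrightarrow> x \<in> R \<Longrightarrow> D v x \<in> R"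
    and D_I: "v \<in> V \<Longrightarrow> x \<in> I \<Longrightarrow> D v x \<in> I"
    and e_M: "v \<in> V \<Longrightarrow> e v \<in> M"
    and euler: "x \<in> M \<Longrightarrow> (\<Sum>v\<in>V. e v * D v x) - x \<in> ideal_add I (mpow 2)"
begin

lemma of_nat_cancel:
  assumes "set_ideal R J" "n > 0" "of_nat n * x \<in> J"
  shows "x \<in> J"
proof -
  have "inverse (of_nat n) * (of_nat n * x) \<in> J"
    by (rule set_ideal.mult_left[OF assms(1) of_nat_unit[OF assms(2)] assms(3)])
  moreover have "inverse (of_nat n) * (of_nat n * x) = x"
    using of_nat_nonzero[OF assms(2)] by (simp add: field_simps)
  ultimately show ?thesis by simp
qed

definition euler_op :: "'a \<Rightarrow> 'a" where
  "euler_op x = (\<Sum>v\<in>V. e v * D v x)"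

abbreviation "J n \<equiv> ideal_add I (mpow n)"

lemma ideal_J: "set_ideal R (J n)"
  and I_J: "I \<subseteq> J n" and mpow_J: "mpow n \<subseteq> J n"
  using set_ideal_ideal_add[OF ideal_I set_ideal_mpow] by blast+

lemma M_mult_J:
  assumes "m \<in> M" "x \<in> J n"
  shows "m * x \<in> J (Suc n)"
proof -
  from assms(2) obtain y z where "y \<in> I" "z \<in> mpow n" "x = y + z" unfolding ideal_add_def by blast
  moreover have "m * y \<in> I" using \<open>y \<in> I\<close> set_ideal.mult_left[OF ideal_I] in_R[OF assms(1)] by blast
  moreover have "m * z \<in> mpow (Suc n)" using assms(1) \<open>z \<in> mpow n\<close> by (simp add: mult_in_ideal_mult)
  ultimately show ?thesis unfolding ideal_add_def by (auto simp: distrib_left)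
qed

text \<open>Bounds the error \<open>b * (euler_op a - a)\<close> that the product rule creates in
  \<open>euler_op_mpow\<close>.\<close>

lemma mpow_mult_J2:
  assumes "b \<in> mpow n" "y \<in> J 2"
  shows "b * y \<in> J (Suc (Suc n))"
proof -
  from assms(2) obtain y1 y2 where y: "y1 \<in> I" "y2 \<in> mpow 2" "y = y1 + y2" unfolding ideal_add_def by blast
  have b: "b \<in> R" using assms(1) set_ideal.in_R[OF set_ideal_mpow] by blast
  have *: "b * z \<in> mpow (Suc n)" if "z \<in> ideal_mult M R" for z
  proof -
    have "ideal_mult M R \<subseteq> M" by (rule ideal_mult_subset[OF set_ideal_axioms mult_right])
    hence "z \<in> M" using that by blast
    hence "z * b \<in> mpow (Suc n)" using assms(1) by (simp add: mult_in_ideal_mult)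
    thus ?thesis by (simp add: mult.commute)
  qed
  have "b * z \<in> mpow (Suc (Suc n))" if "z \<in> ideal_mult M (ideal_mult M R)" for z
    using that
  proof induction
    case zero
    show ?case using set_ideal.zero[OF set_ideal_mpow] by (simp only: mult_zero_right)
  next
    case (add a c z)
    have "a * (b * c) \<in> mpow (Suc (Suc n))" using *[OF add.hyps(2)] add.hyps(1) by (simp add: mult_in_ideal_mult)
    from set_ideal.add[OF set_ideal_mpow this add.IH] show ?case by (simp add: algebra_simps)
  qed
  hence "b * y2 \<in> mpow (Suc (Suc n))" using y(2) by (simp add: numeral_2_eq_2)
  moreover have "b * y1 \<in> I" using set_ideal.mult_left[OF ideal_I b y(1)] .
  ultimately show ?thesis using y(3) unfolding ideal_add_def by (auto simp: distrib_left)
qed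

lemma derivation_euler_op: "derivation euler_op"
  unfolding euler_op_def using D by (rule derivation_sum_mult)

lemma euler_op_I: "x \<in> I \<Longrightarrow> euler_op x \<in> I"
  unfolding euler_op_def
  by (intro set_ideal.sum[OF ideal_I] set_ideal.mult_left[OF ideal_I] D_I in_R e_M)

lemma euler_op_mpow: "x \<in> mpow n \<Longrightarrow> euler_op x - of_nat n * x \<in> J (Suc n)"
proof (induction n arbitrary: x)
  case 0
  have "euler_op x \<in> M" unfolding euler_op_def using 0 by (intro sum mult_right e_M D_R) auto
  thus ?case using M_subset_mpow_1 mpow_J[of "Suc 0"] by auto
next
  case (Suc n)
  from Suc.prems have "x \<in> ideal_mult M (mpow n)" by simp
  thus ?case
  proof induction
    case zero
    show ?case
      using set_ideal.zero[OF ideal_J]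
      by (simp only: derivation_zero[OF derivation_euler_op] mult_zero_right diff_zero)
  next
    case (add a b x)
    have 1: "a * (euler_op b - of_nat n * b) \<in> J (Suc (Suc n))"
      by (rule M_mult_J[OF add.hyps(1) Suc.IH[OF add.hyps(2)]])
    have 2: "b * (euler_op a - a) \<in> J (Suc (Suc n))"
      by (rule mpow_mult_J2[OF add.hyps(2)]) (use euler[OF add.hyps(1)] in \<open>simp add: euler_op_def\<close>)
    have "euler_op (a * b + x) - of_nat (Suc n) * (a * b + x) =
        a * (euler_op b - of_nat n * b) + b * (euler_op a - a) + (euler_op x - of_nat (Suc n) * x)"
      by (simp add: derivation_add[OF derivation_euler_op] derivation_mult[OF derivation_euler_op] algebra_simps)
    thus ?case using set_ideal.add[OF ideal_J set_ideal.add[OF ideal_J 1 2] add.IH] by simp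
  qed
qed

text \<open>Q lies in I + \<open>mpow n\<close> for every n, so Krull's theorem applies. For the
  step let x = y + z with y in I and z in \<open>mpow n\<close>. By stability of Q the Euler
  operator moves x one power further, while it multiplies z by n up to higher order; dividing by n
  moves z one power further too.\<close>

theorem stable_subset_ideal:
  assumes Q: "Q \<subseteq> M" "\<And>v x. v \<in> V \<Longrightarrow> x \<in> Q \<Longrightarrow> D v x \<in> Q"
  shows "Q \<subseteq> I"
proof
  have "Q \<subseteq> J n" for n
  proof (induction n)
    case 0
    show ?case using Q(1) subset mpow_J[of 0] by auto
  next
    case (Suc n)
    show ?case
    proof
      fix x assume x: "x \<in> Q"
      show "x \<in> J (Suc n)"
      \<comment> \<open>The division by n is impossible for n = 0, where the claim is just that Q
        lies in M.\<close>
      proof (cases "n = 0")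
        case True
        thus ?thesis using x Q(1) M_subset_mpow_1 mpow_J[of "Suc 0"] by auto
      next
        case False
        have Ex: "euler_op x \<in> J (Suc n)"
          unfolding euler_op_def
          using x Suc Q(2) e_M by (intro set_ideal.sum[OF ideal_J] M_mult_J) auto
        from x Suc obtain y z where yz: "y \<in> I" "z \<in> mpow n" "x = y + z" unfolding ideal_add_def by blast
        have Ey: "euler_op y \<in> J (Suc n)" using euler_op_I[OF yz(1)] I_J by blast
        have "euler_op x - euler_op y - (euler_op z - of_nat n * z) \<in> J (Suc n)"
          by (intro set_ideal.diff[OF ideal_J] Ex Ey euler_op_mpow yz(2))
        hence "of_nat n * z \<in> J (Suc n)"
          using yz(3) by (simp add: derivation_add[OF derivation_euler_op])
        hence "z \<in> J (Suc n)" using of_nat_cancel[OF ideal_J] False by blast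
        thus ?thesis using yz I_J set_ideal.add[OF ideal_J] by blast
      qed
    qed
  qed
  moreover fix x assume "x \<in> Q"
  ultimately show "x \<in> I" using krull_intersection[OF noetherian ideal_I] Q(1) in_R by blast
qed

text \<open>Each derivation occurs infinitely often in the sequence \<open>s\<close> below, so the intersection of the
  descending primes \<open>Q j\<close> is stable under all of them.\<close>

theorem prime_ideal: "set_prime R I"
proof -
  obtain h where h: "bij_betw h {0..<card V} V" using ex_bij_betw_nat_finite[OF finite_V] by blast
  define s where "s j = h (j mod card V)" for j
  have cV: "card V > 0" using finite_V V_nonempty by (simp add: card_gt_0_iff)
  have sV: "s j \<in> V" for j
    unfolding s_def by (rule bij_betwE[OF h, rule_format]) (use cV in simp)
  have inf: "\<exists>j\<ge>N. s j = v" if "v \<in> V" for v N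
  proof -
    have "v \<in> h ` {0..<card V}" using h that by (simp add: bij_betw_imp_surj_on)
    then obtain i where i: "i < card V" "h i = v" by auto
    have "N * card V \<ge> N" using cV by simp
    hence "N * card V + i \<ge> N" by linarith
    moreover have "s (N * card V + i) = v" using i by (simp add: s_def)
    ultimately show ?thesis by blast
  qed
  define Q where "Q = rec_nat M (\<lambda>j P. {x \<in> R. \<forall>n. (D (s j) ^^ n) x \<in> P})"
  have Q0: "Q 0 = M" and QSuc: "Q (Suc j) = {x \<in> R. \<forall>n. (D (s j) ^^ n) x \<in> Q j}" for j
    by (simp_all add: Q_def)
  have prime_Q: "set_prime R (Q j)" for j
  proof (induction j)
    case 0
    show ?case unfolding Q0 by unfold_locales
  next
    case (Suc j)
    interpret Qj: set_prime R "Q j" by (rule Suc)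
    show ?case unfolding QSuc
      by (rule Qj.prime_iterated_derivatives[OF D[OF sV] D_R[OF sV]])
         (auto intro: of_nat_cancel[OF Qj.set_ideal_axioms])
  qed
  have Q_Suc: "Q (Suc j) \<subseteq> Q j" for j
  proof
    fix x assume "x \<in> Q (Suc j)"
    hence "(D (s j) ^^ 0) x \<in> Q j" unfolding QSuc by blast
    thus "x \<in> Q j" by simp
  qed
  have anti: "Q j \<subseteq> Q i" if "i \<le> j" for i j using lift_Suc_antimono_le[of Q, OF Q_Suc that] .
  have I_Q: "I \<subseteq> Q j" for j
  proof (induction j)
    case 0
    show ?case unfolding Q0 by (rule I_M)
  next
    case (Suc j)
    have "(D (s j) ^^ n) x \<in> I" if "x \<in> I" for x n
      using that by (induction n) (simp_all add: D_I[OF sV])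
    thus ?case unfolding QSuc using Suc set_ideal.in_R[OF ideal_I] by auto
  qed
  let ?Q = "\<Inter>j. Q j"
  have stable: "D v x \<in> ?Q" if "v \<in> V" "x \<in> ?Q" for v x
  proof
    fix j
    obtain i where i: "i \<ge> j" "s i = v" using inf[OF \<open>v \<in> V\<close>] by blast
    have "x \<in> Q (Suc i)" using that(2) by blast
    hence "(D (s i) ^^ Suc 0) x \<in> Q i" unfolding QSuc by blast
    thus "D v x \<in> Q j" using anti[OF i(1)] i(2) by auto
  qed
  have "?Q \<subseteq> I" by (rule stable_subset_ideal[OF _ stable]) (use Q0 in blast)+
  hence eq: "I = ?Q" using I_Q by blast
  show ?thesis
  proof (intro set_prime.intro set_prime_axioms.intro ideal_I)
    show "1 \<notin> I" using I_M one_notin by blast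
    show "x \<in> I \<or> y \<in> I" if xy: "x \<in> R" "y \<in> R" "x * y \<in> I" for x y
    proof (rule ccontr)
      assume "\<not> ?thesis"
      then obtain i j where "x \<notin> Q i" "y \<notin> Q j" using eq by blast
      hence "x \<notin> Q (max i j)" "y \<notin> Q (max i j)" using anti[of i "max i j"] anti[of j "max i j"] by auto
      moreover have "x * y \<in> Q (max i j)" using xy(3) I_Q by blast
      ultimately show False using set_prime.prime[OF prime_Q xy(1,2)] by blast
    qed
  qed
qed

end

section \<open>Localizations and their derivations\<close>

definition loc_ideal :: "'a::idom set \<Rightarrow> 'a set \<Rightarrow> 'a fract set" where
  "loc_ideal S Q = {to_fract a / to_fract s | a s. a \<in> Q \<and> s \<in> S \<and> s \<notin> Q}"

locale idom_prime = set_prime S Q for S :: "'a::idom set" and Q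
begin

abbreviation "L \<equiv> localization S Q"
abbreviation "N \<equiv> loc_ideal S Q"

lemma nonzero: "s \<notin> Q \<Longrightarrow> s \<noteq> 0"
  using zero by blast

lemma in_L: "a \<in> S \<Longrightarrow> s \<in> S \<Longrightarrow> s \<notin> Q \<Longrightarrow> to_fract a / to_fract s \<in> L"
  unfolding localization_def by blast

lemma in_N: "a \<in> Q \<Longrightarrow> s \<in> S \<Longrightarrow> s \<notin> Q \<Longrightarrow> to_fract a / to_fract s \<in> N"
  unfolding loc_ideal_def by blast

lemma L_cases:
  assumes "x \<in> L"
  obtains a s where "a \<in> S" "s \<in> S" "s \<notin> Q" "s \<noteq> 0" "x = to_fract a / to_fract s"
  using assms nonzero unfolding localization_def by blast

lemma N_cases:
  assumes "x \<in> N"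
  obtains a s where "a \<in> Q" "a \<in> S" "s \<in> S" "s \<notin> Q" "s \<noteq> 0" "x = to_fract a / to_fract s"
  using assms nonzero in_R unfolding loc_ideal_def by blast

lemma to_fract_in_L: "a \<in> S \<Longrightarrow> to_fract a \<in> L"
  using in_L[OF _ one_closed one_notin, of a] by simp

lemma to_fract_in_N: "a \<in> Q \<Longrightarrow> to_fract a \<in> N"
  using in_N[OF _ one_closed one_notin, of a] by simp

lemma denominator: "s \<in> S \<Longrightarrow> s \<notin> Q \<Longrightarrow> t \<in> S \<Longrightarrow> t \<notin> Q \<Longrightarrow> s * t \<in> S \<and> s * t \<notin> Q"
  using prime mult_closed by blast

lemma in_N_iff:
  assumes "a \<in> S" "s \<in> S" "s \<notin> Q"
  shows "to_fract a / to_fract s \<in> N \<longleftrightarrow> a \<in> Q"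
proof
  assume "to_fract a / to_fract s \<in> N"
  then obtain b t where b: "b \<in> Q" "t \<in> S" "t \<notin> Q" "t \<noteq> 0" "to_fract a / to_fract s = to_fract b / to_fract t"
    by (rule N_cases)
  have "to_fract (a * t) = to_fract (b * s)"
    using b(4,5) nonzero[OF assms(3)] by (simp add: frac_eq_eq)
  hence "a * t = b * s" by (simp only: to_fract_eq_iff)
  hence "a * t \<in> Q" using mult_right[OF b(1) assms(2)] by simp
  thus "a \<in> Q" using prime[OF assms(1) b(2)] b(3) by blast
qed (use assms in_N in blast)

lemma to_fract_in_N_iff: "a \<in> S \<Longrightarrow> to_fract a \<in> N \<longleftrightarrow> a \<in> Q"
  using in_N_iff[OF _ one_closed one_notin, of a] by simp

lemma set_ring_L: "set_ring L"
proof
  show "1 \<in> L" using to_fract_in_L[OF one_closed] by simp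
  fix x y assume "x \<in> L" "y \<in> L"
  obtain a s where a: "a \<in> S" "s \<in> S" "s \<notin> Q" "s \<noteq> 0" "x = to_fract a / to_fract s"
    using \<open>x \<in> L\<close> by (rule L_cases)
  obtain b t where b: "b \<in> S" "t \<in> S" "t \<notin> Q" "t \<noteq> 0" "y = to_fract b / to_fract t"
    using \<open>y \<in> L\<close> by (rule L_cases)
  have st: "s * t \<in> S" "s * t \<notin> Q" using denominator[OF a(2,3) b(2,3)] by blast+
  have "x - y = to_fract (a * t - b * s) / to_fract (s * t)"
    using a b by (simp add: diff_frac_eq)
  also have "\<dots> \<in> L" using a b by (intro in_L st closed)
  finally show "x - y \<in> L" .
  have "x * y = to_fract (a * b) / to_fract (s * t)"
    using a b by simp
  also have "\<dots> \<in> L" using a b by (intro in_L st closed)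
  finally show "x * y \<in> L" .
qed

lemma set_ideal_N: "set_ideal L N"
proof (intro set_ideal.intro set_ideal_axioms.intro set_ring_L)
  show "N \<subseteq> L" unfolding loc_ideal_def localization_def using subset by blast
  show "0 \<in> N" using to_fract_in_N[OF zero] by simp
  show "x + y \<in> N" if "x \<in> N" "y \<in> N" for x y
  proof -
    obtain a s where a: "a \<in> Q" "a \<in> S" "s \<in> S" "s \<notin> Q" "s \<noteq> 0" "x = to_fract a / to_fract s"
      using \<open>x \<in> N\<close> by (rule N_cases)
    obtain b t where b: "b \<in> Q" "b \<in> S" "t \<in> S" "t \<notin> Q" "t \<noteq> 0" "y = to_fract b / to_fract t"
      using \<open>y \<in> N\<close> by (rule N_cases)
    have "x + y = to_fract (a * t + b * s) / to_fract (s * t)"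
      using a b by (simp add: add_frac_eq)
    also have "\<dots> \<in> N"
      using denominator[OF a(3,4) b(3,4)] by (intro in_N add mult_right a b) blast+
    finally show ?thesis .
  qed
  show "x * y \<in> N" if "x \<in> L" "y \<in> N" for x y
  proof -
    obtain a s where a: "a \<in> S" "s \<in> S" "s \<notin> Q" "s \<noteq> 0" "x = to_fract a / to_fract s"
      using \<open>x \<in> L\<close> by (rule L_cases)
    obtain b t where b: "b \<in> Q" "b \<in> S" "t \<in> S" "t \<notin> Q" "t \<noteq> 0" "y = to_fract b / to_fract t"
      using \<open>y \<in> N\<close> by (rule N_cases)
    have "x * y = to_fract (a * b) / to_fract (s * t)" using a b by simp
    also have "\<dots> \<in> N"
      using denominator[OF a(2,3) b(3,4)] by (intro in_N mult_left a b) blast+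
    finally show ?thesis .
  qed
qed

lemma inverse_in_L:
  assumes "x \<in> L" "x \<notin> N"
  shows "inverse x \<in> L"
proof -
  obtain a s where a: "a \<in> S" "s \<in> S" "s \<notin> Q" "s \<noteq> 0" "x = to_fract a / to_fract s"
    using assms(1) by (rule L_cases)
  have "a \<notin> Q" using assms(2) in_N[OF _ a(2,3)] a(5) by blast
  moreover have "inverse x = to_fract s / to_fract a" using a(5) by simp
  ultimately show ?thesis using a in_L by simp
qed

lemma local_ring_L: "local_ring L N"
proof (intro local_ring.intro set_prime.intro set_ideal_N set_prime_axioms.intro local_ring_axioms.intro inverse_in_L)
  show "1 \<notin> N" using to_fract_in_N_iff[OF one_closed] one_notin by simp
  show "x \<in> N \<or> y \<in> N" if xy: "x \<in> L" "y \<in> L" "x * y \<in> N" for x y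
  proof -
    obtain a s where a: "a \<in> S" "s \<in> S" "s \<notin> Q" "s \<noteq> 0" "x = to_fract a / to_fract s"
      using \<open>x \<in> L\<close> by (rule L_cases)
    obtain b t where b: "b \<in> S" "t \<in> S" "t \<notin> Q" "t \<noteq> 0" "y = to_fract b / to_fract t"
      using \<open>y \<in> L\<close> by (rule L_cases)
    have "to_fract (a * b) / to_fract (s * t) \<in> N" using xy(3) a(5) b(5) by simp
    hence "a * b \<in> Q" using in_N_iff[OF mult_closed[OF a(1) b(1)]] denominator[OF a(2,3) b(2,3)] by blast
    hence "a \<in> Q \<or> b \<in> Q" by (rule prime[OF a(1) b(1)])
    thus ?thesis using in_N a b by blast
  qed
qed

text \<open>An ideal of the localization is generated by the numerators that it contains.\<close>

lemma noetherian_L: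
  assumes "noetherian S"
  shows "noetherian L"
  unfolding noetherian_def
proof (intro allI impI)
  fix J assume J: "set_ideal L J"
  have contr: "set_ideal S {a \<in> S. to_fract a \<in> K}" if "set_ideal L K" for K
  proof
    interpret K: set_ideal L K by fact
    show "x * y \<in> {a \<in> S. to_fract a \<in> K}" if "x \<in> S" "y \<in> {a \<in> S. to_fract a \<in> K}" for x y
      using that K.mult_left[OF to_fract_in_L] by (auto intro: mult_closed)
  qed (use that in \<open>auto intro: closed set_ideal.zero set_ideal.add\<close>)
  obtain G where G: "G \<subseteq> {a \<in> S. to_fract a \<in> J}" "finite G"
    and gen: "\<And>K. set_ideal S K \<Longrightarrow> G \<subseteq> K \<Longrightarrow> {a \<in> S. to_fract a \<in> J} \<subseteq> K"
    using assms contr[OF J] by (rule noetherianE) blast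
  show "\<exists>G\<subseteq>J. finite G \<and> (\<forall>K. set_ideal L K \<longrightarrow> G \<subseteq> K \<longrightarrow> J \<subseteq> K)"
  proof (intro exI[of _ "to_fract ` G"] conjI allI impI)
    fix K assume K: "set_ideal L K" "to_fract ` G \<subseteq> K"
    have sub: "{a \<in> S. to_fract a \<in> J} \<subseteq> {a \<in> S. to_fract a \<in> K}"
      by (rule gen[OF contr[OF K(1)]]) (use K(2) G(1) in blast)
    show "J \<subseteq> K"
    proof
      fix x assume x: "x \<in> J"
      hence "x \<in> L" by (rule set_ideal.in_R[OF J])
      then obtain a s where a: "a \<in> S" "s \<in> S" "s \<notin> Q" "s \<noteq> 0" "x = to_fract a / to_fract s"
        by (rule L_cases)
      have "to_fract s * x \<in> J" by (rule set_ideal.mult_left[OF J to_fract_in_L[OF a(2)] x])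
      hence "to_fract a \<in> J" using a(4,5) by simp
      hence "to_fract a \<in> K" using sub a(1) by blast
      hence "(to_fract 1 / to_fract s) * to_fract a \<in> K"
        by (rule set_ideal.mult_left[OF K(1) in_L[OF one_closed a(2,3)]])
      thus "x \<in> K" using a(5) by simp
    qed
  qed (use G in auto)
qed

end

lemma localization_mono:
  assumes "S \<subseteq> T" "Q \<inter> S = P \<inter> S"
  shows "localization S Q \<subseteq> localization T P"
  using assms unfolding localization_def by blast

section \<open>Derivations on the field of fractions\<close>

definition fract_der :: "('a::idom \<Rightarrow> 'a) \<Rightarrow> 'a fract \<Rightarrow> 'a fract" where
  "fract_der D x = (THE y. \<exists>a b. b \<noteq> 0 \<and> x = to_fract a / to_fract b \<and>
     y = (to_fract (D a) * to_fract b - to_fract a * to_fract (D b)) / to_fract b ^ 2)"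

lemma fract_der_eq:
  assumes "derivation D" "b \<noteq> 0"
  shows "fract_der D (to_fract a / to_fract b) =
    (to_fract (D a) * to_fract b - to_fract a * to_fract (D b)) / to_fract b ^ 2"
proof -
  have key: "(to_fract (D c) * to_fract d - to_fract c * to_fract (D d)) / to_fract d ^ 2 =
      (to_fract (D a) * to_fract b - to_fract a * to_fract (D b)) / to_fract b ^ 2"
    if d: "d \<noteq> 0" "to_fract a / to_fract b = to_fract c / to_fract d" for c d
  proof -
    have "to_fract (a * d) = to_fract (c * b)" using that assms(2) by (simp add: frac_eq_eq)
    hence e: "a * d = c * b" by (simp only: to_fract_eq_iff)
    hence "D (a * d) = D (c * b)" by simp
    hence e': "a * D d + d * D a = c * D b + b * D c" by (simp add: derivation_mult[OF assms(1)])
    \<comment> \<open>The quotient rule is independent of the representation: the equation a d = c b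
      and its derivative are substituted.\<close>
    have "(D c * d - c * D d) * b ^ 2 = d * b * (c * D b + b * D c) - c * b * (d * D b + b * D d)"
      by (simp add: power2_eq_square algebra_simps)
    also have "\<dots> = d * b * (a * D d + d * D a) - a * d * (d * D b + b * D d)" by (simp only: e e')
    also have "\<dots> = (D a * b - a * D b) * d ^ 2" by (simp add: power2_eq_square algebra_simps)
    finally have "to_fract ((D c * d - c * D d) * b ^ 2) = to_fract ((D a * b - a * D b) * d ^ 2)"
      by (rule arg_cong)
    thus ?thesis using d(1) assms(2) by (simp add: frac_eq_eq power2_eq_square)
  qed
  show ?thesis
    unfolding fract_der_def
  proof (rule the_equality)
    show "\<exists>c d. d \<noteq> 0 \<and> to_fract a / to_fract b = to_fract c / to_fract d \<and>
      (to_fract (D a) * to_fract b - to_fract a * to_fract (D b)) / to_fract b ^ 2 =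
      (to_fract (D c) * to_fract d - to_fract c * to_fract (D d)) / to_fract d ^ 2"
      by (intro exI[of _ a] exI[of _ b] conjI refl assms(2))
  qed (elim exE conjE, simp add: key)
qed

lemma fract_cases:
  obtains a b where "b \<noteq> 0" "(x :: 'a::idom fract) = to_fract a / to_fract b"
  by (cases x rule: Fract_cases) (auto simp: Fract_conv_to_fract)

lemma fract_der_to_fract:
  assumes "derivation D"
  shows "fract_der D (to_fract a) = to_fract (D a)"
proof -
  have "D 1 + 0 = D 1 + D 1" using derivation_mult[OF assms, of 1 1] by (simp only: mult_1_left add_0_right)
  hence "D 1 = 0" by (simp only: add_left_cancel)
  thus ?thesis using fract_der_eq[OF assms, of 1 a] by simp
qed

lemma derivation_fract_der:
  assumes "derivation D"
  shows "derivation (fract_der D)"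
  unfolding derivation_def
proof (intro conjI allI)
  fix x y :: "'a fract"
  obtain a b where x: "b \<noteq> 0" "x = to_fract a / to_fract b" by (rule fract_cases)
  obtain c d where y: "d \<noteq> 0" "y = to_fract c / to_fract d" by (rule fract_cases)
  have bd: "b * d \<noteq> 0" using x y by simp
  note fx = fract_der_eq[OF assms x(1), of a, folded x(2)]
  note fy = fract_der_eq[OF assms y(1), of c, folded y(2)]
  have "x + y = to_fract (a * d + c * b) / to_fract (b * d)" using x y by (simp add: add_frac_eq)
  hence "fract_der D (x + y) = (to_fract (D (a * d + c * b)) * to_fract (b * d)
      - to_fract (a * d + c * b) * to_fract (D (b * d))) / to_fract (b * d) ^ 2"
    by (simp only: fract_der_eq[OF assms bd])
  also have "\<dots> = fract_der D x + fract_der D y"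
    unfolding fx fy using x(1) y(1)
    by (simp add: derivation_add[OF assms] derivation_mult[OF assms] field_simps power2_eq_square)
  finally show "fract_der D (x + y) = fract_der D x + fract_der D y" .
  have "x * y = to_fract (a * c) / to_fract (b * d)" using x y by simp
  hence "fract_der D (x * y) = (to_fract (D (a * c)) * to_fract (b * d)
      - to_fract (a * c) * to_fract (D (b * d))) / to_fract (b * d) ^ 2"
    by (simp only: fract_der_eq[OF assms bd])
  also have "\<dots> = x * fract_der D y + y * fract_der D x"
    unfolding fx fy unfolding x(2) y(2) using x(1) y(1)
    by (simp add: derivation_mult[OF assms] field_simps power2_eq_square)
  finally show "fract_der D (x * y) = x * fract_der D y + y * fract_der D x" .
qed

lemma (in idom_prime) fract_der_L:
  assumes "derivation D" "\<And>a. a \<in> S \<Longrightarrow> D a \<in> S" "x \<in> L"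
  shows "fract_der D x \<in> L"
proof -
  obtain a s where a: "a \<in> S" "s \<in> S" "s \<notin> Q" "s \<noteq> 0" "x = to_fract a / to_fract s"
    using assms(3) by (rule L_cases)
  have "fract_der D x = to_fract (D a * s - a * D s) / to_fract (s * s)"
    using a by (simp add: fract_der_eq[OF assms(1)] power2_eq_square)
  also have "\<dots> \<in> L"
    using denominator[OF a(2,3) a(2,3)] a(1,2) assms(2) by (intro in_L closed) blast+
  finally show ?thesis .
qed

section \<open>Endomorphisms on the field of fractions\<close>

lemma fract_map_to_fract:
  assumes "comm_ring_hom h" "inj h"
  shows "fract_map h (to_fract a) = to_fract (h a)"
proof -
  interpret comm_ring_hom h by fact
  show ?thesis using fract_map_eq[OF assms, of 1 a] by simp
qed

lemma comm_ring_hom_inj_nonzero: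
  fixes h :: "'a::idom \<Rightarrow> 'a"
  assumes "comm_ring_hom h" "inj h" "x \<noteq> 0"
  shows "h x \<noteq> 0"
proof -
  interpret comm_ring_hom h by fact
  show ?thesis using assms(3) injD[OF assms(2), of x 0] by auto
qed

lemma fract_map_add:
  assumes "comm_ring_hom h" "inj h"
  shows "fract_map h (x + y) = fract_map h x + fract_map h y"
proof -
  interpret comm_ring_hom h by fact
  obtain a b where x: "b \<noteq> 0" "x = to_fract a / to_fract b" by (rule fract_cases)
  obtain c d where y: "d \<noteq> 0" "y = to_fract c / to_fract d" by (rule fract_cases)
  have bd: "b * d \<noteq> 0" using x y by simp
  have nz: "h b \<noteq> 0" "h d \<noteq> 0" using comm_ring_hom_inj_nonzero[OF assms] x(1) y(1) by blast+
  have "x + y = to_fract (a * d + c * b) / to_fract (b * d)" using x y by (simp add: add_frac_eq)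
  hence "fract_map h (x + y) = to_fract (h (a * d + c * b)) / to_fract (h (b * d))"
    by (simp only: fract_map_eq[OF assms bd])
  also have "\<dots> = to_fract (h a) / to_fract (h b) + to_fract (h c) / to_fract (h d)"
    using nz by (simp add: hom_add hom_mult add_frac_eq)
  finally show ?thesis
    using fract_map_eq[OF assms x(1), of a] fract_map_eq[OF assms y(1), of c] x(2) y(2) by simp
qed

lemma fract_map_mult:
  assumes "comm_ring_hom h" "inj h"
  shows "fract_map h (x * y) = fract_map h x * fract_map h y"
proof -
  interpret comm_ring_hom h by fact
  obtain a b where x: "b \<noteq> 0" "x = to_fract a / to_fract b" by (rule fract_cases)
  obtain c d where y: "d \<noteq> 0" "y = to_fract c / to_fract d" by (rule fract_cases)
  have bd: "b * d \<noteq> 0" using x y by simp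
  have "x * y = to_fract (a * c) / to_fract (b * d)" using x y by simp
  hence "fract_map h (x * y) = to_fract (h (a * c)) / to_fract (h (b * d))"
    by (simp only: fract_map_eq[OF assms bd])
  also have "\<dots> = (to_fract (h a) / to_fract (h b)) * (to_fract (h c) / to_fract (h d))"
    by (simp add: hom_mult)
  finally show ?thesis
    using fract_map_eq[OF assms x(1), of a] fract_map_eq[OF assms y(1), of c] x(2) y(2) by simp
qed

section \<open>The Jacobian criterion\<close>

lemma derivation_dpartial: "derivation (dpartial v)"
  by (simp add: derivation_def dpartial_add dpartial_mult)

lemma to_fract_of_nat: "to_fract (of_nat n) = of_nat n"
  by (induction n) simp_all

lemma (in prime_polys) const_in_prime:
  assumes "a \<in> q" "a \<in> polys_in {}"
  shows "a = 0"
proof (rule ccontr)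
  assume a0: "a \<noteq> 0"
  obtain c where c: "a = Poly_Mapping.single 0 c" using polys_in_empty[OF assms(2)] by blast
  have "Poly_Mapping.single 0 (inverse c) * a = 1"
    using a0 c by (cases "c = 0") (simp_all add: mult_single)
  moreover have "Poly_Mapping.single 0 (inverse c) * a \<in> q"
    by (rule mult_left[OF const_in_polys_in assms(1)])
  ultimately show False using one_notin by simp
qed

text \<open>The gradients of the generators are independent over the residue field of Q. Hence the
  generators are part of a regular system of parameters of the local ring \<open>L\<close>.\<close>

locale regular_gens = prime_polys V Q
  for V :: "('n::linorder \<times> nat) set" and Q :: "('n, 'k::field_char_0) dpoly set" +
  fixes G :: "'l set" and g :: "'l \<Rightarrow> ('n, 'k) dpoly"
  assumes finite_V: "finite V" and V_nonempty: "V \<noteq> {}" and finite_G: "finite G"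
    and g_Q: "l \<in> G \<Longrightarrow> g l \<in> Q"
    and indep: "indep_mod (polys_in V) Q G V (\<lambda>l v. dpartial v (g l))"
begin

sublocale idom_prime "polys_in V" Q by unfold_locales

sublocale loc: local_ring L N by (rule local_ring_L)

definition gen_ideal :: "('n, 'k) dpoly fract set" where
  "gen_ideal = genideal (ring_on L) (to_fract ` g ` G)"

abbreviation "par v \<equiv> fract_der (dpartial v)"

lemma par_to_fract: "par v (to_fract a) = to_fract (dpartial v a)"
  by (rule fract_der_to_fract[OF derivation_dpartial])

lemma derivation_par: "derivation (par v)"
  by (rule derivation_fract_der[OF derivation_dpartial])

lemma par_L: "x \<in> L \<Longrightarrow> par v x \<in> L"
  by (rule fract_der_L[OF derivation_dpartial dpartial_in_polys_in])

lemma g_in: "l \<in> G \<Longrightarrow> g l \<in> polys_in V"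
  using g_Q in_R by blast

lemma gens_L: "to_fract ` g ` G \<subseteq> L"
  using g_in to_fract_in_L by blast

lemma ideal_gen_ideal: "set_ideal L gen_ideal"
  unfolding gen_ideal_def by (rule loc.set_ideal_genideal[OF gens_L])

lemma gen_ideal_least: "set_ideal L J \<Longrightarrow> to_fract ` g ` G \<subseteq> J \<Longrightarrow> gen_ideal \<subseteq> J"
  unfolding gen_ideal_def loc.genideal_eq by blast

lemma gen_in_gen_ideal: "l \<in> G \<Longrightarrow> to_fract (g l) \<in> gen_ideal"
  unfolding gen_ideal_def loc.genideal_eq by blast

lemma gen_ideal_N: "gen_ideal \<subseteq> N"
  by (rule gen_ideal_least[OF set_ideal_N]) (use g_Q to_fract_in_N in blast)

lemma exists_dual:
  "\<exists>H. (\<forall>v\<in>V. \<forall>l\<in>G. H v l \<in> L) \<and>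
     (\<forall>l\<in>G. \<forall>t\<in>G. (\<Sum>v\<in>V. to_fract (dpartial v (g l)) * H v t) = (if l = t then 1 else 0))"
proof -
  have "\<exists>d H. d \<in> polys_in V \<and> d \<notin> Q \<and> (\<forall>v\<in>V. \<forall>l\<in>G. H v l \<in> polys_in V) \<and>
     (\<forall>l\<in>G. \<forall>t\<in>G. (\<Sum>v\<in>V. dpartial v (g l) * H v t) = (if l = t then d else 0))"
    by (rule indep_mod_right_inverse[OF finite_G finite_V _ indep])
       (use g_in dpartial_in_polys_in in blast)
  then obtain d H where "d \<in> polys_in V \<and> d \<notin> Q \<and> (\<forall>v\<in>V. \<forall>l\<in>G. H v l \<in> polys_in V) \<and>
     (\<forall>l\<in>G. \<forall>t\<in>G. (\<Sum>v\<in>V. dpartial v (g l) * H v t) = (if l = t then d else 0))"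
    by (elim exE)
  hence d: "d \<in> polys_in V" "d \<notin> Q" and H: "\<And>v l. v \<in> V \<Longrightarrow> l \<in> G \<Longrightarrow> H v l \<in> polys_in V"
    and inv: "\<And>l t. l \<in> G \<Longrightarrow> t \<in> G \<Longrightarrow> (\<Sum>v\<in>V. dpartial v (g l) * H v t) = (if l = t then d else 0)"
    by blast+
  show ?thesis
  proof (intro exI[of _ "\<lambda>v l. to_fract (H v l) / to_fract d"] conjI ballI)
    show "to_fract (H v l) / to_fract d \<in> L" if "v \<in> V" "l \<in> G" for v l
      by (rule in_L[OF H[OF that] d])
    fix l t assume lt: "l \<in> G" "t \<in> G"
    have "(\<Sum>v\<in>V. to_fract (dpartial v (g l)) * (to_fract (H v t) / to_fract d)) =
        to_fract (\<Sum>v\<in>V. dpartial v (g l) * H v t) / to_fract d"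
      by (simp add: sum_divide_distrib)
    also have "\<dots> = (if l = t then 1 else 0)" using inv[OF lt] nonzero[OF d(2)] by simp
    finally show "(\<Sum>v\<in>V. to_fract (dpartial v (g l)) * (to_fract (H v t) / to_fract d)) =
      (if l = t then 1 else 0)" .
  qed
qed

definition dual :: "'n \<times> nat \<Rightarrow> 'l \<Rightarrow> ('n, 'k) dpoly fract" where
  "dual = (SOME H. (\<forall>v\<in>V. \<forall>l\<in>G. H v l \<in> L) \<and>
     (\<forall>l\<in>G. \<forall>t\<in>G. (\<Sum>v\<in>V. to_fract (dpartial v (g l)) * H v t) = (if l = t then 1 else 0)))"

lemma dual_L: "v \<in> V \<Longrightarrow> l \<in> G \<Longrightarrow> dual v l \<in> L"
  and dual_inverse: "l \<in> G \<Longrightarrow> t \<in> G \<Longrightarrow>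
     (\<Sum>v\<in>V. to_fract (dpartial v (g l)) * dual v t) = (if l = t then 1 else 0)"
  using someI_ex[OF exists_dual] unfolding dual_def by blast+

definition normal_der :: "'l \<Rightarrow> ('n, 'k) dpoly fract \<Rightarrow> ('n, 'k) dpoly fract" where
  "normal_der l x = (\<Sum>v\<in>V. dual v l * par v x)"

text \<open>The partial derivative without its components along the normal derivations; this is what
  makes it vanish on all generators.\<close>

definition tangent_der :: "'n \<times> nat \<Rightarrow> ('n, 'k) dpoly fract \<Rightarrow> ('n, 'k) dpoly fract" where
  "tangent_der v x = par v x - (\<Sum>l\<in>G. to_fract (dpartial v (g l)) * normal_der l x)"

lemma normal_der_g: "l \<in> G \<Longrightarrow> t \<in> G \<Longrightarrow> normal_der t (to_fract (g l)) = (if l = t then 1 else 0)"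
  using dual_inverse[of l t] by (simp add: normal_der_def par_to_fract mult.commute)

lemma derivation_normal_der: "derivation (normal_der l)"
  unfolding normal_der_def by (rule derivation_sum_mult) (rule derivation_par)

lemma normal_der_L: "l \<in> G \<Longrightarrow> x \<in> L \<Longrightarrow> normal_der l x \<in> L"
  unfolding normal_der_def using dual_L par_L by (intro loc.sum_closed loc.mult_closed)

lemma derivation_tangent_der: "derivation (tangent_der v)"
proof -
  have S: "derivation (\<lambda>x. \<Sum>l\<in>G. to_fract (dpartial v (g l)) * normal_der l x)"
    by (rule derivation_sum_mult) (rule derivation_normal_der)
  show ?thesis
    unfolding derivation_def tangent_der_def derivation_add[OF derivation_par] derivation_mult[OF derivation_par]
      derivation_add[OF S] derivation_mult[OF S]
    by (simp add: algebra_simps)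
qed

lemma tangent_der_L: "x \<in> L \<Longrightarrow> tangent_der v x \<in> L"
  unfolding tangent_der_def using g_in dpartial_in_polys_in to_fract_in_L normal_der_L par_L
  by (intro loc.diff_closed loc.sum_closed loc.mult_closed) blast+

lemma tangent_der_g: "l \<in> G \<Longrightarrow> tangent_der v (to_fract (g l)) = 0"
proof -
  assume l: "l \<in> G"
  have "(\<Sum>t\<in>G. to_fract (dpartial v (g t)) * normal_der t (to_fract (g l))) =
      (\<Sum>t\<in>G. if t = l then to_fract (dpartial v (g t)) else 0)"
    using l by (intro sum.cong) (auto simp: normal_der_g)
  thus ?thesis using l finite_G by (simp add: tangent_der_def par_to_fract)
qed

lemma tangent_der_gen_ideal: "x \<in> gen_ideal \<Longrightarrow> tangent_der v x \<in> gen_ideal"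
proof -
  interpret I: set_ideal L gen_ideal by (rule ideal_gen_ideal)
  let ?J = "{x \<in> gen_ideal. tangent_der v x \<in> gen_ideal}"
  have "set_ideal L ?J"
  proof
    show "?J \<subseteq> L" using I.subset by blast
    show "0 \<in> ?J" using I.zero derivation_zero[OF derivation_tangent_der] by simp
    show "x + y \<in> ?J" if "x \<in> ?J" "y \<in> ?J" for x y
      using that by (simp add: I.add derivation_add[OF derivation_tangent_der])
    show "r * x \<in> ?J" if "r \<in> L" "x \<in> ?J" for r x
      using that
      by (simp add: I.mult_left derivation_mult[OF derivation_tangent_der] I.add I.mult_right tangent_der_L)
  qed
  moreover have "to_fract ` g ` G \<subseteq> ?J"
  proof (intro subsetI, elim imageE)
    fix x a l assume "x = to_fract a" "a = g l" "l \<in> G"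
    thus "x \<in> ?J" using gen_in_gen_ideal[of l] tangent_der_g[of l v] I.zero by simp
  qed
  ultimately have "gen_ideal \<subseteq> ?J" by (rule gen_ideal_least)
  thus "x \<in> gen_ideal \<Longrightarrow> tangent_der v x \<in> gen_ideal" by blast
qed

lemma div_eq: "x / to_fract s = (to_fract 1 / to_fract s) * x"
  by simp

text \<open>The extension theorem with eps = 1, started from no variables at all: there the
  condition concerns only constants, and 0 is the only constant in Q.\<close>

lemma exists_euler:
  "\<exists>e. (\<forall>v\<in>V. e v \<in> N) \<and> (\<forall>a\<in>Q. der_on V e a - to_fract a \<in> loc.mpow 2)"
proof -
  interpret N2: set_ideal L "loc.mpow 2" by (rule loc.set_ideal_mpow)
  interpret ext: der_extension V Q N "loc.mpow 2" 1
  proof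
    show "x / to_fract s \<in> N" if "s \<in> polys_in V" "s \<notin> Q" "x \<in> N" for s x
      unfolding div_eq[of x] by (rule loc.mult_left[OF in_L[OF one_closed that(1,2)] that(3)])
    show "x / to_fract s \<in> loc.mpow 2" if "s \<in> polys_in V" "s \<notin> Q" "x \<in> loc.mpow 2" for s x
      unfolding div_eq[of x] by (rule N2.mult_left[OF in_L[OF one_closed that(1,2)] that(3)])
    show "to_fract a * x \<in> loc.mpow 2" if "a \<in> Q" "x \<in> N" for a x
      using mult_in_ideal_mult[OF to_fract_in_N[OF that(1)], of x "loc.mpow (Suc 0)"] that(2)
        loc.M_subset_mpow_1 by (simp add: numeral_2_eq_2 subset_iff)
  qed (use loc.zero loc.add loc.mult_left N2.zero N2.add N2.mult_left to_fract_in_L to_fract_in_N finite_V in auto)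
  have "der_on {} (\<lambda>_. 0) a - 1 * to_fract a \<in> loc.mpow 2" if "a \<in> Q" "a \<in> polys_in {}" for a
    unfolding const_in_prime[OF that] using N2.zero by (simp add: der_on_def)
  from ext.extend_derivation[OF empty_subsetI _ this] show ?thesis by auto
qed

text \<open>The Euler condition has to be checked for the tangent derivations. They differ from the
  partial ones by the terms \<open>der_on V e (g l) * normal_der l x\<close>. Modulo the square of
  \<open>N\<close>, the first factor is \<open>g l\<close> itself, so these terms lie in the ideal
  plus that square.\<close>

theorem prime_gen_ideal: "set_prime L gen_ideal"
proof -
  interpret N2: set_ideal L "loc.mpow 2" by (rule loc.set_ideal_mpow)
  interpret I: set_ideal L gen_ideal by (rule ideal_gen_ideal)
  obtain e where e: "\<And>v. v \<in> V \<Longrightarrow> e v \<in> N"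
    and der_e: "\<And>a. a \<in> Q \<Longrightarrow> der_on V e a - to_fract a \<in> loc.mpow 2"
    using exists_euler by blast
  define E where "E x = (\<Sum>v\<in>V. e v * par v x)" for x
  have der_e_N: "der_on V e a \<in> N" if "a \<in> polys_in V" for a
    unfolding der_on_def
    using e to_fract_in_L dpartial_in_polys_in[OF that] by (intro loc.sum loc.mult_right) blast+
  have N_mult: "x * y \<in> loc.mpow 2" if "x \<in> N" "y \<in> N" for x y
    using mult_in_ideal_mult[OF that(1), of y "loc.mpow (Suc 0)"] that(2)
      loc.M_subset_mpow_1 by (simp add: numeral_2_eq_2 subset_iff)
  \<comment> \<open>The Euler property passes from Q to its localization: in the quotient rule, the
    term with the derivative of the denominator is a product of two elements of
    \<open>N\<close>.\<close>
  have E: "E x - x \<in> loc.mpow 2" if x: "x \<in> N" for x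
  proof -
    obtain a s where a: "a \<in> Q" "a \<in> polys_in V" "s \<in> polys_in V" "s \<notin> Q" "s \<noteq> 0" "x = to_fract a / to_fract s"
      using x by (rule N_cases)
    have par: "par v x = to_fract (dpartial v a) * (1 / to_fract s) - to_fract (dpartial v s) * (to_fract a / to_fract s ^ 2)" for v
      unfolding a(6) fract_der_eq[OF derivation_dpartial a(5)] using a(5)
      by (simp add: field_simps power2_eq_square)
    have "E x = der_on V e a * (1 / to_fract s) - der_on V e s * (to_fract a / to_fract s ^ 2)"
      unfolding E_def par der_on_def
      by (simp add: right_diff_distrib sum_subtractf sum_distrib_right sum_divide_distrib mult.assoc)
    hence "E x - to_fract a / to_fract s = (to_fract 1 / to_fract s) * (der_on V e a - to_fract a)
        - (to_fract 1 / to_fract s) * (der_on V e s * (to_fract a / to_fract s))"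
      by (simp add: diff_divide_distrib power2_eq_square)
    hence "E x - x = (to_fract 1 / to_fract s) * (der_on V e a - to_fract a)
        - (to_fract 1 / to_fract s) * (der_on V e s * x)"
      by (simp only: a(6))
    also have "\<dots> \<in> loc.mpow 2"
      by (intro N2.diff N2.mult_left in_L one_closed a(3,4) der_e a(1) N_mult der_e_N x)
    finally show ?thesis .
  qed
  have "euler_ring L N gen_ideal V tangent_der e"
  proof (intro euler_ring.intro local_ring_L euler_ring_axioms.intro)
    show "noetherian L" by (rule noetherian_L[OF noetherian_polys_in[OF finite_V]])
    show nz: "of_nat n \<noteq> (0 :: ('n, 'k) dpoly fract)" if "n > 0" for n
      using that by (simp flip: to_fract_of_nat)
    show "inverse (of_nat n) \<in> L" if "n > 0" for n
    proof -
      have "of_nat n * Poly_Mapping.single 0 (inverse (of_nat n)) = (1 :: ('n, 'k) dpoly)"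
        using that by (simp add: mult_single flip: single_of_nat single_one)
      hence "to_fract (of_nat n * Poly_Mapping.single 0 (inverse (of_nat n)) :: ('n, 'k) dpoly) = to_fract 1"
        by (rule arg_cong)
      hence "of_nat n * to_fract (Poly_Mapping.single 0 (inverse (of_nat n)) :: ('n, 'k) dpoly) = 1"
        by (simp add: to_fract_of_nat)
      from inverse_unique[OF this] show ?thesis using to_fract_in_L[OF const_in_polys_in] by simp
    qed
    show "(\<Sum>v\<in>V. e v * tangent_der v x) - x \<in> ideal_add gen_ideal (loc.mpow 2)" if x: "x \<in> N" for x
    proof -
      note IM = set_ideal_ideal_add[OF ideal_gen_ideal loc.set_ideal_mpow[of 2]]
      have "(\<Sum>v\<in>V. e v * (\<Sum>l\<in>G. to_fract (dpartial v (g l)) * normal_der l x)) =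
          (\<Sum>v\<in>V. \<Sum>l\<in>G. e v * to_fract (dpartial v (g l)) * normal_der l x)"
        by (simp add: sum_distrib_left mult.assoc)
      also have "\<dots> = (\<Sum>l\<in>G. der_on V e (g l) * normal_der l x)"
        by (subst sum.swap) (simp add: der_on_def sum_distrib_right)
      finally have eq: "(\<Sum>v\<in>V. e v * tangent_der v x) - x = (E x - x) - (\<Sum>l\<in>G. der_on V e (g l) * normal_der l x)"
        by (simp add: tangent_der_def E_def right_diff_distrib sum_subtractf)
      have "der_on V e (g l) * normal_der l x \<in> ideal_add gen_ideal (loc.mpow 2)" if l: "l \<in> G" for l
      proof -
        have "to_fract (g l) * normal_der l x \<in> gen_ideal"
          by (intro I.mult_right gen_in_gen_ideal normal_der_L l loc.in_R x)
        moreover have "(der_on V e (g l) - to_fract (g l)) * normal_der l x \<in> loc.mpow 2"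
          by (intro N2.mult_right der_e g_Q normal_der_L l loc.in_R x)
        moreover have "der_on V e (g l) * normal_der l x =
          to_fract (g l) * normal_der l x + (der_on V e (g l) - to_fract (g l)) * normal_der l x"
          by (simp add: algebra_simps)
        ultimately show ?thesis unfolding ideal_add_def by blast
      qed
      thus ?thesis
        unfolding eq by (intro set_ideal.diff[OF IM(1)] set_ideal.sum[OF IM(1)] subsetD[OF IM(3) E[OF x]])
    qed
  qed (use ideal_gen_ideal gen_ideal_N finite_V V_nonempty derivation_tangent_der tangent_der_L
      tangent_der_gen_ideal e in auto)
  thus ?thesis by (rule euler_ring.prime_ideal)
qed

end

section \<open>Counting parameters\<close>

lemma (in set_prime) dep_mod_member:
  assumes "finite S" "s \<in> S"
  shows "dep_mod R I S J M s"
proof -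
  have "(\<Sum>t\<in>S. (if t = s then 1 else 0) * M t j) = M s j" for j
    using assms by (simp add: if_distrib[of "\<lambda>x. x * _"] sum.delta cong: if_cong)
  thus ?thesis unfolding dep_mod_def
    by (intro exI[of _ "\<lambda>t. if t = s then 1 else 0"] exI[of _ 1])
       (use one_notin zero in \<open>auto intro: closed\<close>)
qed

context regular_gens
begin

interpretation I: set_prime L gen_ideal by (rule prime_gen_ideal)

definition contraction :: "('n, 'k) dpoly set" where
  "contraction = {a \<in> polys_in V. to_fract a \<in> gen_ideal}"

lemma contraction_Q: "contraction \<subseteq> Q"
  unfolding contraction_def using gen_ideal_N to_fract_in_N_iff by blast

lemma prime_contraction: "set_prime (polys_in V) contraction"
proof
  show "contraction \<subseteq> polys_in V" "0 \<in> contraction" "1 \<notin> contraction"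
    unfolding contraction_def using I.zero I.one_notin zero_closed by auto
  show "x + y \<in> contraction" if "x \<in> contraction" "y \<in> contraction" for x y
    using that I.add by (auto simp: contraction_def intro: add_closed)
  show "x * y \<in> contraction" if "x \<in> polys_in V" "y \<in> contraction" for x y
    using that I.mult_left[OF to_fract_in_L] by (auto simp: contraction_def intro: mult_closed)
  show "x \<in> contraction \<or> y \<in> contraction" if "x \<in> polys_in V" "y \<in> polys_in V" "x * y \<in> contraction" for x y
    using that I.prime[OF to_fract_in_L to_fract_in_L] by (auto simp: contraction_def)
qed

lemma to_fract_div_in_gen_ideal_iff:
  assumes "a \<in> polys_in V" "s \<in> polys_in V" "s \<notin> Q"
  shows "to_fract a / to_fract s \<in> gen_ideal \<longleftrightarrow> a \<in> contraction"
proof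
  have s0: "s \<noteq> 0" by (rule nonzero[OF assms(3)])
  assume "to_fract a / to_fract s \<in> gen_ideal"
  from I.mult_left[OF to_fract_in_L[OF assms(2)] this]
  show "a \<in> contraction" using s0 assms(1) by (simp add: contraction_def)
next
  assume "a \<in> contraction"
  hence "(to_fract 1 / to_fract s) * to_fract a \<in> gen_ideal"
    by (intro I.mult_left in_L one_closed assms) (simp add: contraction_def)
  thus "to_fract a / to_fract s \<in> gen_ideal" by simp
qed

text \<open>Localizing at the contraction instead of at Q gives the local ring whose residue field
  is that of \<open>gen_ideal\<close>; the derivations of that field have their values here. The
  next lemmas show that \<open>gen_ideal\<close> consists of the elements of \<open>L\<close> in the
  maximal ideal \<open>q.N\<close>.\<close>

interpretation q: idom_prime "polys_in V" contraction
  by (rule idom_prime.intro) (rule prime_contraction)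

interpretation qp: prime_polys V contraction
  by (rule prime_polys.intro) (rule prime_contraction)

lemma gen_ideal_loc_contraction: "gen_ideal \<subseteq> q.N"
proof
  fix x assume x: "x \<in> gen_ideal"
  obtain a s where a: "a \<in> polys_in V" "s \<in> polys_in V" "s \<notin> Q" "s \<noteq> 0" "x = to_fract a / to_fract s"
    using I.in_R[OF x] by (rule L_cases)
  have "a \<in> contraction" using x to_fract_div_in_gen_ideal_iff[OF a(1-3)] a(5) by simp
  thus "x \<in> q.N" using a contraction_Q by (auto intro!: q.in_N)
qed

lemma loc_contraction_gen_ideal:
  assumes "x \<in> L" "x \<in> q.N"
  shows "x \<in> gen_ideal"
proof -
  obtain a s where a: "a \<in> polys_in V" "s \<in> polys_in V" "s \<notin> Q" "s \<noteq> 0" "x = to_fract a / to_fract s"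
    using assms(1) by (rule L_cases)
  have "s \<notin> contraction" using a(3) contraction_Q by blast
  hence "a \<in> contraction" using assms(2) q.in_N_iff[OF a(1,2)] a(5) by simp
  thus ?thesis using to_fract_div_in_gen_ideal_iff[OF a(1-3)] a(5) by simp
qed

lemma L_loc_contraction: "L \<subseteq> q.L"
  unfolding localization_def using contraction_Q by blast

text \<open>The extension theorem with eps = 0. No nonzero polynomial in E lies in the contraction,
  so arbitrary values on E are consistent and extend to all variables.\<close>

lemma exists_dual_derivation:
  assumes "E \<subseteq> V" "polys_in E \<inter> contraction \<subseteq> {0}" "w \<in> E"
  shows "\<exists>d. (\<forall>v\<in>V. d v \<in> q.L) \<and> (\<forall>v\<in>E. d v = (if v = w then 1 else 0)) \<and>
    (\<forall>a\<in>contraction. der_on V d a \<in> q.N)"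
proof -
  interpret qL: local_ring q.L q.N by (rule q.local_ring_L)
  interpret ext: der_extension V contraction q.L q.N 0
  proof
    show "x / to_fract s \<in> q.L" if "s \<in> polys_in V" "s \<notin> contraction" "x \<in> q.L" for s x
      unfolding div_eq[of x] by (rule qL.mult_closed[OF q.in_L[OF one_closed that(1,2)] that(3)])
    show "x / to_fract s \<in> q.N" if "s \<in> polys_in V" "s \<notin> contraction" "x \<in> q.N" for s x
      unfolding div_eq[of x] by (rule qL.mult_left[OF q.in_L[OF one_closed that(1,2)] that(3)])
  qed (use qL.closed qL.zero qL.add qL.mult_left qL.mult_right q.to_fract_in_L q.to_fract_in_N finite_V in auto)
  let ?d = "\<lambda>v. if v = w then 1 else 0 :: ('n, 'k) dpoly fract"
  have d: "?d v \<in> q.L" for v using qL.one_closed qL.zero_closed by simp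
  have der: "der_on E ?d a - 0 * to_fract a \<in> q.N" if a: "a \<in> contraction" "a \<in> polys_in E" for a
  proof -
    have "a = 0" using a assms(2) by blast
    thus ?thesis using qL.zero by (simp add: der_on_def)
  qed
  from ext.extend_derivation[OF assms(1) d der] show ?thesis by auto
qed

text \<open>In M a row \<open>Inl l\<close> is the gradient of \<open>g l\<close> and a row
  \<open>Inr w\<close> the unit vector at w. Modulo the gradients, the unit vectors become the
  differentials of the variables in the residue field of \<open>gen_ideal\<close>, so those of E
  form a basis for those of U. On the other hand the unit vectors of U clear the columns of U, and
  what is left is the block of gradients outside U, with row basis T.\<close>

theorem card_transcendence_basis:
  assumes U: "U \<subseteq> V" and E: "E \<subseteq> U" "polys_in E \<inter> contraction \<subseteq> {0}"
    and algebraic: "\<And>w. w \<in> U - E \<Longrightarrow> \<exists>a\<in>polys_in (insert w E) \<inter> contraction. a \<noteq> 0"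
    and G1: "G1 \<subseteq> G" "\<And>l. l \<in> G - G1 \<Longrightarrow> g l \<in> polys_in U"
    and T: "row_basis_mod L gen_ideal G1 (V - U) (\<lambda>l v. to_fract (dpartial v (g l))) T"
  shows "card U + card T = card G + card E"
proof -
  define M where "M = case_sum (\<lambda>l v. to_fract (dpartial v (g l))) (\<lambda>w v. if v = w then 1 else 0)"
  have M: "M (Inl l) v = to_fract (dpartial v (g l))" "M (Inr w) v = (if v = w then 1 else 0)" for l w v
    by (simp_all add: M_def)
  have finU: "finite U" using U finite_V finite_subset by blast
  have finE: "finite E" using E finU finite_subset by blast
  have TG1: "T \<subseteq> G1" and T_indep: "indep_mod L gen_ideal T (V - U) (\<lambda>l v. to_fract (dpartial v (g l)))"
    and T_dep: "\<And>l. l \<in> G1 \<Longrightarrow> dep_mod L gen_ideal T (V - U) (\<lambda>l v. to_fract (dpartial v (g l))) l"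
    using T unfolding row_basis_mod_def by blast+
  have TG: "T \<subseteq> G" using TG1 G1 by blast
  have finT: "finite T" using TG finite_G finite_subset by blast
  have gL: "to_fract (dpartial v (g l)) \<in> L" if "l \<in> G" for l v
    by (rule to_fract_in_L[OF dpartial_in_polys_in[OF g_in[OF that]]])
  have M_L: "M r v \<in> L" if "r \<in> G <+> U" for r v
    using that gL[of _ v] loc.zero_closed loc.one_closed by (auto simp: M)
  have sum_M: "(\<Sum>r\<in>A <+> B. c r * M r v) =
      (\<Sum>l\<in>A. c (Inl l) * to_fract (dpartial v (g l))) + (if v \<in> B then c (Inr v) else 0)"
    if "finite A" "finite B" for A B c v
  proof -
    have "(\<Sum>w\<in>B. c (Inr w) * M (Inr w) v) = (\<Sum>w\<in>B. if v = w then c (Inr w) else 0)"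
      by (intro sum.cong) (auto simp: M)
    thus ?thesis using that by (simp add: sum.Plus M)
  qed
  have "row_basis_mod L gen_ideal (G <+> U) V M (T <+> U)"
    unfolding row_basis_mod_def
  proof (intro conjI ballI)
    show "T <+> U \<subseteq> G <+> U" using TG by auto
    \<comment> \<open>The columns outside U see only the rows of T, whose coefficients are thus in
      the ideal; then the column at w isolates the coefficient of the unit vector at w.\<close>
    show "indep_mod L gen_ideal (T <+> U) V M"
      unfolding indep_mod_def sum_M[OF finT finU]
    proof (intro allI impI ballI, elim conjE)
      fix c r assume c: "\<forall>s\<in>T <+> U. c s \<in> L" and r: "r \<in> T <+> U"
        and s: "\<forall>j\<in>V. (\<Sum>l\<in>T. c (Inl l) * to_fract (dpartial j (g l))) + (if j \<in> U then c (Inr j) else 0) \<in> gen_ideal"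
      have cT: "c (Inl l) \<in> gen_ideal" if "l \<in> T" for l
      proof (rule indep_modD[OF T_indep _ _ that])
        show "(\<Sum>l\<in>T. c (Inl l) * to_fract (dpartial j (g l))) \<in> gen_ideal" if "j \<in> V - U" for j
          using bspec[OF s, of j] that by simp
      qed (use c in auto)
      have "c (Inr w) \<in> gen_ideal" if "w \<in> U" for w
      proof -
        have "(\<Sum>l\<in>T. c (Inl l) * to_fract (dpartial w (g l))) \<in> gen_ideal"
          using cT gL[of _ w] TG by (intro I.sum I.mult_right) auto
        thus ?thesis using bspec[OF s, of w] that U I.add_cancel_left by auto
      qed
      thus "c r \<in> gen_ideal" using cT r by auto
    qed
    fix r assume r: "r \<in> G <+> U"
    show "dep_mod L gen_ideal (T <+> U) V M r"
    proof (cases "r \<in> T <+> U")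
      case True
      thus ?thesis using finT finU by (intro I.dep_mod_member) auto
    next
      case False
      with r obtain l where l: "r = Inl l" "l \<in> G" by auto
      have "\<exists>d c. d \<in> L \<and> d \<notin> gen_ideal \<and> (\<forall>s\<in>T. c s \<in> L) \<and>
        (\<forall>v\<in>V - U. d * to_fract (dpartial v (g l)) - (\<Sum>s\<in>T. c s * to_fract (dpartial v (g s))) \<in> gen_ideal)"
      proof (cases "l \<in> G1")
        case True
        from T_dep[OF True] show ?thesis unfolding dep_mod_def by blast
      next
        case False
        hence "dvars (g l) \<subseteq> U" using G1(2) l by (auto simp: polys_in_def)
        hence "dpartial v (g l) = 0" if "v \<in> V - U" for v
          using that by (intro dpartial_notin) auto
        thus ?thesis
          by (intro exI[of _ 1] exI[of _ "\<lambda>_. 0"])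
             (use loc.one_closed loc.zero_closed I.one_notin I.zero in auto)
      qed
      then obtain d c where d: "d \<in> L" "d \<notin> gen_ideal" and c: "\<And>s. s \<in> T \<Longrightarrow> c s \<in> L"
        and dc: "\<And>v. v \<in> V - U \<Longrightarrow> d * to_fract (dpartial v (g l)) - (\<Sum>s\<in>T. c s * to_fract (dpartial v (g s))) \<in> gen_ideal"
        by blast
      \<comment> \<open>Outside U this is the relation with the rows of T; inside U the unit vectors
        absorb the remaining error exactly.\<close>
      define c' where "c' = case_sum c (\<lambda>w. d * to_fract (dpartial w (g l)) - (\<Sum>s\<in>T. c s * to_fract (dpartial w (g s))))"
      have "d * M r v - (\<Sum>s\<in>T <+> U. c' s * M s v) \<in> gen_ideal" if "v \<in> V" for v
        unfolding sum_M[OF finT finU] using dc[of v] that I.zero by (auto simp: c'_def l M)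
      moreover have "c' s \<in> L" if "s \<in> T <+> U" for s
      proof (cases s)
        case (Inr w)
        have "d * to_fract (dpartial w (g l)) - (\<Sum>t\<in>T. c t * to_fract (dpartial w (g t))) \<in> L"
          using TG by (intro loc.diff_closed loc.mult_closed loc.sum_closed c d(1) gL l(2)) blast+
        thus ?thesis by (simp add: c'_def Inr)
      qed (use that c in \<open>auto simp: c'_def\<close>)
      ultimately show ?thesis unfolding dep_mod_def using d by blast
    qed
  qed
  moreover have "row_basis_mod L gen_ideal (G <+> U) V M (G <+> E)"
    unfolding row_basis_mod_def
  proof (intro conjI ballI)
    show "G <+> E \<subseteq> G <+> U" using E by auto
    show "indep_mod L gen_ideal (G <+> E) V M"
      unfolding indep_mod_def sum_M[OF finite_G finE]
    proof (intro allI impI ballI, elim conjE)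
      fix c r assume c: "\<forall>s\<in>G <+> E. c s \<in> L" and r: "r \<in> G <+> E"
        and s: "\<forall>j\<in>V. (\<Sum>l\<in>G. c (Inl l) * to_fract (dpartial j (g l))) + (if j \<in> E then c (Inr j) else 0) \<in> gen_ideal"
      interpret qL: local_ring q.L q.N by (rule q.local_ring_L)
      have EV: "E \<subseteq> V" using E(1) U by blast
      \<comment> \<open>The relation is paired with a derivation of the residue field that is 1 on w
        and 0 on the rest of E. It kills the generators, so only the coefficient of w
        remains.\<close>
      have cE: "c (Inr w) \<in> gen_ideal" if w: "w \<in> E" for w
      proof -
        obtain d where d: "\<And>v. v \<in> V \<Longrightarrow> d v \<in> q.L" "\<And>v. v \<in> E \<Longrightarrow> d v = (if v = w then 1 else 0)"
          and der: "\<And>a. a \<in> contraction \<Longrightarrow> der_on V d a \<in> q.N"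
          using exists_dual_derivation[OF EV E(2) w] by blast
        have "(\<Sum>v\<in>V. d v * ((\<Sum>l\<in>G. c (Inl l) * to_fract (dpartial v (g l))) + (if v \<in> E then c (Inr v) else 0)))
            = (\<Sum>v\<in>V. \<Sum>l\<in>G. c (Inl l) * (d v * to_fract (dpartial v (g l))))
              + (\<Sum>v\<in>V. if v \<in> E then d v * c (Inr v) else 0)"
          unfolding distrib_left sum.distrib
          by (intro arg_cong2[of _ _ _ _ "(+)"] sum.cong refl) (auto simp: sum_distrib_left mult_ac)
        also have "(\<Sum>v\<in>V. \<Sum>l\<in>G. c (Inl l) * (d v * to_fract (dpartial v (g l)))) =
            (\<Sum>l\<in>G. c (Inl l) * der_on V d (g l))"
          by (subst sum.swap) (simp add: der_on_def sum_distrib_left)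
        also have "(\<Sum>v\<in>V. if v \<in> E then d v * c (Inr v) else 0) = (\<Sum>v\<in>V. if v = w then c (Inr w) else 0)"
          using d(2) w by (intro sum.cong) auto
        also have "\<dots> = c (Inr w)" using finite_V EV w by auto
        finally have eq: "c (Inr w) =
            (\<Sum>v\<in>V. d v * ((\<Sum>l\<in>G. c (Inl l) * to_fract (dpartial v (g l))) + (if v \<in> E then c (Inr v) else 0)))
            - (\<Sum>l\<in>G. c (Inl l) * der_on V d (g l))" by simp
        have cL: "c (Inl l) \<in> q.L" if "l \<in> G" for l using c that L_loc_contraction by auto
        have gc: "g l \<in> contraction" if "l \<in> G" for l
          using g_in[OF that] gen_in_gen_ideal[OF that] by (simp add: contraction_def)
        have "c (Inr w) \<in> q.N"
          unfolding eq
        proof (intro qL.diff qL.sum)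
          show "d v * ((\<Sum>l\<in>G. c (Inl l) * to_fract (dpartial v (g l))) + (if v \<in> E then c (Inr v) else 0)) \<in> q.N"
            if "v \<in> V" for v
            by (rule qL.mult_left[OF d(1)[OF that] subsetD[OF gen_ideal_loc_contraction bspec[OF s that]]])
          show "c (Inl l) * der_on V d (g l) \<in> q.N" if "l \<in> G" for l
            by (rule qL.mult_left[OF cL[OF that] der[OF gc[OF that]]])
        qed
        moreover have "c (Inr w) \<in> L" using c w by auto
        ultimately show ?thesis by (intro loc_contraction_gen_ideal)
      qed
      have sG: "(\<Sum>l\<in>G. c (Inl l) * to_fract (dpartial v (g l))) \<in> gen_ideal" if v: "v \<in> V" for v
      proof (cases "v \<in> E")
        case True
        thus ?thesis using bspec[OF s v] I.add_cancel_right[OF cE[OF True]] by simp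
      qed (use bspec[OF s v] in simp)
      \<comment> \<open>Without the part from E, the dual vectors of the gradients isolate each
        coefficient.\<close>
      have "c (Inl t) \<in> gen_ideal" if t: "t \<in> G" for t
      proof -
        have "(\<Sum>v\<in>V. (\<Sum>l\<in>G. c (Inl l) * to_fract (dpartial v (g l))) * dual v t)
            = (\<Sum>l\<in>G. c (Inl l) * (\<Sum>v\<in>V. to_fract (dpartial v (g l)) * dual v t))"
          unfolding sum_distrib_right sum_distrib_left by (subst sum.swap) (simp add: mult.assoc)
        also have "\<dots> = (\<Sum>l\<in>G. if l = t then c (Inl t) else 0)"
          using t by (intro sum.cong) (auto simp: dual_inverse)
        also have "\<dots> = c (Inl t)" using finite_G t by simp
        finally have "c (Inl t) = (\<Sum>v\<in>V. (\<Sum>l\<in>G. c (Inl l) * to_fract (dpartial v (g l))) * dual v t)" ..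
        also have "\<dots> \<in> gen_ideal" by (rule I.sum) (rule I.mult_right[OF sG dual_L[OF _ t]])
        finally show ?thesis .
      qed
      thus "c r \<in> gen_ideal" using cE r by auto
    qed
    fix r assume r: "r \<in> G <+> U"
    show "dep_mod L gen_ideal (G <+> E) V M r"
    proof (cases "r \<in> G <+> E")
      case True
      thus ?thesis using finite_G finE by (intro I.dep_mod_member) auto
    next
      case False
      with r obtain w where w: "r = Inr w" "w \<in> U" "w \<notin> E" by auto
      have wV: "w \<in> V" and EV: "E \<subseteq> V" using w U E by auto
      \<comment> \<open>A minimal relation b of w over E lies in the ideal. Its gradient is a
        combination of the gradients of the generators modulo the ideal and involves only w and E,
        with a coefficient at w that is outside the ideal; solving for the unit vector at w gives
        the dependence.\<close>
      obtain a where a: "a \<in> polys_in (insert w E)" "a \<in> contraction" "a \<noteq> 0"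
        using algebraic[of w] w by blast
      obtain p where p: "\<forall>t. coeff p t \<in> polys_in E" "poly p (dvar w) = a"
        using polys_in_insert[OF a(1)] by blast
      have "p \<noteq> 0" using a(3) p(2) by auto
      hence "lead_coeff p \<noteq> 0" by simp
      hence "lead_coeff p \<notin> contraction" using p(1) E(2) by blast
      then obtain H where H: "min_rel E w contraction H"
        using qp.exists_min_rel[OF EV wV p(1)] p(2) a(2) by blast
      have HE: "\<forall>t. coeff H t \<in> polys_in E" and Hq: "poly H (dvar w) \<in> contraction"
        using H unfolding min_rel_def by blast+
      let ?b = "poly H (dvar w)"
      have b': "dpartial w ?b \<notin> contraction"
        using qp.min_rel_pderiv[OF H EV] dpartial_poly_dvar[OF HE w(3)] by simp
      have bV: "?b \<in> polys_in V" using Hq q.in_R by blast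
      have "?b \<in> polys_in (insert w E)"
      proof (rule poly_in[OF set_ring_polys_in])
        show "\<forall>t. coeff H t \<in> polys_in (insert w E)" using HE polys_in_mono[of E "insert w E"] by blast
      qed (simp add: dvar_in_polys_in)
      hence bE: "dpartial v ?b = 0" if "v \<noteq> w" "v \<notin> E" for v
        using that by (intro dpartial_notin) (auto simp: polys_in_def)
      let ?x = "to_fract ?b"
      have xI: "?x \<in> gen_ideal" using Hq by (simp add: contraction_def)
      \<comment> \<open>This is the stability of the ideal under the tangent derivation at v,
        written out.\<close>
      have grad: "to_fract (dpartial v ?b) - (\<Sum>l\<in>G. normal_der l ?x * to_fract (dpartial v (g l))) \<in> gen_ideal" for v
        using tangent_der_gen_ideal[OF xI, of v] by (simp add: tangent_der_def par_to_fract mult.commute)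
      define c where "c = case_sum (\<lambda>l. normal_der l ?x) (\<lambda>v. - to_fract (dpartial v ?b))"
      let ?d = "to_fract (dpartial w ?b)"
      have "?d * M r v - (\<Sum>s\<in>G <+> E. c s * M s v) \<in> gen_ideal" for v
      proof -
        have "?d * M r v - (\<Sum>s\<in>G <+> E. c s * M s v) =
            to_fract (dpartial v ?b) - (\<Sum>l\<in>G. normal_der l ?x * to_fract (dpartial v (g l)))"
          unfolding sum_M[OF finite_G finE] using w bE[of v] by (auto simp: c_def M)
        thus ?thesis using grad by simp
      qed
      moreover have "?d \<in> L" "?d \<notin> gen_ideal"
        using b' dpartial_in_polys_in[OF bV] to_fract_in_L by (auto simp: contraction_def)
      moreover have "c s \<in> L" if "s \<in> G <+> E" for s
        using that normal_der_L to_fract_in_L[OF bV] to_fract_in_L[OF dpartial_in_polys_in[OF bV]]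
        by (auto simp: c_def intro!: loc.uminus_closed)
      ultimately show ?thesis unfolding dep_mod_def by blast
    qed
  qed
  ultimately have "card (T <+> U) = card (G <+> E)"
    by (intro I.card_row_basis_unique[of "G <+> U" V M]) (use finite_G finU finite_V M_L in auto)
  thus ?thesis using finT finU finite_G finE by (simp add: card_Plus)
qed

end

section \<open>Prolongation by the difference operator\<close>

lemma comm_ring_hom_of_nat:
  assumes "comm_ring_hom s"
  shows "s (of_nat n) = of_nat n"
proof -
  interpret comm_ring_hom s by fact
  show ?thesis by (induction n) (simp_all add: hom_add)
qed

lemma lookup_shift_monom_0: "Poly_Mapping.lookup (shift_monom m) (j, 0) = 0"
  by (simp add: shift_monom_def lookup_sum lookup_single when_def)

lemma keys_shift_monom: "Poly_Mapping.keys (shift_monom m) \<subseteq> apsnd Suc ` Poly_Mapping.keys m"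
proof (intro subsetI)
  fix v assume v: "v \<in> Poly_Mapping.keys (shift_monom m)"
  obtain j l' where jl: "v = (j, l')" by (cases v)
  with v lookup_shift_monom_0[of m j] obtain l where l: "l' = Suc l" by (cases l') (auto simp: in_keys_iff)
  with v jl have "(j, l) \<in> Poly_Mapping.keys m" by (simp add: in_keys_iff)
  thus "v \<in> apsnd Suc ` Poly_Mapping.keys m" using jl l by (intro image_eqI[of _ _ "(j, l)"]) auto
qed

lemma shift_monom_diff_single:
  "shift_monom (m - Poly_Mapping.single (b, l) 1) = shift_monom m - Poly_Mapping.single (b, Suc l) 1"
proof (rule poly_mapping_eqI)
  fix v :: "'a \<times> nat"
  obtain j l' where v: "v = (j, l')" by (cases v)
  show "Poly_Mapping.lookup (shift_monom (m - Poly_Mapping.single (b, l) 1)) v =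
      Poly_Mapping.lookup (shift_monom m - Poly_Mapping.single (b, Suc l) 1) v"
    by (cases l') (simp_all add: v lookup_minus lookup_single lookup_shift_monom_0 when_def)
qed

lemma sigma_poly_zero: "sigma_poly s 0 = 0"
  by (simp add: sigma_poly_def)

text \<open>Applied to every entry, this shows that \<open>Sig\<close> carries the pseudo-Jacobian
  matrix for i to the one for i + 1.\<close>

lemma dpartial_sigma_poly:
  assumes "comm_ring_hom s"
  shows "dpartial (b, Suc l) (sigma_poly s g) = sigma_poly s (dpartial (b, l) g)"
proof -
  interpret comm_ring_hom s by fact
  show ?thesis
  proof (induction g rule: dpoly_induct)
    case (single m c)
    show ?case
      by (simp add: sigma_poly_single[OF assms] dpartial_single shift_monom_diff_single[unfolded One_nat_def] hom_mult comm_ring_hom_of_nat[OF assms])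
  qed (simp_all add: sigma_poly_add[OF assms] dpartial_add sigma_poly_zero)
qed

lemma sigma_poly_in_polys_in:
  assumes "g \<in> polys_in (UNIV \<times> {..N})"
  shows "sigma_poly s g \<in> polys_in (UNIV \<times> {..Suc N})"
proof -
  have "dvars (Poly_Mapping.single (shift_monom m) (s (Poly_Mapping.lookup g m))) \<subseteq> UNIV \<times> {..Suc N}"
    if m: "m \<in> Poly_Mapping.keys g" for m
  proof -
    have "Poly_Mapping.keys m \<subseteq> UNIV \<times> {..N}" using assms m by (auto simp: polys_in_def dvars_def)
    hence "apsnd Suc ` Poly_Mapping.keys m \<subseteq> UNIV \<times> {..Suc N}" by auto
    thus ?thesis
      using dvars_single[of "shift_monom m" "s (Poly_Mapping.lookup g m)"] keys_shift_monom[of m] by blast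
  qed
  thus ?thesis unfolding polys_in_def sigma_poly_def using dvars_sum by blast
qed

lemma comm_ring_hom_field_inj:
  fixes s :: "'k::field \<Rightarrow> 'k"
  assumes "comm_ring_hom s"
  shows "inj s"
proof (rule injI)
  interpret comm_ring_hom s by fact
  fix x y assume "s x = s y"
  hence 0: "s (x - y) = 0" using hom_minus by simp
  show "x = y"
  proof (rule ccontr)
    assume "x \<noteq> y"
    hence "s ((x - y) * inverse (x - y)) = 1" by simp
    thus False using 0 by (simp only: hom_mult) simp
  qed
qed

section \<open>The chain of ideals and the difference index\<close>

lemma ring_on_UNIV: "ring_on UNIV = (class_ring :: 'a::comm_ring_1 ring)"
  by simp

locale difference_system =
  fixes \<sigma> :: "'k::field_char_0 \<Rightarrow> 'k"
    and f :: "'r::finite \<Rightarrow> ('n::{finite,linorder}, 'k) dpoly"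
    and P :: "('n, 'k) dpoly set"
  assumes hom: "comm_ring_hom \<sigma>" and ord: "max_ord f \<ge> 1"
    and sigma_prime: "sigma_prime class_ring (sigma_poly \<sigma>) P"
    and f_P: "range f \<subseteq> P"
    and quasi_regular: "quasi_regular \<sigma> f P"
    and rank_hypothesis: "rank_hypothesis \<sigma> f P"
begin

abbreviation "e \<equiv> max_ord f"
abbreviation "Sig \<equiv> sigma_poly \<sigma> :: ('n, 'k) dpoly \<Rightarrow> ('n, 'k) dpoly"
abbreviation "vars_upto N \<equiv> UNIV \<times> {..N} :: ('n \<times> nat) set"

definition gen :: "nat \<times> 'r \<Rightarrow> ('n, 'k) dpoly" where
  "gen u = (Sig ^^ fst u) (f (snd u))"

lemma hom_Sig: "comm_ring_hom Sig"
  by (rule comm_ring_hom_sigma_poly[OF hom])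

lemma inj_Sig: "inj Sig"
  by (rule inj_sigma_poly[OF hom comm_ring_hom_field_inj[OF hom]])

sublocale UNIV: set_ring "UNIV :: ('n, 'k) dpoly set"
  by unfold_locales auto

lemma prime_P: "set_prime UNIV P"
proof -
  have "primeideal P (ring_on UNIV)"
    using sigma_prime unfolding sigma_prime_def ring_on_UNIV by blast
  thus ?thesis by (rule UNIV.primeideal_iff[THEN iffD1])
qed

sublocale P: set_prime UNIV P
  by (rule prime_P)

lemma Sig_P_iff: "Sig a \<in> P \<longleftrightarrow> a \<in> P"
  using sigma_prime unfolding sigma_prime_def sigma_ideal_def sigma_reflexive_def by auto

lemma gen_P: "gen u \<in> P"
proof -
  have "(Sig ^^ l) (f a) \<in> P" for l a
    using f_P by (induction l) (auto simp: Sig_P_iff)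
  thus ?thesis by (simp add: gen_def)
qed

lemma f_vars: "f a \<in> polys_in (vars_upto e)"
proof -
  have "l \<le> e" if "(j, l) \<in> dvars (f a)" for j l
  proof -
    have "finite (snd ` dvars (f a))" by simp
    hence "finite {l. (j, l) \<in> dvars (f a)}" by (rule rev_finite_subset) force
    hence "l \<le> Max {l. (j, l) \<in> dvars (f a)}" using that by (intro Max_ge) auto
    hence "l \<le> dord j (f a)" using that by (auto simp: dord_def)
    also have "\<dots> \<le> e" unfolding max_ord_def by (intro Max_ge) (auto intro!: rev_image_eqI[of "(a, j)"])
    finally show ?thesis .
  qed
  thus ?thesis by (auto simp: polys_in_def)
qed

lemma gen_vars: "gen u \<in> polys_in (vars_upto (fst u + e))"
proof -
  have "(Sig ^^ l) (f a) \<in> polys_in (vars_upto (l + e))" for l a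
    by (induction l) (use f_vars sigma_poly_in_polys_in in auto)
  thus ?thesis by (simp add: gen_def)
qed

abbreviation "eqs h \<equiv> {..<h::nat} \<times> (UNIV :: 'r set)"
abbreviation "prime_upto N \<equiv> polys_in (vars_upto N) \<inter> P"

lemma prime_prime_upto: "set_prime (polys_in (vars_upto N)) (prime_upto N)"
  by (rule set_prime_restrict[OF prime_P set_ring_polys_in]) simp

lemma B_ring_eq: "B_ring P N = localization (polys_in (vars_upto N)) (prime_upto N)"
  by (simp add: B_ring_def A_ring_eq_polys_in)

text \<open>Full row rank means that a row basis has as many elements as there are rows, hence
  consists of all of them.\<close>

lemma jacobian_indep:
  assumes N: "N = h + e - 1"
  shows "indep_mod (polys_in (vars_upto N)) (prime_upto N) (eqs h) (vars_upto N) (\<lambda>u v. dpartial v (gen u))"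
proof (cases h)
  case 0
  thus ?thesis by (simp add: indep_mod_def)
next
  case (Suc k)
  interpret p: set_prime "polys_in (vars_upto N)" "prime_upto N" by (rule prime_prime_upto)
  let ?R = "ring_on (polys_in (vars_upto N) :: ('n, 'k) dpoly set)"
  let ?M = "\<lambda>u v. residue_map ?R (prime_upto N) (prolonged_jacobian \<sigma> f u v)"
  let ?C = "{..N} \<times> (UNIV :: 'n set)"
  have Nk: "h - 1 + e = N" "h + e - 1 = N" using N Suc by auto
  have M_eq: "prolonged_jacobian \<sigma> f u v = dpartial (prod.swap v) (gen u)" for u v
    by (cases u; cases v) (simp add: prolonged_jacobian_def gen_def)
  have jet: "dpartial v (gen u) \<in> polys_in (vars_upto N)" if "u \<in> eqs h" for u v
  proof -
    have "vars_upto (fst u + e) \<subseteq> vars_upto N" using that N by auto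
    hence "gen u \<in> polys_in (vars_upto N)" using gen_vars[of u] polys_in_mono by blast
    thus ?thesis by (rule dpartial_in_polys_in)
  qed
  have rows_eq: "{..h - 1} = {..<h}" using Suc by auto
  have "mat_rank (residue_field ?R (prime_upto N)) (eqs h) ?C ?M = card (eqs h)"
  proof -
    have "h \<ge> 1" using Suc by simp
    with quasi_regular have "mat_rank (residue_field (ring_on (A_ring (h - 1 + e))) (P_trunc f P h))
        ({..h - 1} \<times> UNIV) ({..h - 1 + e} \<times> UNIV)
        (\<lambda>u v. residue_map (ring_on (A_ring (h - 1 + e))) (P_trunc f P h) (prolonged_jacobian \<sigma> f u v)) =
        h * card (UNIV :: 'r set)"
      unfolding quasi_regular_def Let_def by blast
    thus ?thesis
      unfolding P_trunc_def Nk rows_eq A_ring_eq_polys_in by (simp only: card_cartesian_product card_lessThan)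
  qed
  moreover obtain S where S: "row_basis_mod (polys_in (vars_upto N)) (prime_upto N) (eqs h) ?C (prolonged_jacobian \<sigma> f) S"
    using p.exists_row_basis_mod[of "eqs h" ?C "prolonged_jacobian \<sigma> f"] jet unfolding M_eq by auto
  moreover have "mat_rank (residue_field ?R (prime_upto N)) (eqs h) ?C ?M = card S"
    by (rule residue_hom.mat_rank_eq_card_row_basis[OF p.residue_hom _ _ _ S]) (use jet in \<open>auto simp: M_eq\<close>)
  ultimately have "card S = card (eqs h)" "S \<subseteq> eqs h" unfolding row_basis_mod_def by auto
  hence "S = eqs h" by (intro card_subset_eq) auto
  hence "indep_mod (polys_in (vars_upto N)) (prime_upto N) (eqs h) ?C (prolonged_jacobian \<sigma> f)"
    using S unfolding row_basis_mod_def by blast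
  \<comment> \<open>The Jacobian columns are indexed by (order, indeterminate), while a variable is
    the pair in the opposite order.\<close>
  thus ?thesis by (rule indep_mod_columns[of _ _ _ _ _ prod.swap]) (auto simp: M_eq)
qed

lemma regular_gens: "regular_gens (vars_upto (h + e - 1)) (prime_upto (h + e - 1)) (eqs h) gen"
proof -
  interpret p: set_prime "polys_in (vars_upto (h + e - 1))" "prime_upto (h + e - 1)"
    by (rule prime_prime_upto)
  have "gen u \<in> prime_upto (h + e - 1)" if "u \<in> eqs h" for u
  proof -
    have "vars_upto (fst u + e) \<subseteq> vars_upto (h + e - 1)" using that by auto
    thus ?thesis using gen_vars[of u] polys_in_mono gen_P[of u] by blast
  qed
  thus ?thesis
    by unfold_locales (use jacobian_indep[OF refl] in auto)
qed

sublocale reg: regular_gens "vars_upto (h + e - 1)" "prime_upto (h + e - 1)" "eqs h" gen for h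
  by (rule regular_gens)

lemma Delta_trunc_eq: "Delta_trunc \<sigma> f P h = reg.gen_ideal h"
proof -
  have "{to_fract ((Sig ^^ l) (f a)) |a l. l < h} = to_fract ` gen ` eqs h"
    by (force simp: gen_def)
  thus ?thesis unfolding Delta_trunc_def reg.gen_ideal_def B_ring_eq by simp
qed

abbreviation "contr h \<equiv> reg.contraction h"

subsection \<open>Ranks\<close>

lemma pseudo_jacobian_eq:
  "pseudo_jacobian \<sigma> f i u v = dpartial (snd v, i + fst v) (gen (i + fst u - e, snd u))"
  by (cases u; cases v) (simp add: pseudo_jacobian_def gen_def)

abbreviation "prows k \<equiv> {1..k::nat} \<times> (UNIV :: 'r set)"
abbreviation "pcols k \<equiv> {1..k::nat} \<times> (UNIV :: 'n set)"

text \<open>\<open>mu_at\<close> is described by a sum so that later equations between cardinalities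
  involve no truncated subtraction of ranks.\<close>

lemma mu_at_row_basis:
  assumes "row_basis_mod UNIV P (prows k) (pcols k) (pseudo_jacobian \<sigma> f i) S"
  shows "mu_at \<sigma> f P k i + card S = k * card (UNIV :: 'r set)"
    and "pseudo_rank class_ring P id \<sigma> f k i = card S"
proof -
  have "card S \<le> card (prows k)"
    using assms unfolding row_basis_mod_def by (intro card_mono) auto
  moreover have "mu_at \<sigma> f P k i = card (prows k) - card S"
    unfolding mu_at_def
    by (rule residue_hom.left_kernel_dim_eq_card_row_basis[OF P.residue_hom[unfolded ring_on_UNIV] _ _ _ assms]) auto
  ultimately show "mu_at \<sigma> f P k i + card S = k * card (UNIV :: 'r set)"
    by (simp add: card_cartesian_product)
  show "pseudo_rank class_ring P id \<sigma> f k i = card S"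
    unfolding pseudo_rank_def id_apply
    by (rule residue_hom.mat_rank_eq_card_row_basis[OF P.residue_hom[unfolded ring_on_UNIV] _ _ _ assms]) auto
qed

lemma pseudo_jacobian_Suc:
  assumes "i \<ge> e - 1" "u \<in> prows k"
  shows "pseudo_jacobian \<sigma> f (Suc i) u v = Sig (pseudo_jacobian \<sigma> f i u v)"
proof -
  \<comment> \<open>Row blocks start at 1, so \<open>i + fst u\<close> is at least e and the
    subtraction does not truncate.\<close>
  have "Suc i + fst u - e = Suc (i + fst u - e)" using assms ord by auto
  hence "gen (Suc i + fst u - e, snd u) = Sig (gen (i + fst u - e, snd u))"
    by (simp add: gen_def)
  thus ?thesis by (simp add: pseudo_jacobian_eq dpartial_sigma_poly[OF hom])
qed

lemma row_basis_mod_cong: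
  assumes "row_basis_mod R I A J M S" "\<And>u v. u \<in> A \<Longrightarrow> v \<in> J \<Longrightarrow> M' u v = M u v"
  shows "row_basis_mod R I A J M' S"
proof -
  have S: "S \<subseteq> A" using assms(1) unfolding row_basis_mod_def by blast
  have eq: "(\<Sum>s\<in>S. c s * M' s j) = (\<Sum>s\<in>S. c s * M s j)" if "j \<in> J" for c j
    using S assms(2) that by (intro sum.cong) auto
  show ?thesis
    using assms(1) unfolding row_basis_mod_def indep_mod_def dep_mod_def
    by (simp add: eq assms(2))
qed

text \<open>A single S serves all i: passing from i to i + 1 applies \<open>Sig\<close>, which maps
  the complement of P to itself. It follows that \<open>mu_at\<close> does not depend on i.\<close>

lemma pseudo_jacobian_row_basis:
  "\<exists>S. \<forall>i\<ge>e - 1. row_basis_mod UNIV P (prows k) (pcols k) (pseudo_jacobian \<sigma> f i) S"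
proof -
  obtain S where S: "row_basis_mod UNIV P (prows k) (pcols k) (pseudo_jacobian \<sigma> f (e - 1)) S"
    using P.exists_row_basis_mod[of "prows k" "pcols k" "pseudo_jacobian \<sigma> f (e - 1)"] by auto
  have "row_basis_mod UNIV P (prows k) (pcols k) (pseudo_jacobian \<sigma> f i) S" if "i \<ge> e - 1" for i
    using that
  proof (induction i rule: dec_induct)
    case base
    show ?case by (rule S)
  next
    case (step i)
    have "row_basis_mod UNIV P (prows k) (pcols k) (\<lambda>u v. Sig (pseudo_jacobian \<sigma> f i u v)) S"
      by (rule P.row_basis_mod_hom[OF hom_Sig _ _ _ _ _ step.IH]) (auto simp: Sig_P_iff)
    thus ?case by (rule row_basis_mod_cong) (rule pseudo_jacobian_Suc[OF step.hyps(1)])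
  qed
  thus ?thesis by blast
qed

lemma mu_at_eq_mu:
  assumes "i \<ge> e - 1"
  shows "mu_at \<sigma> f P k i = mu \<sigma> f P k"
proof -
  obtain S where S: "\<And>i. i \<ge> e - 1 \<Longrightarrow> row_basis_mod UNIV P (prows k) (pcols k) (pseudo_jacobian \<sigma> f i) S"
    using pseudo_jacobian_row_basis[of k] by blast
  from mu_at_row_basis(1)[OF S[OF assms]] mu_at_row_basis(1)[OF S[OF order.refl]]
  show ?thesis by (simp add: mu_def)
qed

text \<open>Here the rank hypothesis enters: it transfers the rank from the residue field of P,
  where \<open>mu\<close> is defined, to the residue field of the ideal with index h.\<close>

lemma pseudo_rank_Delta:
  assumes i: "i \<ge> e - 1" and h: "h = i + 1 - e + k"
  shows "pseudo_rank (ring_on (B_ring P (h + e - 1))) (Delta_trunc \<sigma> f P h) to_fract \<sigma> f k i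
    + mu \<sigma> f P k = k * card (UNIV :: 'r set)"
proof -
  obtain S where S: "\<And>i. i \<ge> e - 1 \<Longrightarrow> row_basis_mod UNIV P (prows k) (pcols k) (pseudo_jacobian \<sigma> f i) S"
    using pseudo_jacobian_row_basis[of k] by blast
  have "pseudo_rank (ring_on (B_ring P (h + e - 1))) (Delta_trunc \<sigma> f P h) to_fract \<sigma> f k i
      = pseudo_rank class_ring P id \<sigma> f k i"
    using rank_hypothesis i unfolding rank_hypothesis_def Let_def h by metis
  thus ?thesis using mu_at_row_basis[OF S[OF i]] mu_at_eq_mu[OF i, of k] by simp
qed

text \<open>The count of parameters with U the variables of order at most i. The first i + 1 - e
  prolongations of f involve only these variables; the other k are the row blocks of the
  pseudo-Jacobian matrix, whose column blocks are the k remaining orders.\<close>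

lemma card_transcendence_basis:
  assumes i: "i \<ge> e - 1" and h: "h = i + 1 - e + k"
    and E: "E \<subseteq> vars_upto i" "polys_in E \<inter> contr h \<subseteq> {0}"
    and algebraic: "\<And>w. w \<in> vars_upto i - E \<Longrightarrow> \<exists>a\<in>polys_in (insert w E) \<inter> contr h. a \<noteq> 0"
  shows "card E + (i + 1 - e) * card (UNIV :: 'r set) + mu \<sigma> f P k = (i + 1) * card (UNIV :: 'n set)"
proof -
  define m where "m = i + 1 - e"
  have N: "h + e - 1 = i + k" and hm: "h = m + k" using i h ord by (auto simp: m_def)
  let ?L = "B_ring P (h + e - 1)" and ?I = "Delta_trunc \<sigma> f P h"
  let ?\<rho> = "\<lambda>u :: nat \<times> 'r. (i + fst u - e, snd u)" and ?\<gamma> = "\<lambda>v :: nat \<times> 'n. (snd v, i + fst v)"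
  interpret I: set_prime ?L ?I
    unfolding B_ring_eq Delta_trunc_eq by (rule reg.prime_gen_ideal)
  have in_rows: "?\<rho> u \<in> eqs h" if "u \<in> prows k" for u
    using that i ord by (auto simp: hm m_def)
  have entry: "to_fract (pseudo_jacobian \<sigma> f i u v) \<in> ?L" if "u \<in> prows k" for u v
    unfolding pseudo_jacobian_eq B_ring_eq
    by (rule reg.to_fract_in_L[OF dpartial_in_polys_in[OF reg.g_in[OF in_rows[OF that]]]])
  obtain S where S: "row_basis_mod ?L ?I (prows k) (pcols k) (\<lambda>u v. to_fract (pseudo_jacobian \<sigma> f i u v)) S"
    using I.exists_row_basis_mod[of "prows k" "pcols k" "\<lambda>u v. to_fract (pseudo_jacobian \<sigma> f i u v)"] entry by auto
  have "pseudo_rank (ring_on ?L) ?I to_fract \<sigma> f k i = card S"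
    unfolding pseudo_rank_def
    by (rule residue_hom.mat_rank_eq_card_row_basis[OF I.residue_hom _ _ _ S]) (use entry in auto)
  hence cS: "card S + mu \<sigma> f P k = k * card (UNIV :: 'r set)" using pseudo_rank_Delta[OF i h] by simp
  have inj: "inj_on ?\<rho> (prows k)" using i ord by (auto simp: inj_on_def)
  have SP: "S \<subseteq> prows k" using S unfolding row_basis_mod_def by blast
  have cols_eq: "?\<gamma> ` pcols k = vars_upto (h + e - 1) - vars_upto i"
  proof (intro equalityI subsetI)
    fix v assume v: "v \<in> vars_upto (h + e - 1) - vars_upto i"
    obtain b l where bl: "v = (b, l)" by (cases v)
    have "v = ?\<gamma> (l - i, b)" "(l - i, b) \<in> pcols k" using v bl N by auto
    thus "v \<in> ?\<gamma> ` pcols k" by (rule image_eqI)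
  qed (use N in auto)
  have "row_basis_mod ?L ?I (?\<rho> ` prows k) (vars_upto (h + e - 1) - vars_upto i)
      (\<lambda>u v. to_fract (dpartial v (gen u))) (?\<rho> ` S)"
    by (rule row_basis_mod_reindex[OF _ inj cols_eq]) (use S in \<open>simp only: pseudo_jacobian_eq\<close>)
  note T = this[unfolded B_ring_eq Delta_trunc_eq]
  have low: "gen u \<in> polys_in (vars_upto i)" if u: "u \<in> eqs h - ?\<rho> ` prows k" for u
  proof -
    have "fst u < m"
    proof (rule ccontr)
      assume "\<not> ?thesis"
      hence "u = ?\<rho> (fst u - m + 1, snd u)" "(fst u - m + 1, snd u) \<in> prows k"
        using u i ord by (auto simp: hm m_def prod_eq_iff)
      hence "u \<in> ?\<rho> ` prows k" by (rule image_eqI)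
      thus False using u by blast
    qed
    hence "fst u + e \<le> i" by (simp add: m_def)
    hence "vars_upto (fst u + e) \<subseteq> vars_upto i" by auto
    thus ?thesis using gen_vars[of u] polys_in_mono by blast
  qed
  have U: "vars_upto i \<subseteq> vars_upto (h + e - 1)" using N by auto
  have G1: "?\<rho> ` prows k \<subseteq> eqs h" using in_rows by blast
  have "card (vars_upto i) + card (?\<rho> ` S) = card (eqs h) + card E"
    by (rule reg.card_transcendence_basis[OF U E algebraic G1 low T])
  moreover have "card (?\<rho> ` S) = card S" using inj SP by (intro card_image) (rule inj_on_subset)
  ultimately show ?thesis using cS
    by (simp add: card_cartesian_product hm m_def algebra_simps)
qed

section \<open>The truncated ideals as a chain and their union\<close>

abbreviation "Del h \<equiv> Delta_trunc \<sigma> f P h"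
abbreviation "R_P \<equiv> localization UNIV P"
abbreviation "SigF \<equiv> fract_map Sig"

sublocale PF: idom_prime UNIV P
  by unfold_locales

lemma ideal_Del: "set_ideal (B_ring P (h + e - 1)) (Del h)"
  unfolding B_ring_eq Delta_trunc_eq by (rule reg.ideal_gen_ideal)

lemma Del_least:
  assumes "set_ideal (B_ring P (h + e - 1)) J" "\<And>l a. l < h \<Longrightarrow> to_fract (gen (l, a)) \<in> J"
  shows "Del h \<subseteq> J"
proof -
  have "to_fract ` gen ` eqs h \<subseteq> J" using assms(2) by auto
  with assms(1) show ?thesis unfolding B_ring_eq Delta_trunc_eq by (rule reg.gen_ideal_least)
qed

lemma gen_Del: "l < h \<Longrightarrow> to_fract (gen (l, a)) \<in> Del h"
  unfolding Delta_trunc_eq by (rule reg.gen_in_gen_ideal) simp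

lemma B_ring_mono: "N \<le> N' \<Longrightarrow> B_ring P N \<subseteq> B_ring P N'"
proof -
  assume "N \<le> N'"
  hence "vars_upto N \<subseteq> vars_upto N'" by auto
  hence sub: "polys_in (vars_upto N) \<subseteq> (polys_in (vars_upto N') :: ('n, 'k) dpoly set)"
    by (rule polys_in_mono)
  show "B_ring P N \<subseteq> B_ring P N'"
    unfolding B_ring_eq by (rule localization_mono[OF sub]) (use sub in blast)
qed

lemma B_ring_R_P: "B_ring P N \<subseteq> R_P"
  unfolding B_ring_eq by (rule localization_mono) auto

lemma set_ring_B: "set_ring (B_ring P N)"
proof -
  interpret p: idom_prime "polys_in (vars_upto N)" "prime_upto N"
    by (rule idom_prime.intro) (rule prime_prime_upto)
  show ?thesis unfolding B_ring_eq by (rule p.set_ring_L)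
qed

lemma Del_mono: "h \<le> h' \<Longrightarrow> Del h \<subseteq> Del h'"
proof -
  assume hh: "h \<le> h'"
  have N: "h + e - 1 \<le> h' + e - 1" using hh by simp
  have "Del h \<subseteq> B_ring P (h + e - 1) \<inter> Del h'"
  proof (rule Del_least[OF set_ideal_restrict[OF ideal_Del set_ring_B B_ring_mono[OF N]]])
    fix l a assume l: "l < h"
    have "to_fract (gen (l, a)) \<in> B_ring P (h + e - 1)"
      using gen_Del[OF l] set_ideal.in_R[OF ideal_Del] by blast
    moreover have "to_fract (gen (l, a)) \<in> Del h'" using l hh by (intro gen_Del) simp
    ultimately show "to_fract (gen (l, a)) \<in> B_ring P (h + e - 1) \<inter> Del h'" by blast
  qed
  thus "Del h \<subseteq> Del h'" by blast
qed

lemma R_P_B_ring: "x \<in> R_P \<Longrightarrow> \<exists>N. x \<in> B_ring P N"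
proof -
  assume "x \<in> R_P"
  then obtain a s where a: "s \<notin> P" "x = to_fract a / to_fract s" unfolding localization_def by blast
  have "\<exists>N. dvars b \<subseteq> vars_upto N" for b :: "('n, 'k) dpoly"
  proof -
    have "finite (snd ` dvars b)" by simp
    then obtain N where "\<forall>l\<in>snd ` dvars b. l \<le> N" using finite_nat_set_iff_bounded_le by blast
    thus ?thesis by (intro exI[of _ N]) auto
  qed
  then obtain N1 N2 where "dvars a \<subseteq> vars_upto N1" "dvars s \<subseteq> vars_upto N2" by metis
  hence "a \<in> polys_in (vars_upto (max N1 N2))" "s \<in> polys_in (vars_upto (max N1 N2))"
    by (auto simp: polys_in_def)
  hence "x \<in> B_ring P (max N1 N2)" unfolding B_ring_eq localization_def using a by blast
  thus ?thesis by blast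
qed

lemma SigF_to_fract: "SigF (to_fract a) = to_fract (Sig a)"
  by (rule fract_map_to_fract[OF hom_Sig inj_Sig])

lemma SigF_zero: "SigF 0 = 0"
  using SigF_to_fract[of 0] by (simp add: sigma_poly_zero)

lemma SigF_B_ring: "x \<in> B_ring P N \<Longrightarrow> SigF x \<in> B_ring P (Suc N)"
proof -
  assume "x \<in> B_ring P N"
  then obtain a s where a: "a \<in> polys_in (vars_upto N)" "s \<in> polys_in (vars_upto N)" "s \<notin> P"
    "x = to_fract a / to_fract s" unfolding B_ring_eq localization_def by blast
  have "s \<noteq> 0" using a(3) P.zero by metis
  hence "SigF x = to_fract (Sig a) / to_fract (Sig s)"
    using fract_map_eq[OF hom_Sig inj_Sig] a(4) by blast
  moreover have "Sig a \<in> polys_in (vars_upto (Suc N))" "Sig s \<in> polys_in (vars_upto (Suc N))"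
    using a(1,2) sigma_poly_in_polys_in by blast+
  moreover have "Sig s \<notin> P" using a(3) Sig_P_iff by blast
  ultimately show ?thesis unfolding B_ring_eq localization_def by blast
qed

lemma SigF_Del: "x \<in> Del h \<Longrightarrow> SigF x \<in> Del (Suc h)"
proof -
  interpret I: set_ideal "B_ring P (h + e - 1)" "Del h" by (rule ideal_Del)
  interpret I': set_ideal "B_ring P (Suc h + e - 1)" "Del (Suc h)" by (rule ideal_Del)
  have N: "Suc (h + e - 1) = Suc h + e - 1" using ord by simp
  let ?J = "{x \<in> B_ring P (h + e - 1). SigF x \<in> Del (Suc h)}"
  have "set_ideal (B_ring P (h + e - 1)) ?J"
  proof
    show "0 \<in> ?J" using I.zero_closed I'.zero by (simp only: SigF_zero mem_Collect_eq simp_thms)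
    show "x + y \<in> ?J" if "x \<in> ?J" "y \<in> ?J" for x y
    proof (intro CollectI conjI)
      show "x + y \<in> B_ring P (h + e - 1)" using that by (intro I.add_closed) blast+
      show "SigF (x + y) \<in> Del (Suc h)"
        unfolding fract_map_add[OF hom_Sig inj_Sig] using that by (intro I'.add) blast+
    qed
    show "r * x \<in> ?J" if "r \<in> B_ring P (h + e - 1)" "x \<in> ?J" for r x
    proof -
      have r: "SigF r \<in> B_ring P (Suc h + e - 1)" using SigF_B_ring[OF that(1)] N by simp
      show ?thesis
      proof (intro CollectI conjI)
        show "r * x \<in> B_ring P (h + e - 1)" using that by (intro I.mult_closed) blast+
        show "SigF (r * x) \<in> Del (Suc h)"
          unfolding fract_map_mult[OF hom_Sig inj_Sig] using that r by (intro I'.mult_left) blast+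
      qed
    qed
  qed auto
  moreover have "to_fract (gen (l, a)) \<in> ?J" if l: "l < h" for l a
  proof -
    have "SigF (to_fract (gen (l, a))) = to_fract (gen (Suc l, a))" by (simp add: SigF_to_fract gen_def)
    thus ?thesis using gen_Del[of "Suc l" "Suc h" a] gen_Del[OF l] l I.in_R by auto
  qed
  ultimately have "Del h \<subseteq> ?J" by (rule Del_least)
  thus "x \<in> Del h \<Longrightarrow> SigF x \<in> Del (Suc h)" by blast
qed

text \<open>The union is an ideal of the full local ring because every element of that ring has
  finite order, and it is stable because the shift raises the index h by one. Conversely, every
  stable ideal with f contains all prolongations of f.\<close>

lemma Delta_eq: "Delta \<sigma> f P = (\<Union>h. Del h)"
proof
  have ring: "set_ring R_P" by (rule PF.set_ring_L)
  show "Delta \<sigma> f P \<subseteq> (\<Union>h. Del h)"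
  proof -
    have "set_ideal R_P (\<Union>h. Del h)"
    proof (intro set_ideal.intro set_ideal_axioms.intro ring)
      show "(\<Union>h. Del h) \<subseteq> R_P" using set_ideal.in_R[OF ideal_Del] B_ring_R_P by blast
      show "0 \<in> (\<Union>h. Del h)" using set_ideal.zero[OF ideal_Del] by blast
      show "x + y \<in> (\<Union>h. Del h)" if xy: "x \<in> (\<Union>h. Del h)" "y \<in> (\<Union>h. Del h)" for x y
      proof -
        obtain h1 h2 where "x \<in> Del h1" "y \<in> Del h2" using xy by blast
        hence "x \<in> Del (max h1 h2)" "y \<in> Del (max h1 h2)"
          using Del_mono[of h1 "max h1 h2"] Del_mono[of h2 "max h1 h2"] by auto
        thus ?thesis using set_ideal.add[OF ideal_Del] by blast
      qed
      show "r * x \<in> (\<Union>h. Del h)" if r: "r \<in> R_P" and x: "x \<in> (\<Union>h. Del h)" for r x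
      proof -
        obtain N h where N: "r \<in> B_ring P N" and h: "x \<in> Del h" using R_P_B_ring[OF r] x by blast
        \<comment> \<open>Without e at least 1, the local ring belonging to index N could miss the
          variables of order N.\<close>
        have "N \<le> max h N + e - 1" using ord by simp
        hence "r \<in> B_ring P (max h N + e - 1)" using N B_ring_mono by blast
        moreover have "x \<in> Del (max h N)" using h Del_mono[of h "max h N"] by auto
        ultimately show ?thesis using set_ideal.mult_left[OF ideal_Del] by blast
      qed
    qed
    hence "sigma_ideal (ring_on R_P) SigF (\<Union>h. Del h)"
      unfolding sigma_ideal_def set_ring.ideal_iff[OF ring] using SigF_Del by blast
    moreover have "to_fract (f a) \<in> Del (Suc 0)" for a
      using gen_Del[of 0 "Suc 0" a] by (simp add: gen_def)
    ultimately show ?thesis unfolding Delta_def sigma_genideal_def by blast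
  qed
  show "(\<Union>h. Del h) \<subseteq> Delta \<sigma> f P"
    unfolding Delta_def sigma_genideal_def
  proof (intro Inter_greatest, elim CollectE conjE)
    fix J assume J: "sigma_ideal (ring_on R_P) SigF J" "range (\<lambda>a. to_fract (f a)) \<subseteq> J"
    have ideal_J: "set_ideal R_P J" and Sig_J: "\<And>x. x \<in> J \<Longrightarrow> SigF x \<in> J"
      using J(1) unfolding sigma_ideal_def set_ring.ideal_iff[OF ring] by blast+
    have gen_J: "to_fract (gen (l, a)) \<in> J" for l a
    proof (induction l)
      case 0
      show ?case using J(2) by (auto simp: gen_def)
    next
      case (Suc l)
      have "to_fract (gen (Suc l, a)) = SigF (to_fract (gen (l, a)))" by (simp add: SigF_to_fract gen_def)
      thus ?case using Sig_J[OF Suc] by simp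
    qed
    have "Del h \<subseteq> B_ring P (h + e - 1) \<inter> J" for h
    proof (rule Del_least[OF set_ideal_restrict[OF ideal_J set_ring_B B_ring_R_P]])
      fix l a assume "l < h"
      thus "to_fract (gen (l, a)) \<in> B_ring P (h + e - 1) \<inter> J"
        using gen_J gen_Del set_ideal.in_R[OF ideal_Del] by blast
    qed
    thus "(\<Union>h. Del h) \<subseteq> J" by blast
  qed
qed

subsection \<open>The stabilization of the chain\<close>

lemma Del_B_ring_iff:
  assumes "i \<le> h + e - 1" "a \<in> polys_in (vars_upto i)" "s \<in> polys_in (vars_upto i)" "s \<notin> P"
  shows "to_fract a / to_fract s \<in> Del h \<longleftrightarrow> a \<in> contr h"
  unfolding Delta_trunc_eq
proof (rule reg.to_fract_div_in_gen_ideal_iff)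
  have "vars_upto i \<subseteq> vars_upto (h + e - 1)" using assms(1) by auto
  thus "a \<in> polys_in (vars_upto (h + e - 1))" "s \<in> polys_in (vars_upto (h + e - 1))"
    using assms(2,3) polys_in_mono by blast+
qed (use assms(4) in blast)

text \<open>Denominators outside P do not affect membership, so the chain can be compared on
  polynomials, where transcendence bases are taken.\<close>

lemma Del_Int_B_ring_eq_iff:
  assumes "i \<le> h + e - 1" "i \<le> h' + e - 1"
  shows "Del h \<inter> B_ring P i = Del h' \<inter> B_ring P i \<longleftrightarrow>
    contr h \<inter> polys_in (vars_upto i) = contr h' \<inter> polys_in (vars_upto i)"
proof
  assume eq: "Del h \<inter> B_ring P i = Del h' \<inter> B_ring P i"
  have "a \<in> contr h \<longleftrightarrow> a \<in> contr h'" if a: "a \<in> polys_in (vars_upto i)" for a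
  proof -
    interpret A: set_ring "polys_in (vars_upto i) :: ('n, 'k) dpoly set" by (rule set_ring_polys_in)
    have "to_fract a / to_fract 1 \<in> B_ring P i"
      unfolding B_ring_eq localization_def using a A.one_closed P.one_notin by blast
    thus ?thesis
      using Del_B_ring_iff[OF assms(1) a A.one_closed P.one_notin]
        Del_B_ring_iff[OF assms(2) a A.one_closed P.one_notin] eq by blast
  qed
  thus "contr h \<inter> polys_in (vars_upto i) = contr h' \<inter> polys_in (vars_upto i)" by blast
next
  assume eq: "contr h \<inter> polys_in (vars_upto i) = contr h' \<inter> polys_in (vars_upto i)"
  have "x \<in> Del h \<longleftrightarrow> x \<in> Del h'" if x: "x \<in> B_ring P i" for x
  proof -
    obtain a s where a: "a \<in> polys_in (vars_upto i)" "s \<in> polys_in (vars_upto i)" "s \<notin> P"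
      "x = to_fract a / to_fract s" using x unfolding B_ring_eq localization_def by blast
    show ?thesis
      unfolding a(4) using Del_B_ring_iff[OF assms(1) a(1-3)] Del_B_ring_iff[OF assms(2) a(1-3)] eq a(1) by blast
  qed
  thus "Del h \<inter> B_ring P i = Del h' \<inter> B_ring P i" by blast
qed

lemma contr_mono: "h \<le> h' \<Longrightarrow> contr h \<subseteq> contr h'"
proof -
  assume hh: "h \<le> h'"
  hence "vars_upto (h + e - 1) \<subseteq> vars_upto (h' + e - 1)" by auto
  thus "contr h \<subseteq> contr h'"
    unfolding reg.contraction_def Delta_trunc_eq[symmetric] using Del_mono[OF hh] polys_in_mono by blast
qed

lemma extend_to_transcendence_basis:
  assumes "E0 \<subseteq> vars_upto i" "polys_in E0 \<inter> contr h \<subseteq> {0}"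
  obtains E where "E0 \<subseteq> E" "E \<subseteq> vars_upto i" "polys_in E \<inter> contr h \<subseteq> {0}"
    "\<And>w. w \<in> vars_upto i - E \<Longrightarrow> \<exists>a\<in>polys_in (insert w E) \<inter> contr h. a \<noteq> 0"
proof -
  let ?F = "\<lambda>E. E0 \<subseteq> E \<and> E \<subseteq> vars_upto i \<and> polys_in E \<inter> contr h \<subseteq> {0}"
  have fin: "finite (vars_upto i)" by simp
  have "?F E0" using assms by blast
  moreover have "card E < Suc (card (vars_upto i))" if "?F E" for E
    using that fin card_mono by (metis less_Suc_eq_le)
  ultimately obtain E where E: "?F E" and max: "\<And>E'. ?F E' \<Longrightarrow> card E' \<le> card E"
    using ex_has_greatest_nat[of ?F E0 card "Suc (card (vars_upto i))"] by blast
  have finE: "finite E" using E fin finite_subset by blast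
  show ?thesis
  proof (rule that)
    fix w assume w: "w \<in> vars_upto i - E"
    hence "\<not> ?F (insert w E)" using max[of "insert w E"] finE by auto
    with E w have "\<not> polys_in (insert w E) \<inter> contr h \<subseteq> {0}" by blast
    thus "\<exists>a\<in>polys_in (insert w E) \<inter> contr h. a \<noteq> 0" by blast
  qed (use E in blast)+
qed

lemma exists_transcendence_basis:
  obtains E where "E \<subseteq> vars_upto i" "polys_in E \<inter> contr h \<subseteq> {0}"
    "\<And>w. w \<in> vars_upto i - E \<Longrightarrow> \<exists>a\<in>polys_in (insert w E) \<inter> contr h. a \<noteq> 0"
proof -
  interpret q: prime_polys "vars_upto (h + e - 1)" "contr h"
    by (rule prime_polys.intro) (rule reg.prime_contraction)
  have "polys_in {} \<inter> contr h \<subseteq> {0}" using q.const_in_prime by blast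
  thus ?thesis
  proof (rule extend_to_transcendence_basis[OF empty_subsetI])
    fix E assume E: "{} \<subseteq> E" "E \<subseteq> vars_upto i" "polys_in E \<inter> contr h \<subseteq> {0}"
      "\<And>w. w \<in> vars_upto i - E \<Longrightarrow> \<exists>a\<in>polys_in (insert w E) \<inter> contr h. a \<noteq> 0"
    show ?thesis by (rule that[OF E(2-4)])
  qed
qed

text \<open>If the contractions agree, one transcendence basis serves both, and the two counts force
  equal \<open>mu\<close>. Conversely, a basis for the larger prime is still independent modulo the
  smaller one and extends to a basis there; equal \<open>mu\<close> gives equal sizes, so nothing
  was added, and \<open>prime_eq_of_algebraic\<close> identifies the primes.\<close>

lemma contr_eq_iff:
  assumes i: "i \<ge> e - 1" and h: "h = i + 1 - e + k"
  shows "contr h \<inter> polys_in (vars_upto i) = contr (Suc h) \<inter> polys_in (vars_upto i) \<longleftrightarrow>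
    mu \<sigma> f P k = mu \<sigma> f P (Suc k)"
proof
  have h': "Suc h = i + 1 - e + Suc k" using h by simp
  assume eq: "contr h \<inter> polys_in (vars_upto i) = contr (Suc h) \<inter> polys_in (vars_upto i)"
  obtain E where E: "E \<subseteq> vars_upto i" "polys_in E \<inter> contr h \<subseteq> {0}"
    "\<And>w. w \<in> vars_upto i - E \<Longrightarrow> \<exists>a\<in>polys_in (insert w E) \<inter> contr h. a \<noteq> 0"
    using exists_transcendence_basis[of i h] by blast
  have same: "polys_in W \<inter> contr h = polys_in W \<inter> contr (Suc h)" if "W \<subseteq> vars_upto i" for W
    using polys_in_mono[OF that] eq by blast
  have "card E + (i + 1 - e) * card (UNIV :: 'r set) + mu \<sigma> f P k = (i + 1) * card (UNIV :: 'n set)"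
    by (rule card_transcendence_basis[OF i h E])
  moreover have "card E + (i + 1 - e) * card (UNIV :: 'r set) + mu \<sigma> f P (Suc k) = (i + 1) * card (UNIV :: 'n set)"
  proof (rule card_transcendence_basis[OF i h' E(1)])
    show "polys_in E \<inter> contr (Suc h) \<subseteq> {0}" using E(2) same[OF E(1)] by simp
    fix w assume w: "w \<in> vars_upto i - E"
    hence "insert w E \<subseteq> vars_upto i" using E(1) by blast
    from E(3)[OF w] show "\<exists>a\<in>polys_in (insert w E) \<inter> contr (Suc h). a \<noteq> 0"
      unfolding same[OF \<open>insert w E \<subseteq> vars_upto i\<close>] .
  qed
  ultimately show "mu \<sigma> f P k = mu \<sigma> f P (Suc k)" by simp
next
  have h': "Suc h = i + 1 - e + Suc k" using h by simp
  assume mu: "mu \<sigma> f P k = mu \<sigma> f P (Suc k)"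
  obtain E where E: "E \<subseteq> vars_upto i" "polys_in E \<inter> contr (Suc h) \<subseteq> {0}"
    "\<And>w. w \<in> vars_upto i - E \<Longrightarrow> \<exists>a\<in>polys_in (insert w E) \<inter> contr (Suc h). a \<noteq> 0"
    using exists_transcendence_basis[of i "Suc h"] by blast
  have sub: "contr h \<subseteq> contr (Suc h)" by (rule contr_mono) simp
  have E_h: "polys_in E \<inter> contr h \<subseteq> {0}" using E(2) sub by blast
  obtain E' where E': "E \<subseteq> E'" "E' \<subseteq> vars_upto i"
    "polys_in E' \<inter> contr h \<subseteq> {0}"
    "\<And>w. w \<in> vars_upto i - E' \<Longrightarrow> \<exists>a\<in>polys_in (insert w E') \<inter> contr h. a \<noteq> 0"
    using extend_to_transcendence_basis[OF E(1) E_h] by blast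
  have "card E + (i + 1 - e) * card (UNIV :: 'r set) + mu \<sigma> f P (Suc k) = (i + 1) * card (UNIV :: 'n set)"
    by (rule card_transcendence_basis[OF i h' E])
  moreover have "card E' + (i + 1 - e) * card (UNIV :: 'r set) + mu \<sigma> f P k = (i + 1) * card (UNIV :: 'n set)"
    by (rule card_transcendence_basis[OF i h E'(2-4)])
  ultimately have "card E = card E'" using mu by simp
  moreover have "finite E'" using E'(2) by (rule finite_subset) simp
  ultimately have EE': "E = E'" using E'(1) card_subset_eq by blast
  have N: "vars_upto i \<subseteq> vars_upto (h + e - 1)" "vars_upto i \<subseteq> vars_upto (Suc h + e - 1)"
    using h i by auto
  have "polys_in (vars_upto i) \<inter> contr h = polys_in (vars_upto i) \<inter> contr (Suc h)"
  proof (rule prime_eq_of_algebraic)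
    show "set_prime (polys_in (vars_upto i)) (polys_in (vars_upto i) \<inter> contr h)"
      by (rule set_prime_restrict[OF reg.prime_contraction set_ring_polys_in polys_in_mono[OF N(1)]])
    show "set_prime (polys_in (vars_upto i)) (polys_in (vars_upto i) \<inter> contr (Suc h))"
      by (rule set_prime_restrict[OF reg.prime_contraction set_ring_polys_in polys_in_mono[OF N(2)]])
    show "polys_in E \<inter> (polys_in (vars_upto i) \<inter> contr (Suc h)) \<subseteq> {0}" using E(2) by blast
    show "\<exists>a\<in>polys_in (insert w E) \<inter> (polys_in (vars_upto i) \<inter> contr h). a \<noteq> 0"
      if w: "w \<in> vars_upto i - E" for w
    proof -
      have "insert w E \<subseteq> vars_upto i" using w E(1) by blast
      hence "polys_in (insert w E) \<subseteq> polys_in (vars_upto i)" by (rule polys_in_mono)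
      thus ?thesis using E'(4)[of w] w EE' by blast
    qed
  qed (use sub E(1) in auto)
  thus "contr h \<inter> polys_in (vars_upto i) = contr (Suc h) \<inter> polys_in (vars_upto i)" by blast
qed

text \<open>\<open>Delta\<close> cuts out the union of the chain in \<open>B_ring P i\<close>. The
  chain is constant from \<omega> on; before \<omega> each step is strict, so no earlier member can
  equal the union.\<close>

theorem difference_index:
  assumes \<omega>: "is_difference_index \<sigma> f P \<omega>" and i: "i \<ge> e - 1"
  shows "Del (i + 1 - e + \<omega>) \<inter> B_ring P i = Delta \<sigma> f P \<inter> B_ring P i"
    and "\<omega> = (LEAST h. Del (i + 1 - e + h) \<inter> B_ring P i = Delta \<sigma> f P \<inter> B_ring P i)"
proof -
  define m where "m = i + 1 - e"
  define C where "C k = Del (m + k) \<inter> B_ring P i" for k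
  have step: "C k = C (Suc k) \<longleftrightarrow> mu \<sigma> f P k = mu \<sigma> f P (Suc k)" for k
    using Del_Int_B_ring_eq_iff[of i "m + k" "Suc (m + k)"] contr_eq_iff[OF i refl, of k] i ord
    by (simp add: C_def m_def)
  have mono: "C k \<subseteq> C l" if "k \<le> l" for k l
    unfolding C_def using Del_mono[of "m + k" "m + l"] that by auto
  have Delta: "Delta \<sigma> f P \<inter> B_ring P i = (\<Union>k. C k)"
  proof -
    have "x \<in> (\<Union>k. C k)" if x: "x \<in> Del h" "x \<in> B_ring P i" for x h
      using x Del_mono[of h "m + h"] unfolding C_def by auto
    thus ?thesis unfolding Delta_eq C_def by blast
  qed
  have eq_le: "C l \<subseteq> C \<omega>" if "l \<ge> \<omega>" for l
    using that
  proof (induction l rule: dec_induct)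
    case (step l)
    have "mu \<sigma> f P l = mu \<sigma> f P (Suc l)" using \<omega> step.hyps unfolding is_difference_index_def by blast
    thus ?case using step.IH \<open>\<And>k. (C k = C (Suc k)) = (mu \<sigma> f P k = mu \<sigma> f P (Suc k))\<close> by blast
  qed simp
  have C_\<omega>: "C \<omega> = (\<Union>k. C k)"
  proof
    show "(\<Union>k. C k) \<subseteq> C \<omega>"
    proof (rule UN_least)
      fix k
      show "C k \<subseteq> C \<omega>" using mono[of k "max k \<omega>"] eq_le[of "max k \<omega>"] by simp
    qed
  qed blast
  show "Del (i + 1 - e + \<omega>) \<inter> B_ring P i = Delta \<sigma> f P \<inter> B_ring P i"
    unfolding Delta using C_\<omega> by (simp add: C_def m_def)
  show "\<omega> = (LEAST h. Del (i + 1 - e + h) \<inter> B_ring P i = Delta \<sigma> f P \<inter> B_ring P i)"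
  proof (rule Least_equality[symmetric])
    show "Del (i + 1 - e + \<omega>) \<inter> B_ring P i = Delta \<sigma> f P \<inter> B_ring P i" by fact
    fix h assume "Del (i + 1 - e + h) \<inter> B_ring P i = Delta \<sigma> f P \<inter> B_ring P i"
    hence Ch: "C h = (\<Union>k. C k)" unfolding Delta by (simp add: C_def m_def)
    show "\<omega> \<le> h"
    proof (rule ccontr)
      assume "\<not> \<omega> \<le> h"
      hence "mu \<sigma> f P h < mu \<sigma> f P (Suc h)" using \<omega> unfolding is_difference_index_def by simp
      moreover have "C (Suc h) \<subseteq> C h" unfolding Ch by blast
      hence "C h = C (Suc h)" using mono[of h "Suc h"] by simp
      ultimately show False using step[of h] by simp
    qed
  qed
qed

end

theorem theorem5p1:
  fixes \<sigma> :: "'k::field_char_0 \<Rightarrow> 'k"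
    and f :: "'r::finite \<Rightarrow> ('n::{finite,linorder}, 'k) dpoly"
    and P :: "('n, 'k) dpoly set"
    and \<omega> :: nat
  assumes "comm_ring_hom \<sigma>"
    and "max_ord f \<ge> 1"
    and "minimal_sigma_prime class_ring (sigma_poly \<sigma>) (range f) P"
    and "quasi_regular \<sigma> f P"
    and "rank_hypothesis \<sigma> f P"
    and "is_difference_index \<sigma> f P \<omega>"
  shows "(\<forall>i\<ge>max_ord f - 1.
            Delta_trunc \<sigma> f P (i + 1 - max_ord f + \<omega>) \<inter> B_ring P i = Delta \<sigma> f P \<inter> B_ring P i) \<and>
         (\<forall>i\<ge>max_ord f - 1.
            \<omega> = (LEAST h. Delta_trunc \<sigma> f P (i + 1 - max_ord f + h) \<inter> B_ring P i
                            = Delta \<sigma> f P \<inter> B_ring P i))"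
proof -
  have "range f \<subseteq> sigma_genideal class_ring (sigma_poly \<sigma>) (range f)"
    unfolding sigma_genideal_def by blast
  hence "difference_system \<sigma> f P"
    using assms(1-5) unfolding minimal_sigma_prime_def by (intro difference_system.intro) auto
  then interpret difference_system \<sigma> f P .
  show ?thesis using difference_index[OF assms(6)] by blast
qed

end
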